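(* Let $G$ be an $H$-type group with structure matrices $U^{(1)},\dots,U^{(m)}$, let $\lambda\in\mathbb R^m\setminus\{0\}$ and $p,q,k\in\mathbb Z_+$. Let $f\in L^1(\mathbb C^n)$ be of the form $f=gP$, where $g$ is radial and $P\in H^\lambda_{p,q}$. Then $$f\times_\lambda\varphi_{k,\lambda}^{n-1}(z)=(2\pi)^{-n}|\lambda|^{p+q}P(z)\;g\times_\lambda\varphi_{k-p,\lambda}^{n+p+q-1}(z')$$ if $k\ge p$, and $f\times_\lambda\varphi_{k,\lambda}^{n-1}(z)=0$ otherwise, where $z'\in\mathbb C^{n+p+q}$ is such that $|z'|=|z|$ and the convolution on the right is on $\mathbb C^{n+p+q}$.
   Context: **$H$-type group and twisted convolution.** $U^{(1)},\dots,U^{(m)}$ are real skew-symmetric orthogonal $2n\times2n$ matrices with $U^{(j)}U^{(l)}+U^{(l)}U^{(j)}=0$ for $j\ne l$; the $H$-type group is $\mathbb R^{2n}\times\mathbb R^m$ with law $(x,t)(\xi,\tau)=(x+\xi,(t_j+\tau_j+\frac12\langle x,U^{(j)}\xi\rangle)_j)$. Identify $x=(x_1,\dots,x_n,y_1,\dots,y_n)\in\mathbb R^{2n}$ with its complexification $z=(x_1+iy_1,\dots,x_n+iy_n)\in\mathbb C^n$; $U^{(j)}w$ denotes the complexification of $U^{(j)}\xi$ if $w$ is that of $\xi$, and $z\cdot w=\sum_jz_jw_j$. The $\lambda$-twisted convolution on $\mathbb C^n$ is $$f\times_\lambda h(z)=\int_{\mathbb C^n}f(z-w)h(w)\,e^{\frac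 i2\sum_{j=1}^m\lambda_j\mathrm{Re}(z\cdot\overline{U^{(j)}w})}\,dw.$$ On the right-hand side of the identity, radial functions are regarded as radial functions on $\mathbb C^N$, $N=n+p+q$, and $\times_\lambda$ there is the $|\lambda|$-twisted convolution $\int_{\mathbb C^N}g(z'-w)h(w)e^{\frac i2|\lambda|\mathrm{Im}(z'\cdot\bar w)}dw$ (which for radial $g,h$ is radial in $z'$). **Laguerre functions.** On $\mathbb C^N$, $\varphi_k^{N-1}(z)=L_k^{N-1}(\frac12|z|^2)e^{-\frac14|z|^2}$, with $L_k^{N-1}$ the Laguerre polynomial of degree $k$ and type $N-1$, and $\varphi_{k,\lambda}^{N-1}(z)=\varphi_k^{N-1}(|\lambda|^{1/2}z)$. **The space $H^\lambda_{p,q}$.** $V_\lambda=\sum_j\lambda_jU^{(j)}$ has eigenvalues $\pm i|\lambda|$ (each of multiplicity $n$). Let $u_j\pm iv_j$ ($1\le j\le n$) be eigenvectors for $\pm i|\lambda|$ chosen so that $A_\lambda=(\sqrt2v_1,\dots,\sqrt2v_n,\sqrt2u_1,\dots,\sqrt2u_n)$ is orthogonal; then $V_\lambda A_\lambda=A_\lambda\begin{pmatrix}0&-|\lambda|I\\|\lambda|I&0\end{pmatrix}$. If $z$ is the complexification of $x$, $\tilde z_\lambda$ is the complexification of $A_\lambda x$, and $f_\lambda(z)=f(\tilde z_\lambda)$. $H_{p,q}$ is the space of harmonic polynomials on $\mathbb C^n$ of the form $\sum_{|\alpha|=p,|\beta|=q}c_{\alpha\beta}z^\alpha\bar z^\beta$,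 and $H^\lambda_{p,q}=\{P\in\bigoplus_{p'+q'=p+q}H_{p',q'}:P_\lambda\in H_{p,q}\}$.
   Formalization: The constant (2π)^{-n} is replaced by (2π)^{-(p+q)}: as printed the identity fails, e.g. for p=q=0, P=1, n=1, k=0, g(z)=exp(-|λ||z|²/4), z=0, where the left side is 2π/|λ| and the right side is 1/|λ|. *)

theory Defs
  imports "HOL-Analysis.Analysis"
begin

text \<open>
  The index type \<open>'n + 'n\<close> (with \<open>n = CARD('n)\<close>) labels the coordinates
  \<open>(x_1, ..., x_n, y_1, ..., y_n)\<close> of \<open>R^{2n}\<close>: \<open>x_j\<close> sits at \<open>Inl j\<close> and \<open>y_j\<close> at \<open>Inr j\<close>.
\<close>

definition cplx :: "real ^ ('n + 'n) \<Rightarrow> complex ^ 'n::finite" where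
  "cplx x = (\<chi> j. Complex (x $ Inl j) (x $ Inr j))"

definition realify :: "complex ^ 'n::finite \<Rightarrow> real ^ ('n + 'n)" where
  "realify z = (\<chi> i. case i of Inl j \<Rightarrow> Re (z $ j) | Inr j \<Rightarrow> Im (z $ j))"

lemma cplx_realify [simp]: "cplx (realify z) = z"
  by (simp add: cplx_def realify_def vec_eq_iff complex_eq_iff)

lemma realify_cplx [simp]: "realify (cplx x) = x"
  by (simp add: cplx_def realify_def vec_eq_iff split: sum.split)

definition act :: "real ^ ('n + 'n) ^ ('n + 'n) \<Rightarrow> complex ^ 'n::finite \<Rightarrow> complex ^ 'n" where
  "act M z = cplx (M *v realify z)"

definition cdot :: "complex ^ 'N::finite \<Rightarrow> complex ^ 'N \<Rightarrow> complex" where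
  "cdot z w = (\<Sum>j\<in>UNIV. z $ j * w $ j)"

definition cconj :: "complex ^ 'N::finite \<Rightarrow> complex ^ 'N" where
  "cconj z = (\<chi> j. cnj (z $ j))"

definition h_type :: "('m::finite \<Rightarrow> real ^ ('n + 'n) ^ ('n::finite + 'n)) \<Rightarrow> bool" where
  "h_type U \<longleftrightarrow>
     (\<forall>j. transpose (U j) = - U j \<and> orthogonal_matrix (U j)) \<and>
     (\<forall>j l. j \<noteq> l \<longrightarrow> U j ** U l + U l ** U j = 0)"

definition Vmat :: "('m::finite \<Rightarrow> real ^ ('n + 'n) ^ ('n::finite + 'n)) \<Rightarrow> real ^ 'm
    \<Rightarrow> real ^ ('n + 'n) ^ ('n + 'n)" where
  "Vmat U lam = (\<Sum>j\<in>UNIV. lam $ j *\<^sub>R U j)"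

definition complex_eigenvector :: "real ^ 'd ^ 'd \<Rightarrow> complex \<Rightarrow> complex ^ 'd::finite \<Rightarrow> bool" where
  "complex_eigenvector M c w \<longleftrightarrow>
     w \<noteq> 0 \<and> (\<chi> i l. complex_of_real (M $ i $ l)) *v w = c *s w"

text \<open>The matrix \<open>(sqrt 2 v_1, ..., sqrt 2 v_n, sqrt 2 u_1, ..., sqrt 2 u_n)\<close>, given by its columns.\<close>

definition frame_matrix :: "('n \<Rightarrow> real ^ ('n + 'n)) \<Rightarrow> ('n \<Rightarrow> real ^ ('n + 'n))
    \<Rightarrow> real ^ ('n + 'n) ^ ('n::finite + 'n)" where
  "frame_matrix u v = (\<chi> i c. case c of Inl j \<Rightarrow> sqrt 2 * v j $ i | Inr j \<Rightarrow> sqrt 2 * u j $ i)"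

definition adapted_matrix :: "('m::finite \<Rightarrow> real ^ ('n + 'n) ^ ('n::finite + 'n)) \<Rightarrow> real ^ 'm
    \<Rightarrow> real ^ ('n + 'n) ^ ('n + 'n) \<Rightarrow> bool" where
  "adapted_matrix U lam A \<longleftrightarrow> (\<exists>u v.
     (\<forall>j. complex_eigenvector (Vmat U lam) (\<i> * of_real (norm lam))
            (\<chi> i. Complex (u j $ i) (v j $ i)) \<and>
          complex_eigenvector (Vmat U lam) (- \<i> * of_real (norm lam))
            (\<chi> i. Complex (u j $ i) (- v j $ i))) \<and>
     A = frame_matrix u v \<and> orthogonal_matrix A)"

text \<open>
  Both twisted convolutions use unnormalised Lebesgue measure, on \<open>C^n\<close> and on \<open>C^N\<close>
  respectively. With this normalisation the scaled Laguerre functions on \<open>C^N\<close> satisfy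
  \<open>\<phi> \<times> \<phi> = (2 \<pi> / |\<lambda>|)^N \<phi>\<close>, so the factor relating the convolutions on \<open>C^n\<close> and on
  \<open>C^{n+p+q}\<close> in the Hecke-Bochner identity is \<open>(2 \<pi> / |\<lambda>|)^{-(p+q)}\<close>. The factor
  \<open>(2 \<pi>)^{-n} |\<lambda>|^{p+q}\<close> found in the literature is inconsistent with it unless \<open>p + q = n\<close>:
  for \<open>p = q = 0\<close> both convolutions coincide.
\<close>

definition twisted_conv :: "('m::finite \<Rightarrow> real ^ ('n + 'n) ^ ('n::finite + 'n)) \<Rightarrow> real ^ 'm
    \<Rightarrow> (complex ^ 'n \<Rightarrow> complex) \<Rightarrow> (complex ^ 'n \<Rightarrow> complex) \<Rightarrow> complex ^ 'n \<Rightarrow> complex" where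
  "twisted_conv U lam f h z =
     (LINT w|lebesgue. f (z - w) * h w *
        exp (\<i> / 2 * of_real (\<Sum>j\<in>UNIV. lam $ j * Re (cdot z (cconj (act (U j) w))))))"

definition scalar_twisted_conv :: "real \<Rightarrow> (complex ^ 'N::finite \<Rightarrow> complex)
    \<Rightarrow> (complex ^ 'N \<Rightarrow> complex) \<Rightarrow> complex ^ 'N \<Rightarrow> complex" where
  "scalar_twisted_conv c g h z =
     (LINT w|lebesgue. g (z - w) * h w *
        exp (\<i> / 2 * of_real c * of_real (Im (cdot z (cconj w)))))"

definition laguerre :: "nat \<Rightarrow> nat \<Rightarrow> real \<Rightarrow> real" where
  "laguerre a k x = (\<Sum>i\<le>k. (- 1) ^ i * real ((k + a) choose (k - i)) * x ^ i / fact i)"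

text \<open>The Laguerre function \<open>\<phi>_k^{N-1}\<close> on \<open>C^N\<close>; the type \<open>N - 1\<close> is read off the domain.\<close>

definition laguerre_fun :: "nat \<Rightarrow> complex ^ 'N::finite \<Rightarrow> complex" where
  "laguerre_fun k z =
     of_real (laguerre (CARD('N) - 1) k ((norm z)\<^sup>2 / 2) * exp (- (norm z)\<^sup>2 / 4))"

definition laguerre_fun_scaled :: "nat \<Rightarrow> real ^ 'm::finite \<Rightarrow> complex ^ 'N::finite \<Rightarrow> complex" where
  "laguerre_fun_scaled k lam z = laguerre_fun k (sqrt (norm lam) *\<^sub>R z)"

definition cmonomial :: "('n \<Rightarrow> nat) \<Rightarrow> ('n \<Rightarrow> nat) \<Rightarrow> complex ^ 'n::finite \<Rightarrow> complex" where
  "cmonomial \<alpha> \<beta> z = (\<Prod>j\<in>UNIV. z $ j ^ \<alpha> j * cnj (z $ j) ^ \<beta> j)"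

definition multiindices :: "nat \<Rightarrow> ('n::finite \<Rightarrow> nat) set" where
  "multiindices p = {\<alpha>. sum \<alpha> UNIV = p}"

lemma finite_multiindices [simp]: "finite (multiindices p :: ('n::finite \<Rightarrow> nat) set)"
proof (rule finite_subset)
  have "\<alpha> j \<le> sum \<alpha> UNIV" for \<alpha> :: "'n \<Rightarrow> nat" and j
    by (rule member_le_sum) auto
  then show "(multiindices p :: ('n \<Rightarrow> nat) set) \<subseteq> (UNIV \<rightarrow>\<^sub>E {..p})"
    by (auto simp: multiindices_def)
qed (auto intro!: finite_PiE)

text \<open>
  The Laplacian of the underlying real space: \<open>Basis\<close> of \<open>complex ^ 'n\<close> consists of the \<open>2n\<close>
  real coordinate directions. It is only applied to polynomials, so the derivatives exist.
\<close>

definition laplacian :: "('a::euclidean_space \<Rightarrow> complex) \<Rightarrow> 'a \<Rightarrow> complex" where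
  "laplacian P z = (\<Sum>b\<in>Basis.
     vector_derivative (\<lambda>s. vector_derivative (\<lambda>t. P (z + t *\<^sub>R b)) (at s)) (at 0))"

definition Hpq :: "nat \<Rightarrow> nat \<Rightarrow> (complex ^ 'n::finite \<Rightarrow> complex) set" where
  "Hpq p q = {P.
     (\<exists>c. P = (\<lambda>z. \<Sum>\<alpha>\<in>multiindices p. \<Sum>\<beta>\<in>multiindices q. c \<alpha> \<beta> * cmonomial \<alpha> \<beta> z)) \<and>
     (\<forall>z. laplacian P z = 0)}"

definition Hdeg :: "nat \<Rightarrow> (complex ^ 'n::finite \<Rightarrow> complex) set" where
  "Hdeg d = {P. \<exists>Q. (\<forall>p\<le>d. Q p \<in> Hpq p (d - p)) \<and> P = (\<lambda>z. \<Sum>p\<le>d. Q p z)}"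

definition Hpq_twisted :: "real ^ ('n + 'n) ^ ('n + 'n) \<Rightarrow> nat \<Rightarrow> nat
    \<Rightarrow> (complex ^ 'n::finite \<Rightarrow> complex) set" where
  "Hpq_twisted A p q = {P \<in> Hdeg (p + q). (\<lambda>z. P (act A z)) \<in> Hpq p q}"

end

theory Submission
  imports Defs "HOL-Probability.Distributions"
begin

text \<open>
  Write \<open>c = |\<lambda>|\<close>, \<open>X = z \<cdot> cnj w\<close>, \<open>Y = cnj z \<cdot> w\<close> and \<open>N = n + p + q\<close>.

  The orthogonal change of variables \<open>w \<mapsto> A w\<close> turns the phase of the \<open>\<lambda>\<close>-twisted
  convolution into \<open>c Im(z \<cdot> cnj w)\<close> and \<open>P\<close> into an element of \<open>H_{p,q}\<close>
  (\<open>twisted_conv_adapted\<close>), so it suffices to treat the scalar twisted convolution and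
  \<open>P \<in> H_{p,q}\<close>. After the reflection \<open>w \<mapsto> z - w\<close> the convolution integrates \<open>g(|w|) P(w)\<close>
  against the kernel
  \<open>exp(-c(|z|^2 + |w|^2)/4) L_k^{n-1}(c(|z|^2 + |w|^2 - X - Y)/2) exp(cY/2)\<close>, which is a
  power series in \<open>X\<close> and \<open>Y\<close> with coefficients that depend only on \<open>|w|\<close>.

  The heart of the proof is that, against a radial weight \<open>G\<close>, the integral of \<open>P X^s Y^b\<close>
  vanishes unless \<open>s = p + l\<close> and \<open>b = q + l\<close> for some \<open>l \<ge> 0\<close>, and otherwise equals
  \<open>\<pi>^n s! b! / l! |z|^{2l} P(z) * 2 / (N + l - 1)!\<close> times the integral of
  \<open>G(r) r^{2(N+l)-1}\<close> over \<open>r > 0\<close> (\<open>radial_moment\<close>). Apart from \<open>s! b!\<close>, \<open>\<pi>^n\<close> and \<open>P(z)\<close>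
  this depends on the dimension and the bidegree through \<open>N\<close> alone. That is why a
  convolution on \<open>C^n\<close> turns into one on \<open>C^N\<close>.

  Two facts give this moment formula. By homogeneity, the integral of \<open>P X^s Y^b G(|w|)\<close> is
  a constant times a one-dimensional integral of \<open>G\<close> (\<open>radial_pushforward\<close>), so \<open>G\<close> may be
  taken Gaussian. For Gaussian \<open>G\<close>, integration by parts turns multiplication by \<open>X\<close> and \<open>Y\<close>
  into the Wirtinger derivatives in the directions \<open>z\<close> and \<open>cnj z\<close> (\<open>wick\<close>). These
  derivatives preserve harmonicity and lower the bidegree, and a harmonic polynomial of
  bidegree other than \<open>(0, 0)\<close> has Gaussian integral zero; this yields a recursion in \<open>s\<close>
  and \<open>b\<close> (\<open>gaussian_integral_moment\<close>).

  The kernel is expanded by Taylor's formula for Laguerre polynomials, in which each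
  derivative raises the type and lowers the degree by one; the factor \<open>exp(cY/2)\<close> is
  expanded only inside the integral, where a single term of its series survives
  (\<open>exp_moment\<close>). Vandermonde's identity collects the powers of \<open>Y\<close> that come from the
  Laguerre polynomial and from the exponential. The outcome is
  \<open>(c/2)^{p+q} \<pi>^n P(z) S(N, k - p)\<close> with an explicit radial expression \<open>S\<close>, or zero if
  \<open>k < p\<close> (\<open>scalar_hecke_bochner\<close>). Applied on \<open>C^N\<close> to the constant polynomial 1, the same
  formula gives \<open>\<pi>^N S(N, k - p)\<close>, and the quotient of the two is \<open>(c / 2\<pi>)^{p+q} P(z)\<close>.

  One measure-theoretic point remains: \<open>g P\<close> is only Lebesgue integrable. If \<open>P \<noteq> 0\<close>, then
  \<open>g\<close> agrees almost everywhere on \<open>(0, \<infinity>)\<close> with a Borel function (\<open>radial_profile_borel\<close>),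
  and radial null sets are null in every dimension, so on both sides \<open>g\<close> can be replaced by
  that Borel function.
\<close>

section \<open>Bilinear algebra on complex vectors\<close>

lemma cdot_add: "cdot a (x + y) = cdot a x + cdot a y"
  and cdot_scale: "cdot a (c *s x) = c * cdot a x"
  and cdot_scale_left: "cdot (c *s a) x = c * cdot a x"
  and cdot_scaleR: "cdot a (r *\<^sub>R x) = r *\<^sub>R cdot a x"
  and cdot_commute: "cdot a x = cdot x a"
  by (simp_all add: cdot_def sum_distrib_left sum.distrib scaleR_sum_right algebra_simps)

lemma cdot_minus_left: "cdot (- x) y = - cdot x y"
  by (simp add: cdot_def sum_negf)

lemma cdot_minus_right: "cdot x (- y) = - cdot x y"
  by (simp add: cdot_def sum_negf)

lemma cdot_axis: "cdot (axis j 1) x = x $ j"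
proof -
  have "cdot (axis j 1) x = (\<Sum>k\<in>UNIV. if k = j then x $ k else 0)"
    unfolding cdot_def by (rule sum.cong) (auto simp: axis_def)
  then show ?thesis by simp
qed

lemma cconj_add: "cconj (x + y) = cconj x + cconj y"
  and cconj_scale: "cconj (c *s x) = cnj c *s cconj x"
  and cconj_scaleR: "cconj (r *\<^sub>R x) = r *\<^sub>R cconj x"
  and cconj_cconj [simp]: "cconj (cconj x) = x"
  and cnj_cdot: "cnj (cdot x y) = cdot (cconj x) (cconj y)"
  by (simp_all add: cconj_def vec_eq_iff cdot_def)

lemma cdot_cconj_self: "cdot z (cconj z) = of_real ((norm z)\<^sup>2)"
  by (simp add: cdot_def cconj_def norm_vec_def L2_set_def sum_nonneg complex_norm_square[symmetric])

lemma Re_cdot_cconj: "Re (cdot x (cconj y)) = x \<bullet> y"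
  by (simp add: cdot_def cconj_def inner_vec_def inner_complex_def)

lemma norm_cdot_le: "norm (cdot x y) \<le> norm x * norm y"
proof -
  have "norm (cdot x y) \<le> (\<Sum>j\<in>UNIV. \<bar>norm (x $ j)\<bar> * \<bar>norm (y $ j)\<bar>)"
    by (simp add: cdot_def sum_norm_le norm_mult)
  also have "\<dots> \<le> norm x * norm y"
    unfolding norm_vec_def by (rule L2_set_mult_ineq)
  finally show ?thesis .
qed

lemma norm_cconj [simp]: "norm (cconj x) = norm x"
  by (simp add: norm_vec_def cconj_def)

lemma axis_expansion: "w = (\<Sum>j\<in>UNIV. w $ j *s axis j 1)" for w :: "complex ^ 'n::finite"
proof -
  have "(\<Sum>j\<in>UNIV. (w $ j *s axis j 1) $ i) = (\<Sum>j\<in>UNIV. if j = i then w $ j else 0)" for i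
    by (rule sum.cong) (auto simp: axis_def)
  then show ?thesis by (simp add: vec_eq_iff)
qed

lemma cconj_axis: "cconj (axis j 1) = axis j 1"
  by (auto simp: cconj_def axis_def vec_eq_iff)

lemma continuous_on_cdot [continuous_intros]:
  "continuous_on S f \<Longrightarrow> continuous_on S g \<Longrightarrow> continuous_on S (\<lambda>x. cdot (f x) (g x))"
  unfolding cdot_def by (intro continuous_intros)

lemma continuous_on_cconj [continuous_intros]:
  "continuous_on S f \<Longrightarrow> continuous_on S (\<lambda>x. cconj (f x))"
  unfolding cconj_def by (intro continuous_intros)

section \<open>Symmetries of Lebesgue measure\<close>

lemma nn_integral_lborel_translate:
  fixes f :: "'a::euclidean_space \<Rightarrow> ennreal"
  assumes [measurable]: "f \<in> borel_measurable borel"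
  shows "(\<integral>\<^sup>+x. f (c + x) \<partial>lborel) = (\<integral>\<^sup>+x. f x \<partial>lborel)"
proof -
  have "(\<integral>\<^sup>+x. f x \<partial>lborel) = (\<integral>\<^sup>+x. f x \<partial>distr lborel borel ((+) c))"
    by (simp add: lborel_distr_plus)
  also have "\<dots> = (\<integral>\<^sup>+x. f (c + x) \<partial>lborel)"
    by (subst nn_integral_distr) auto
  finally show ?thesis ..
qed

text \<open>
  The usual uniqueness argument for translation-invariant measures, carried out for the pair
  of Lebesgue measure and its image under \<open>T\<close>: after two translations and two applications
  of Fubini's theorem, the product of the measure of \<open>A\<close> and the measure \<open>V\<close> of the unit
  ball becomes \<open>V\<close> times the image measure of \<open>A\<close>. The unit ball is the right test set
  because \<open>T\<close> maps it to itself.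
\<close>
lemma lborel_distr_orthogonal_transformation:
  fixes T :: "'a::euclidean_space \<Rightarrow> 'a"
  assumes T: "orthogonal_transformation T"
  shows "distr lborel borel T = lborel"
proof (rule measure_eqI)
  have lin: "linear T" and bij: "bij T" and nrm: "\<And>x. norm (T x) = norm x"
    using T by (auto simp: orthogonal_transformation_linear orthogonal_transformation_bij
        orthogonal_transformation_norm)
  have [measurable]: "T \<in> borel_measurable borel"
    using lin by (intro borel_measurable_continuous_onI linear_continuous_on)
      (simp add: linear_conv_bounded_linear)
  fix A :: "'a set" assume "A \<in> sets (distr lborel borel T)"
  then have [measurable]: "A \<in> sets borel" by simp
  let ?B = "ball (0::'a) 1"
  have [measurable]: "?B \<in> sets borel" by simp
  define V where "V = emeasure lborel ?B"
  have V: "V \<noteq> 0" "V \<noteq> \<infinity>"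
    unfolding V_def using unit_ball_vol_pos[of "real DIM('a)"] by (auto simp: emeasure_ball simp del: unit_ball_vol_pos)
  have "emeasure lborel A * V = (\<integral>\<^sup>+y. (\<integral>\<^sup>+x. indicator A x * indicator ?B y \<partial>lborel) \<partial>lborel)"
    by (subst nn_integral_multc; simp add: nn_integral_cmult_indicator V_def)
  also have "\<dots> = (\<integral>\<^sup>+y. (\<integral>\<^sup>+x. indicator A (T y + x) * indicator ?B y \<partial>lborel) \<partial>lborel)"
  proof (rule nn_integral_cong)
    fix y :: 'a
    show "(\<integral>\<^sup>+x. indicator A x * indicator ?B y \<partial>lborel) =
        (\<integral>\<^sup>+x. indicator A (T y + x) * indicator ?B y \<partial>lborel)"
      using nn_integral_lborel_translate[of "\<lambda>x. indicator A x * indicator ?B y" "T y"] by simp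
  qed
  also have "\<dots> = (\<integral>\<^sup>+x. (\<integral>\<^sup>+y. indicator A (T y + x) * indicator ?B (T y) \<partial>lborel) \<partial>lborel)"
    by (subst lborel_pair.Fubini') (auto simp: indicator_def nrm)
  also have "\<dots> = (\<integral>\<^sup>+x. (\<integral>\<^sup>+y. indicator A (T y) * indicator ?B (T y - x) \<partial>lborel) \<partial>lborel)"
  proof (rule nn_integral_cong)
    fix x :: 'a
    have *: "T (inv T x + y) = x + T y" for y
      using lin bij by (simp add: linear_add bij_is_surj surj_f_inv_f)
    show "(\<integral>\<^sup>+y. indicator A (T y + x) * indicator ?B (T y) \<partial>lborel) =
        (\<integral>\<^sup>+y. indicator A (T y) * indicator ?B (T y - x) \<partial>lborel)"
    proof -
      have "(\<lambda>y. indicator A (T y) * indicator ?B (T y - x) :: ennreal) \<in> borel_measurable borel"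
        by measurable
      from nn_integral_lborel_translate[OF this, of "inv T x"] show ?thesis
        by (simp add: * add.commute[of "T _" x])
    qed
  qed
  also have "\<dots> = (\<integral>\<^sup>+y. (\<integral>\<^sup>+x. indicator A (T y) * indicator (ball (T y) 1) x \<partial>lborel) \<partial>lborel)"
    by (subst lborel_pair.Fubini') (auto simp: indicator_def dist_norm norm_minus_commute)
  also have "\<dots> = (\<integral>\<^sup>+y. indicator A (T y) * V \<partial>lborel)"
    by (simp add: nn_integral_cmult_indicator V_def emeasure_ball)
  also have "\<dots> = emeasure (distr lborel borel T) A * V"
  proof -
    have "(\<integral>\<^sup>+y. indicator A (T y) \<partial>lborel) = (\<integral>\<^sup>+y. indicator A y \<partial>distr lborel borel T)"
      by (subst nn_integral_distr) auto
    also have "\<dots> = emeasure (distr lborel borel T) A"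
      by (rule nn_integral_indicator) simp
    finally show ?thesis
      by (subst nn_integral_multc) simp_all
  qed
  \<comment> \<open>\<open>V\<close> is positive and finite, so it cancels.\<close>
  finally have "emeasure lborel A * V / V = emeasure (distr lborel borel T) A * V / V"
    by (rule arg_cong)
  then show "emeasure (distr lborel borel T) A = emeasure lborel A"
    using V by (simp add: ennreal_mult_divide_eq)
qed simp

lemma nn_integral_lborel_scale:
  fixes f :: "'a::euclidean_space \<Rightarrow> ennreal"
  assumes [measurable]: "f \<in> borel_measurable borel" and "c > 0"
  shows "(\<integral>\<^sup>+x. f x \<partial>lborel) = ennreal (c ^ DIM('a)) * (\<integral>\<^sup>+x. f (c *\<^sub>R x) \<partial>lborel)"
  using \<open>c > 0\<close>
  by (subst lborel_affine[of c 0]) (simp_all add: nn_integral_density nn_integral_distr nn_integral_cmult)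

lemma lborel_distr_reflect:
  fixes z :: "'a::euclidean_space"
  shows "distr lborel borel (\<lambda>x. z - x) = lborel"
  by (subst lborel_affine[of "-1" z]) (simp_all add: density_1 distr_distr o_def)

lemma lborel_integral_reflect:
  fixes f :: "'a::euclidean_space \<Rightarrow> complex"
  assumes [measurable]: "f \<in> borel_measurable borel"
  shows "(LINT w|lborel. f (z - w)) = (LINT w|lborel. f w)"
proof -
  have "(LINT w|lborel. f w) = (LINT w|distr lborel borel (\<lambda>x. z - x). f w)"
    by (simp add: lborel_distr_reflect)
  also have "\<dots> = (LINT w|lborel. f (z - w))"
    by (rule integral_distr) measurable
  finally show ?thesis ..
qed

text \<open>
  By Fubini's theorem and translation invariance, the integral of \<open>f'\<close> over space equals its
  average over the segments from \<open>w\<close> to \<open>w + e\<close>. By the fundamental theorem of calculus this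
  is the integral of \<open>f(w + e) - f(w)\<close>, which is zero, again by translation invariance.
\<close>
lemma integral_directional_derivative_eq_0:
  fixes f f' :: "'a::euclidean_space \<Rightarrow> complex"
  assumes f: "integrable lborel f" and f': "integrable lborel f'" and cont: "continuous_on UNIV f'"
    and der: "\<And>w t. ((\<lambda>t. f (w + t *\<^sub>R e)) has_vector_derivative f' (w + t *\<^sub>R e)) (at t)"
  shows "(LINT w|lborel. f' w) = 0"
proof -
  have [measurable]: "f' \<in> borel_measurable borel"
    using cont by (rule borel_measurable_continuous_onI)
  have shift: "integrable lborel (\<lambda>w. g (w + c))" "(LINT w|lborel. g (w + c)) = (LINT w|lborel. g w)"
    if "integrable lborel g" for g :: "'a \<Rightarrow> 'b::{banach, second_countable_topology}" and c
  proof -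
    have g: "integrable (distr lborel borel ((+) c)) g"
      using that by (simp add: lborel_distr_plus)
    have [measurable]: "g \<in> borel_measurable borel"
      using borel_measurable_integrable[OF that] by simp
    show "integrable lborel (\<lambda>w. g (w + c))"
      using g by (subst (asm) integrable_distr_eq) (auto simp: add.commute)
    have "(LINT w|lborel. g w) = (LINT w|distr lborel borel ((+) c). g w)"
      by (simp add: lborel_distr_plus)
    also have "\<dots> = (LINT w|lborel. g (w + c))"
      by (subst integral_distr) (auto simp: add.commute)
    finally show "(LINT w|lborel. g (w + c)) = (LINT w|lborel. g w)" ..
  qed
  let ?F = "\<lambda>(t::real, w). indicator {0..1} t *\<^sub>R f' (w + t *\<^sub>R e)"
  have int: "integrable (lborel \<Otimes>\<^sub>M lborel) ?F"
  proof (rule lborel_pair.Fubini_integrable)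
    show "?F \<in> borel_measurable (lborel \<Otimes>\<^sub>M lborel)"
      by measurable
    have *: "(\<lambda>t. LINT w|lborel. norm (?F (t, w))) = (\<lambda>t. indicator {0..1} t * (LINT w|lborel. norm (f' w)))"
      using shift(2)[of "\<lambda>w. norm (f' w)"] f' by auto
    show "integrable lborel (\<lambda>t. LINT w|lborel. norm (?F (t, w)))"
      unfolding * by simp
    show "AE t in lborel. integrable lborel (\<lambda>w. ?F (t, w))"
      using shift(1)[OF f'] by simp
  qed
  have "(LINT w|lborel. f' w) = (LINT t|lborel. indicator {0..1} (t::real) *\<^sub>R (LINT w|lborel. f' w))"
    by simp
  also have "\<dots> = (LINT t|lborel. LINT w|lborel. ?F (t, w))"
    using shift(2)[OF f'] by simp
  also have "\<dots> = (LINT w|lborel. LINT t|lborel. ?F (t, w))"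
    using lborel_pair.Fubini_integral[OF int] by simp
  also have "\<dots> = (LINT w|lborel. f (w + 1 *\<^sub>R e) - f (w + 0 *\<^sub>R e))"
  proof (rule Bochner_Integration.integral_cong)
    fix w :: 'a
    have "(LINT t|lborel. indicator {0..1} t *\<^sub>R f' (w + t *\<^sub>R e)) = f (w + 1 *\<^sub>R e) - f (w + 0 *\<^sub>R e)"
    proof (rule integral_FTC_Icc)
      show "continuous_on {0..1} (\<lambda>t. f' (w + t *\<^sub>R e))"
        by (intro continuous_on_compose2[OF cont] continuous_intros) auto
      show "((\<lambda>t. f (w + t *\<^sub>R e)) has_vector_derivative f' (w + t *\<^sub>R e)) (at t within {0..1})" for t
        using der by (rule has_vector_derivative_at_within)
    qed simp
    then show "(LINT t|lborel. ?F (t, w)) = f (w + 1 *\<^sub>R e) - f (w + 0 *\<^sub>R e)"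
      by simp
  qed simp
  also have "\<dots> = 0"
    using shift[OF f, of e] f by simp
  finally show ?thesis .
qed

section \<open>Integrals of homogeneous functions against radial weights\<close>

text \<open>
  Polar coordinates in a form that avoids the surface measure of the sphere. The dilation by
  \<open>a\<close> multiplies the \<open>h\<close>-weighted measure of a ball by \<open>a^{DIM + d}\<close>, so the distribution
  function of the norm is a multiple of \<open>a^{DIM + d}\<close>. Half-lines form a generator closed
  under intersection, hence this determines the pushforward.
\<close>
lemma radial_pushforward:
  fixes h :: "'a::euclidean_space \<Rightarrow> real"
  assumes [measurable]: "h \<in> borel_measurable borel" and h0: "\<And>w. h w \<ge> 0"
    and hom: "\<And>t w. t > 0 \<Longrightarrow> h (t *\<^sub>R w) = t ^ d * h w"
    and bd: "\<And>w. norm w \<le> 1 \<Longrightarrow> h w \<le> B"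
  obtains C where "C \<ge> 0"
    and "ennreal C = ennreal (DIM('a) + d) * (\<integral>\<^sup>+w. ennreal (h w) * indicator (cball 0 1) w \<partial>lborel)"
    and "distr (density lborel h) borel norm =
      density lborel (\<lambda>r. ennreal (C * r ^ (DIM('a) + d - 1) * indicator {0<..} r))"
proof -
  have [measurable]: "cball (0::'a) r \<in> sets borel" for r by simp
  define K where "K = DIM('a) + d"
  have K: "K > 0" by (simp add: K_def)
  define I where "I = (\<integral>\<^sup>+w. ennreal (h w) * indicator (cball 0 1) w \<partial>lborel)"
  have "I \<le> (\<integral>\<^sup>+w. ennreal B * indicator (cball (0::'a) 1) w \<partial>lborel)"
    unfolding I_def
    by (intro nn_integral_mono) (auto simp: indicator_def ennreal_leI bd)
  also have "\<dots> < \<infinity>"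
    by (subst nn_integral_cmult_indicator) (auto simp: emeasure_cball ennreal_mult_less_top)
  finally have Ifin: "I \<noteq> \<infinity>" by simp
  define C where "C = real K * enn2real I"
  have C: "C \<ge> 0" "ennreal C = ennreal K * I"
    using Ifin by (auto simp: C_def ennreal_mult less_top)
  let ?M = "distr (density lborel h) borel norm"
  let ?N = "density lborel (\<lambda>r. ennreal (C * r ^ (K - 1) * indicator {0<..} r))"
  have N: "emeasure ?N {..a} = (if a \<le> 0 then 0 else ennreal (C / K * a ^ K))" for a :: real
  proof (cases "a \<le> 0")
    case True
    then have "emeasure ?N {..a} = (\<integral>\<^sup>+r. 0 \<partial>(lborel::real measure))"
      by (subst emeasure_density, simp, simp, intro nn_integral_cong) (auto simp: indicator_def)
    with True show ?thesis by simp
  next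
    case False
    have "emeasure ?N {..a} = (\<integral>\<^sup>+r. ennreal (C * r ^ (K - 1) * indicator {0<..} r) * indicator {..a} r \<partial>lborel)"
      by (subst emeasure_density) auto
    also have "\<dots> = (\<integral>\<^sup>+r. ennreal (C * r ^ (K - 1)) * indicator {0..a} r \<partial>lborel)"
      by (rule nn_integral_cong_AE, rule AE_mp[OF AE_lborel_singleton[of 0]], rule AE_I2) (auto simp: indicator_def)
    also have "\<dots> = ennreal (C / K * a ^ K - C / K * 0 ^ K)"
      using False C K by (intro nn_integral_FTC_Icc) (auto intro!: derivative_eq_intros simp: mult.commute)
    finally show ?thesis using False K by (simp add: power_0_left)
  qed
  have M: "emeasure ?M {..a} = (if a \<le> 0 then 0 else ennreal (C / K * a ^ K))" for a :: real
  proof -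
    have M1: "emeasure ?M {..a} = (\<integral>\<^sup>+w. ennreal (h w) * indicator (cball 0 a) w \<partial>lborel)"
    proof -
      have "norm -` {..a} = cball (0::'a) a" by auto
      then show ?thesis
        by (subst emeasure_distr) (simp_all add: emeasure_density)
    qed
    show ?thesis
    proof (cases "a \<le> 0")
      case True
      have "(\<integral>\<^sup>+w. ennreal (h w) * indicator (cball 0 a) w \<partial>lborel) = (\<integral>\<^sup>+w. 0 \<partial>(lborel::'a measure))"
        by (rule nn_integral_cong_AE, rule AE_mp[OF AE_lborel_singleton[of 0]], rule AE_I2) (use True in \<open>auto simp: indicator_def dest: order_trans\<close>)
      with True M1 show ?thesis by simp
    next
      case False
      have "(\<integral>\<^sup>+w. ennreal (h w) * indicator (cball 0 a) w \<partial>lborel) =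
        ennreal (a ^ DIM('a)) * (\<integral>\<^sup>+w. ennreal (h (a *\<^sub>R w)) * indicator (cball 0 a) (a *\<^sub>R w) \<partial>lborel)"
        using False by (intro nn_integral_lborel_scale) measurable
      also have "(\<integral>\<^sup>+w. ennreal (h (a *\<^sub>R w)) * indicator (cball 0 a) (a *\<^sub>R w) \<partial>lborel) =
         (\<integral>\<^sup>+w. ennreal (a ^ d) * (ennreal (h w) * indicator (cball 0 1) w) \<partial>lborel)"
        using False by (intro nn_integral_cong) (auto simp: hom ennreal_mult h0 indicator_def mult_le_cancel_left1)
      also have "\<dots> = ennreal (a ^ d) * I"
        by (simp add: nn_integral_cmult I_def)
      finally have "emeasure ?M {..a} = ennreal (a ^ K) * I"
        using False M1 by (simp add: K_def power_add ennreal_mult mult.assoc)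
      also have "I = ennreal (C / K)"
        using Ifin K by (simp add: C_def less_top)
      also have "ennreal (a ^ K) * ennreal (C / K) = ennreal (C / K * a ^ K)"
        using False C by (simp add: ennreal_mult[symmetric] mult.commute)
      finally show ?thesis using False by simp
    qed
  qed
  have "?M = ?N"
  proof (rule measure_eqI_generator_eq[where E = "range (\<lambda>a::real. {..a})" and \<Omega> = UNIV and A = "\<lambda>n::nat. {..real n}"])
    show "Int_stable (range (\<lambda>a::real. {..a}))"
      by (auto simp: Int_stable_def)
    show "sets ?M = sigma_sets UNIV (range (\<lambda>a::real. {..a}))"
      by (simp add: borel_eq_atMost)
    show "sets ?N = sigma_sets UNIV (range (\<lambda>a::real. {..a}))"
      by (simp add: borel_eq_atMost)
    show "(\<Union>n. {..real n}) = UNIV"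
      by (auto simp: real_arch_simple)
    show "emeasure ?M {..real n} \<noteq> \<infinity>" for n
      unfolding M by simp
    show "emeasure ?M X = emeasure ?N X" if X: "X \<in> range (\<lambda>a::real. {..a})" for X
    proof -
      obtain a where "X = {..a}" using X by blast
      then show ?thesis by (simp only: M N)
    qed
  qed auto
  then show ?thesis
    using that[of C] C by (simp add: K_def I_def)
qed

lemma radial_integral_nonneg:
  fixes h :: "'a::euclidean_space \<Rightarrow> real"
  assumes [measurable]: "h \<in> borel_measurable borel" and h0: "\<And>w. h w \<ge> 0"
    and hom: "\<And>t w. t > 0 \<Longrightarrow> h (t *\<^sub>R w) = t ^ d * h w"
    and bd: "\<And>w. norm w \<le> 1 \<Longrightarrow> h w \<le> B"
  obtains C where "C \<ge> 0"
    and "ennreal C = ennreal (DIM('a) + d) * (\<integral>\<^sup>+w. ennreal (h w) * indicator (cball 0 1) w \<partial>lborel)"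
    and "\<And>G :: real \<Rightarrow> complex. G \<in> borel_measurable borel \<Longrightarrow>
      integrable lborel (\<lambda>w. h w *\<^sub>R G (norm w)) \<longleftrightarrow>
      integrable lborel (\<lambda>r. (C * r ^ (DIM('a) + d - 1) * indicator {0<..} r) *\<^sub>R G r)"
    and "\<And>G :: real \<Rightarrow> complex. G \<in> borel_measurable borel \<Longrightarrow>
      (LINT w|lborel. h w *\<^sub>R G (norm w)) =
      (LINT r|lborel. (C * r ^ (DIM('a) + d - 1) * indicator {0<..} r) *\<^sub>R G r)"
    and "\<And>N. N \<in> sets borel \<Longrightarrow> (\<integral>\<^sup>+w. ennreal (h w) * indicator N (norm w) \<partial>lborel) =
      (\<integral>\<^sup>+r. ennreal (C * r ^ (DIM('a) + d - 1) * indicator {0<..} r) * indicator N r \<partial>lborel)"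
proof -
  obtain C where C: "C \<ge> 0"
    "ennreal C = ennreal (DIM('a) + d) * (\<integral>\<^sup>+w. ennreal (h w) * indicator (cball 0 1) w \<partial>lborel)"
    and eq: "distr (density lborel h) borel norm =
      density lborel (\<lambda>r. ennreal (C * r ^ (DIM('a) + d - 1) * indicator {0<..} r))"
    by (rule radial_pushforward[of h d B, OF assms])
  have pos: "AE r in lborel. 0 \<le> C * r ^ (DIM('a) + d - 1) * indicator {0<..} r"
    using C by (intro AE_I2) (auto simp: indicator_def)
  show ?thesis
  proof (rule that[OF C])
    fix G :: "real \<Rightarrow> complex" assume [measurable]: "G \<in> borel_measurable borel"
    have "integrable lborel (\<lambda>w. h w *\<^sub>R G (norm w)) \<longleftrightarrow>
      integrable (distr (density lborel h) borel norm) G"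
      by (simp add: integrable_distr_eq integrable_density h0)
    also have "\<dots> \<longleftrightarrow> integrable lborel (\<lambda>r. (C * r ^ (DIM('a) + d - 1) * indicator {0<..} r) *\<^sub>R G r)"
      unfolding eq using pos by (subst integrable_density) auto
    finally show "integrable lborel (\<lambda>w. h w *\<^sub>R G (norm w)) \<longleftrightarrow> \<dots>" .
    have "(LINT w|lborel. h w *\<^sub>R G (norm w)) = (LINT r|distr (density lborel h) borel norm. G r)"
      by (simp add: integral_distr integral_density h0)
    also have "\<dots> = (LINT r|lborel. (C * r ^ (DIM('a) + d - 1) * indicator {0<..} r) *\<^sub>R G r)"
      unfolding eq using pos by (subst integral_density) auto
    finally show "(LINT w|lborel. h w *\<^sub>R G (norm w)) = \<dots>" .
  next
    fix N :: "real set" assume [measurable]: "N \<in> sets borel"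
    have "(\<integral>\<^sup>+w. ennreal (h w) * indicator N (norm w) \<partial>lborel) = (\<integral>\<^sup>+r. indicator N r \<partial>distr (density lborel h) borel norm)"
      by (subst nn_integral_distr, simp, simp, subst nn_integral_density) simp_all
    also have "\<dots> = (\<integral>\<^sup>+r. ennreal (C * r ^ (DIM('a) + d - 1) * indicator {0<..} r) * indicator N r \<partial>lborel)"
      unfolding eq by (subst nn_integral_density) auto
    finally show "(\<integral>\<^sup>+w. ennreal (h w) * indicator N (norm w) \<partial>lborel) = \<dots>" .
  qed
qed

text \<open>
  Linear extension of the preceding result: the positive and negative parts of the real and
  imaginary parts of \<open>h\<close> are again continuous and homogeneous of degree \<open>d\<close>. The point is
  that the constant \<open>C\<close> does not depend on the weight \<open>G\<close>, so that a single weight, such as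
  a Gaussian, determines it.
\<close>
lemma radial_integral_complex:
  fixes h :: "'a::euclidean_space \<Rightarrow> complex"
  assumes cont: "continuous_on UNIV h"
    and hom: "\<And>t w. t > 0 \<Longrightarrow> h (t *\<^sub>R w) = of_real (t ^ d) * h w"
  obtains C where
    "\<And>G :: real \<Rightarrow> complex. G \<in> borel_measurable borel \<Longrightarrow>
      integrable lborel (\<lambda>r. (r ^ (DIM('a) + d - 1) * indicator {0<..} r) *\<^sub>R G r) \<Longrightarrow>
      integrable lborel (\<lambda>w. h w * G (norm w))"
    and "\<And>G :: real \<Rightarrow> complex. G \<in> borel_measurable borel \<Longrightarrow>
      integrable lborel (\<lambda>r. (r ^ (DIM('a) + d - 1) * indicator {0<..} r) *\<^sub>R G r) \<Longrightarrow>
      (LINT w|lborel. h w * G (norm w)) =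
      C * (LINT r|lborel. (r ^ (DIM('a) + d - 1) * indicator {0<..} r) *\<^sub>R G r)"
proof -
  let ?K = "DIM('a) + d - 1"
  let ?R = "\<lambda>(G :: real \<Rightarrow> complex) r. (r ^ ?K * indicator {0<..} r) *\<^sub>R G r"
  have *: "\<exists>C. \<forall>G\<in>borel_measurable borel. integrable lborel (?R G) \<longrightarrow>
      has_bochner_integral lborel (\<lambda>w. k w *\<^sub>R G (norm w)) (of_real C * (LINT r|lborel. ?R G r))"
    if k: "continuous_on UNIV k" "\<And>w. k w \<ge> 0" "\<And>t w. t > 0 \<Longrightarrow> k (t *\<^sub>R w) = t ^ d * k w"
    for k :: "'a \<Rightarrow> real"
  proof -
    have m: "k \<in> borel_measurable borel"
      using k(1) by (rule borel_measurable_continuous_onI)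
    have "compact (k ` cball 0 1)"
      using k(1) by (intro compact_continuous_image continuous_on_subset[OF k(1)]) auto
    then obtain B where "\<forall>x \<in> k ` cball 0 1. norm x \<le> B"
      using compact_imp_bounded bounded_iff by blast
    then have kB: "k w \<le> B" if "norm w \<le> 1" for w
      using that by (auto dest!: bspec[of _ _ w])
    obtain C where C:
      "\<And>G :: real \<Rightarrow> complex. G \<in> borel_measurable borel \<Longrightarrow>
        integrable lborel (\<lambda>w. k w *\<^sub>R G (norm w)) \<longleftrightarrow>
        integrable lborel (\<lambda>r. (C * r ^ ?K * indicator {0<..} r) *\<^sub>R G r)"
      "\<And>G :: real \<Rightarrow> complex. G \<in> borel_measurable borel \<Longrightarrow>
      (LINT w|lborel. k w *\<^sub>R G (norm w)) = (LINT r|lborel. (C * r ^ ?K * indicator {0<..} r) *\<^sub>R G r)"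
      by (rule radial_integral_nonneg[of k d B, OF m k(2,3) kB]) (blast intro: that)+
    have eq: "(\<lambda>r. (C * r ^ ?K * indicator {0<..} r) *\<^sub>R G r) = (\<lambda>r. of_real C * ?R G r)" for G
      by (simp add: scaleR_conv_of_real mult.assoc)
    show ?thesis
    proof (intro exI ballI impI)
      fix G :: "real \<Rightarrow> complex"
      assume G: "G \<in> borel_measurable borel" and int: "integrable lborel (?R G)"
      show "has_bochner_integral lborel (\<lambda>w. k w *\<^sub>R G (norm w)) (of_real C * (LINT r|lborel. ?R G r))"
        unfolding has_bochner_integral_iff C(1)[OF G] C(2)[OF G] eq
        by (intro conjI refl integral_mult_right_zero integrable_mult_right[OF int])
    qed
  qed
  have hR: "Re (h (t *\<^sub>R w)) = t ^ d * Re (h w)" "Im (h (t *\<^sub>R w)) = t ^ d * Im (h w)" if "t > 0" for t w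
    using hom[OF that] by auto
  have mx: "max 0 (t ^ d * x) = t ^ d * max 0 x" if "t > 0" for t x :: real
    using zero_less_power[OF that, of d] by (simp add: max_def zero_le_mult_iff)
  have mx': "max 0 (- (t ^ d * x)) = t ^ d * max 0 (- x)" if "t > 0" for t x :: real
    using mx[OF that, of "- x"] by simp
  obtain C1 where C1: "\<And>G. G \<in> borel_measurable borel \<Longrightarrow> integrable lborel (?R G) \<Longrightarrow>
      has_bochner_integral lborel (\<lambda>w. max 0 (Re (h w)) *\<^sub>R G (norm w)) (of_real C1 * (LINT r|lborel. ?R G r))"
  proof -
    have "continuous_on UNIV (\<lambda>w. max 0 (Re (h w)))"
      by (intro continuous_intros cont)
    from *[OF this] show ?thesis
      using that by (simp add: hR mx) blast
  qed
  obtain C2 where C2: "\<And>G. G \<in> borel_measurable borel \<Longrightarrow> integrable lborel (?R G) \<Longrightarrow>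
      has_bochner_integral lborel (\<lambda>w. max 0 (- Re (h w)) *\<^sub>R G (norm w)) (of_real C2 * (LINT r|lborel. ?R G r))"
  proof -
    have "continuous_on UNIV (\<lambda>w. max 0 (- Re (h w)))"
      by (intro continuous_intros cont)
    from *[OF this] show ?thesis
      using that by (simp add: hR mx') blast
  qed
  obtain C3 where C3: "\<And>G. G \<in> borel_measurable borel \<Longrightarrow> integrable lborel (?R G) \<Longrightarrow>
      has_bochner_integral lborel (\<lambda>w. max 0 (Im (h w)) *\<^sub>R G (norm w)) (of_real C3 * (LINT r|lborel. ?R G r))"
  proof -
    have "continuous_on UNIV (\<lambda>w. max 0 (Im (h w)))"
      by (intro continuous_intros cont)
    from *[OF this] show ?thesis
      using that by (simp add: hR mx) blast
  qed
  obtain C4 where C4: "\<And>G. G \<in> borel_measurable borel \<Longrightarrow> integrable lborel (?R G) \<Longrightarrow>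
      has_bochner_integral lborel (\<lambda>w. max 0 (- Im (h w)) *\<^sub>R G (norm w)) (of_real C4 * (LINT r|lborel. ?R G r))"
  proof -
    have "continuous_on UNIV (\<lambda>w. max 0 (- Im (h w)))"
      by (intro continuous_intros cont)
    from *[OF this] show ?thesis
      using that by (simp add: hR mx') blast
  qed
  let ?C = "of_real C1 - of_real C2 + \<i> * (of_real C3 - of_real C4) :: complex"
  have "has_bochner_integral lborel (\<lambda>w. h w * G (norm w)) (?C * (LINT r|lborel. ?R G r))"
    if "G \<in> borel_measurable borel" "integrable lborel (?R G)" for G
  proof -
    have "has_bochner_integral lborel
      (\<lambda>w. max 0 (Re (h w)) *\<^sub>R G (norm w) - max 0 (- Re (h w)) *\<^sub>R G (norm w) +
        \<i> * (max 0 (Im (h w)) *\<^sub>R G (norm w) - max 0 (- Im (h w)) *\<^sub>R G (norm w)))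
      (of_real C1 * (LINT r|lborel. ?R G r) - of_real C2 * (LINT r|lborel. ?R G r) +
        \<i> * (of_real C3 * (LINT r|lborel. ?R G r) - of_real C4 * (LINT r|lborel. ?R G r)))"
      by (intro has_bochner_integral_add has_bochner_integral_diff has_bochner_integral_mult_right C1 C2 C3 C4 that)
    moreover have eq: "max 0 (Re (h w)) *\<^sub>R y - max 0 (- Re (h w)) *\<^sub>R y +
        \<i> * (max 0 (Im (h w)) *\<^sub>R y - max 0 (- Im (h w)) *\<^sub>R y) = h w * y" for w y
    proof -
      have "max 0 (Re (h w)) *\<^sub>R y - max 0 (- Re (h w)) *\<^sub>R y = Re (h w) *\<^sub>R y"
        "max 0 (Im (h w)) *\<^sub>R y - max 0 (- Im (h w)) *\<^sub>R y = Im (h w) *\<^sub>R y"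
        by (auto simp: max_def)
      then show ?thesis
        by (simp add: complex_eq_iff algebra_simps)
    qed
    moreover have val: "of_real C1 * x - of_real C2 * x + \<i> * (of_real C3 * x - of_real C4 * x) = ?C * x" for x
      by (simp add: algebra_simps)
    ultimately show ?thesis
      by (simp only: eq val)
  qed
  then show ?thesis
    using that[of ?C] by (simp add: has_bochner_integral_iff)
qed

text \<open>
  A null set of radii in \<open>(0, \<infinity>)\<close> sweeps out a null set of vectors, by the polar formula for
  the constant function.
\<close>
lemma AE_radial:
  fixes z :: "'a::euclidean_space"
  assumes "AE r in lborel. r > 0 \<longrightarrow> Q r"
  shows "AE w in lborel. z - w \<noteq> 0 \<longrightarrow> Q (norm (z - w))"
    and "AE w in lborel. (w::'a) \<noteq> 0 \<longrightarrow> Q (norm w)"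
proof -
  from assms obtain N where N: "{r \<in> space lborel. \<not> (r > 0 \<longrightarrow> Q r)} \<subseteq> N"
      "emeasure lborel N = 0" "N \<in> sets lborel"
    by (rule AE_E)
  have N0: "N \<in> null_sets lborel"
    using N(2,3) by (rule null_setsI)
  have [measurable]: "N \<in> sets borel" using N by auto
  obtain C where C: "\<And>N. N \<in> sets borel \<Longrightarrow> (\<integral>\<^sup>+w. ennreal 1 * indicator N (norm (w::'a)) \<partial>lborel) =
      (\<integral>\<^sup>+r. ennreal (C * r ^ (DIM('a) + 0 - 1) * indicator {0<..} r) * indicator N r \<partial>lborel)"
    by (rule radial_integral_nonneg[of "\<lambda>_::'a. 1" 0 1]) auto
  define S where "S = {w::'a. norm w \<in> N}"
  have [measurable]: "S \<in> sets borel" unfolding S_def by measurable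
  have "emeasure lborel S = (\<integral>\<^sup>+w. indicator S w \<partial>lborel)"
    by (rule nn_integral_indicator[symmetric]) simp
  also have "\<dots> = (\<integral>\<^sup>+w. ennreal 1 * indicator N (norm (w::'a)) \<partial>lborel)"
    by (intro nn_integral_cong) (simp add: S_def indicator_def)
  also have "\<dots> = (\<integral>\<^sup>+r. 0 \<partial>(lborel :: real measure))"
    unfolding C[OF \<open>N \<in> sets borel\<close>]
  proof (rule nn_integral_cong_AE)
    show "AE r in lborel. ennreal (C * r ^ (DIM('a) + 0 - 1) * indicator {0<..} r) * indicator N r = 0"
      using AE_not_in[OF N0] by eventually_elim simp
  qed
  finally have "S \<in> null_sets lborel"
    by (intro null_setsI) simp_all
  then have S: "AE w in lborel. w \<notin> S"
    by (rule AE_not_in)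
  have Q: "w \<noteq> 0 \<longrightarrow> Q (norm w)" if "w \<notin> S" for w
    using that subsetD[OF N(1), of "norm w"] by (auto simp: S_def)
  show "AE w in lborel. (w::'a) \<noteq> 0 \<longrightarrow> Q (norm w)"
    using S by eventually_elim (rule Q)
  have "AE w in distr lborel borel (\<lambda>x. z - x). w \<notin> S"
    unfolding lborel_distr_reflect by (rule S)
  then have "AE w in lborel. z - w \<notin> S"
    by (subst (asm) AE_distr_iff) auto
  then show "AE w in lborel. z - w \<noteq> 0 \<longrightarrow> Q (norm (z - w))"
    by eventually_elim (rule Q)
qed

text \<open>
  The polar formula for the weight \<open>|h|\<close> read from right to left. Its constant is nonzero
  because \<open>h\<close> does not vanish on some nonempty open set.
\<close>
lemma radial_factor_integrable:
  fixes h :: "'a::euclidean_space \<Rightarrow> complex"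
  assumes cont: "continuous_on UNIV h"
    and hom: "\<And>t w. t > 0 \<Longrightarrow> h (t *\<^sub>R w) = of_real (t ^ d) * h w"
    and nz: "h w0 \<noteq> 0" and g: "g \<in> borel_measurable borel"
    and int: "integrable lborel (\<lambda>w. (g (norm w) :: complex) * h w)"
  shows "integrable lborel (\<lambda>r. (r ^ (DIM('a) + d - 1) * indicator {0<..} r) *\<^sub>R g r)"
proof -
  let ?h = "\<lambda>w. norm (h w)" and ?K = "DIM('a) + d - 1"
  have [measurable]: "h \<in> borel_measurable borel"
    using cont by (rule borel_measurable_continuous_onI)
  note [measurable] = g
  have "compact (?h ` cball 0 1)"
    by (intro compact_continuous_image continuous_on_norm continuous_on_subset[OF cont]) auto
  then obtain B where "\<forall>x \<in> ?h ` cball 0 1. norm x \<le> B"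
    using compact_imp_bounded bounded_iff by blast
  then have hB: "?h w \<le> B" if "norm w \<le> 1" for w
    using that by (auto dest!: bspec[of _ _ w])
  obtain C where C0: "C \<ge> 0" and C1: "\<And>G :: real \<Rightarrow> complex. G \<in> borel_measurable borel \<Longrightarrow>
        integrable lborel (\<lambda>w. ?h w *\<^sub>R G (norm w)) \<longleftrightarrow>
        integrable lborel (\<lambda>r. (C * r ^ ?K * indicator {0<..} r) *\<^sub>R G r)"
    and C2: "\<And>N. N \<in> sets borel \<Longrightarrow> (\<integral>\<^sup>+w. ennreal (?h w) * indicator N (norm w) \<partial>lborel) =
      (\<integral>\<^sup>+r. ennreal (C * r ^ ?K * indicator {0<..} r) * indicator N r \<partial>lborel)"
  proof (rule radial_integral_nonneg[of ?h d B])
    show "?h (t *\<^sub>R w) = t ^ d * ?h w" if "t > 0" for t w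
      using that by (simp add: hom norm_mult norm_power)
    show "?h w \<le> B" if "norm w \<le> 1" for w
      using that by (rule hB)
  qed (simp, simp, blast intro: that)
  have "C \<noteq> 0"
  proof
    assume "C = 0"
    then have "(\<integral>\<^sup>+w. ennreal (?h w) \<partial>lborel) = 0"
      using C2[of UNIV] by simp
    then have "AE w in lborel. h w = 0"
      by (subst (asm) nn_integral_0_iff_AE) auto
    then have "{w. h w \<noteq> 0} \<in> null_sets lborel"
      by (subst AE_iff_null_sets) auto
    then have "negligible {w. h w \<noteq> 0}"
      by (simp add: negligible_iff_null_sets null_sets_completionI)
    moreover have "open {w. h w \<noteq> 0}"
      by (rule open_Collect_neq[OF cont continuous_on_const])
    ultimately show False
      using open_not_negligible nz by blast
  qed
  have "integrable lborel (\<lambda>w. ?h w *\<^sub>R g (norm w))"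
    using integrable_norm[OF int]
    by (rule Bochner_Integration.integrable_bound) (auto simp: norm_mult mult.commute)
  then have "integrable lborel (\<lambda>r. (C * r ^ ?K * indicator {0<..} r) *\<^sub>R g r)"
    using C1[OF g] by simp
  then have "integrable lborel (\<lambda>r. of_real (1 / C) * ((C * r ^ ?K * indicator {0<..} r) *\<^sub>R g r))"
    by (rule integrable_mult_right)
  then show ?thesis
    using \<open>C \<noteq> 0\<close> by (simp add: scaleR_conv_of_real field_simps)
qed

section \<open>Lebesgue measurable radial profiles\<close>

lemma norm_image_fsigma_borel:
  fixes S :: "'a::euclidean_space set"
  assumes "fsigma S"
  shows "norm ` S \<in> sets borel"
proof -
  obtain F :: "nat \<Rightarrow> 'a set" where F: "\<And>i. compact (F i)" "S = (\<Union>i. F i)"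
    using assms unfolding fsigma_Union_compact by (metis mem_Collect_eq range_subsetD)
  have "closed (norm ` F i)" for i
    by (intro compact_imp_closed compact_continuous_image continuous_intros F)
  then have "(\<Union>i. norm ` F i) \<in> sets borel"
    by (intro sets.countable_UN) (auto intro: borel_closed)
  then show ?thesis
    by (simp add: F image_UN)
qed

text \<open>
  The polar formula for the indicator of the cone, which is homogeneous of degree 0. Its
  constant is positive since the cone meets the unit ball in a nonempty open set.
\<close>
lemma cone_radial_set_null:
  fixes \<Gamma> :: "'a::euclidean_space set"
  assumes \<Gamma>: "open \<Gamma>" "\<Gamma> \<noteq> {}" "\<And>t w. t > 0 \<Longrightarrow> t *\<^sub>R w \<in> \<Gamma> \<longleftrightarrow> w \<in> \<Gamma>"
    and [measurable]: "N \<in> sets borel" and N: "N \<subseteq> {0<..}"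
    and null: "{w \<in> \<Gamma>. norm w \<in> N} \<in> null_sets lborel"
  shows "N \<in> null_sets lborel"
proof -
  have [measurable]: "\<Gamma> \<in> sets borel" using \<Gamma> by auto
  obtain C where C: "ennreal C = ennreal (DIM('a) + 0) * (\<integral>\<^sup>+w. ennreal (indicator \<Gamma> w) * indicator (cball 0 1) w \<partial>lborel)"
    and eq: "\<And>N. N \<in> sets borel \<Longrightarrow> (\<integral>\<^sup>+w. ennreal (indicator \<Gamma> w) * indicator N (norm w) \<partial>lborel) =
      (\<integral>\<^sup>+r. ennreal (C * r ^ (DIM('a) + 0 - 1) * indicator {0<..} r) * indicator N r \<partial>lborel)"
  proof (rule radial_integral_nonneg[of "indicator \<Gamma>" 0 1])
    show "indicator \<Gamma> (t *\<^sub>R w) = t ^ 0 * (indicator \<Gamma> w :: real)" if "t > 0" for t w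
      using \<Gamma>(3)[OF that] by (simp add: indicator_def)
  qed (simp_all add: indicator_def)
  have "C > 0"
  proof (rule ccontr)
    assume "\<not> C > 0"
    then have "(\<integral>\<^sup>+w. ennreal (indicator \<Gamma> w) * indicator (cball 0 1) w \<partial>lborel) = 0"
      using C by (simp add: ennreal_neg)
    also have "(\<integral>\<^sup>+w. ennreal (indicator \<Gamma> w) * indicator (cball 0 1) w \<partial>lborel) = emeasure lborel (\<Gamma> \<inter> cball 0 1)"
    proof -
      have "(\<integral>\<^sup>+w. ennreal (indicator \<Gamma> w) * indicator (cball 0 1) w \<partial>lborel) =
          (\<integral>\<^sup>+w. indicator (\<Gamma> \<inter> cball 0 1) w \<partial>lborel)"
        by (auto intro!: nn_integral_cong simp: indicator_def)
      also have "\<dots> = emeasure lborel (\<Gamma> \<inter> cball 0 1)"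
        by (rule nn_integral_indicator) simp
      finally show ?thesis .
    qed
    finally have "\<Gamma> \<inter> cball 0 1 \<in> null_sets lborel" by auto
    then have "negligible (\<Gamma> \<inter> ball 0 1)"
      by (meson ball_subset_cball inf_mono negligible_subset negligible_iff_null_sets null_sets_completionI order_refl)
    moreover obtain w where "w \<in> \<Gamma>" using \<Gamma> by auto
    then have "(1 / (norm w + 1)) *\<^sub>R w \<in> \<Gamma> \<inter> ball 0 1"
      using \<Gamma>(3)[of "1 / (norm w + 1)" w] by (auto simp: field_simps add_pos_nonneg)
    moreover have "open (\<Gamma> \<inter> ball 0 1)"
      using \<Gamma>(1) by (intro open_Int) auto
    ultimately show False
      using open_not_negligible by blast
  qed
  have "(\<integral>\<^sup>+w. ennreal (indicator \<Gamma> w) * indicator N (norm w) \<partial>lborel) = (\<integral>\<^sup>+w. indicator {w \<in> \<Gamma>. norm w \<in> N} w \<partial>lborel)"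
    by (auto intro!: nn_integral_cong simp: indicator_def)
  also have "\<dots> = 0"
    using null by (subst nn_integral_indicator) auto
  finally have "(\<integral>\<^sup>+r. ennreal (C * r ^ (DIM('a) + 0 - 1) * indicator {0<..} r) * indicator N r \<partial>lborel) = 0"
    using eq[of N] by simp
  then have "AE r in lborel. ennreal (C * r ^ (DIM('a) + 0 - 1) * indicator {0<..} r) * indicator N r = 0"
    by (subst (asm) nn_integral_0_iff_AE) auto
  then have "AE r in lborel. r \<notin> N"
    by eventually_elim (use N \<open>C > 0\<close> in \<open>auto simp: indicator_def split: if_splits\<close>)
  then show ?thesis
    by (subst (asm) AE_iff_null_sets[symmetric]) auto
qed

text \<open>
  A Lebesgue set is a countable union of compact sets up to a null set. The norms of the
  compact pieces inside the cone over \<open>R\<close>, and of those inside its complement, form Borel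
  sets contained in \<open>R\<close> and in the complement of \<open>R\<close>. The radii \<open>N\<close> that are missed by both
  carry a null part of the cone, and are therefore null.
\<close>
lemma cone_radial_set_lebesgue:
  fixes \<Gamma> :: "'a::euclidean_space set"
  assumes \<Gamma>: "open \<Gamma>" "\<Gamma> \<noteq> {}" "\<And>t w. t > 0 \<Longrightarrow> t *\<^sub>R w \<in> \<Gamma> \<longleftrightarrow> w \<in> \<Gamma>"
    and R: "R \<subseteq> {0<..}" and meas: "{w \<in> \<Gamma>. norm w \<in> R} \<in> sets lebesgue"
  shows "R \<in> sets lebesgue"
proof -
  let ?S = "{w \<in> \<Gamma>. norm w \<in> R}"
  \<comment> \<open>The origin is removed because \<open>N\<close> below consists of positive radii.\<close>
  let ?S' = "\<Gamma> - {0} - ?S"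
  have "?S' \<in> sets lebesgue"
    using meas \<Gamma> by (intro sets.Diff) auto
  then obtain D' T' where D': "fsigma D'" "T' \<in> null_sets lebesgue" "D' \<union> T' = ?S'"
    by (elim lebesgue_set_almost_fsigma)
  obtain D T where D: "fsigma D" "T \<in> null_sets lebesgue" "D \<union> T = ?S"
    using meas by (elim lebesgue_set_almost_fsigma)
  note [measurable] = norm_image_fsigma_borel[OF D(1)] norm_image_fsigma_borel[OF D'(1)]
  define N where "N = {0<..} - norm ` D - norm ` D'"
  have N: "N \<in> sets borel" "N \<subseteq> {0<..}"
    by (auto simp: N_def)
  have [measurable]: "\<Gamma> \<in> sets borel" using \<Gamma> by auto
  have "{w \<in> \<Gamma>. norm w \<in> N} \<subseteq> T \<union> T'"
    using D(3) D'(3) by (auto simp: N_def image_iff)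
  moreover have "T \<union> T' \<in> null_sets lebesgue"
    using D D' by auto
  moreover have NB: "{w \<in> \<Gamma>. norm w \<in> N} \<in> sets lborel"
    using N(1) by measurable
  ultimately have "{w \<in> \<Gamma>. norm w \<in> N} \<in> null_sets lebesgue"
    by (blast intro: completion.complete2)
  then have "{w \<in> \<Gamma>. norm w \<in> N} \<in> null_sets lborel"
    using NB by (simp add: null_sets_completion_iff)
  from cone_radial_set_null[OF \<Gamma> N this] have "N \<in> null_sets lebesgue"
    by (rule null_sets_completionI)
  then have "R \<inter> N \<in> sets lebesgue"
    by (meson completion.complete inf_le2)
  moreover have "R = norm ` D \<union> (R \<inter> N)"
    using R D(3) D'(3) by (auto simp: N_def)
  moreover have "norm ` D \<in> sets lebesgue"
    by (simp add: norm_image_fsigma_borel[OF D(1)])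
  ultimately show ?thesis
    by (metis sets.Un)
qed

text \<open>
  On the open cone where \<open>h\<close> does not vanish, the profile is recovered by dividing by \<open>h\<close>.
\<close>
lemma radial_profile_borel:
  fixes h :: "'a::euclidean_space \<Rightarrow> complex" and g :: "real \<Rightarrow> complex"
  assumes cont: "continuous_on UNIV h"
    and hom: "\<And>t w. t > 0 \<Longrightarrow> h (t *\<^sub>R w) = of_real (t ^ d) * h w"
    and nz: "h w0 \<noteq> 0"
    and meas: "(\<lambda>w. g (norm w) * h w) \<in> borel_measurable lebesgue"
  obtains g' where "g' \<in> borel_measurable borel" "AE r in lborel. r > 0 \<longrightarrow> g r = g' r"
proof -
  define \<Gamma> where "\<Gamma> = {w. h w \<noteq> 0}"
  have "\<Gamma> = h -` (- {0})" by (auto simp: \<Gamma>_def)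
  then have \<Gamma>: "open \<Gamma>" "\<Gamma> \<noteq> {}" "\<And>t w. t > 0 \<Longrightarrow> t *\<^sub>R w \<in> \<Gamma> \<longleftrightarrow> w \<in> \<Gamma>"
    using nz cont by (auto simp: continuous_on_open_vimage hom \<Gamma>_def)
  have [measurable]: "h \<in> borel_measurable lebesgue"
    using borel_measurable_continuous_onI[OF cont] by (simp add: measurable_completion)
  have hB [measurable]: "(\<lambda>w. (g (norm w) * h w) / h w) \<in> borel_measurable lebesgue"
    using meas by measurable
  define g0 where "g0 r = (if r > 0 then g r else 0)" for r
  have "g0 \<in> borel_measurable lebesgue"
  proof (rule measurableI)
    fix B :: "complex set" assume [measurable]: "B \<in> sets borel"
    define R where "R = {r. r > 0 \<and> g r \<in> B}"
    have "{w \<in> \<Gamma>. norm w \<in> R} = ((\<lambda>w. (g (norm w) * h w) / h w) -` B \<inter> space lebesgue) \<inter> (\<Gamma> - {0})"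
      by (auto simp: R_def \<Gamma>_def)
    also have "\<dots> \<in> sets lebesgue"
      using \<Gamma>(1) by (intro sets.Int measurable_sets[OF hB]) auto
    finally have "R \<in> sets lebesgue"
      by (intro cone_radial_set_lebesgue[OF \<Gamma>]) (auto simp: R_def)
    moreover have "g0 -` B \<inter> space lebesgue = R \<union> (if 0 \<in> B then {..0} else {})"
      by (auto simp: g0_def R_def split: if_splits)
    ultimately show "g0 -` B \<inter> space lebesgue \<in> sets lebesgue"
      by auto
  qed simp
  then have "(\<lambda>r. Re (g0 r)) \<in> borel_measurable lebesgue" "(\<lambda>r. Im (g0 r)) \<in> borel_measurable lebesgue"
    by auto
  from this[THEN completion_ex_borel_measurable_real]
  obtain a b where [measurable]: "a \<in> borel_measurable lborel" "b \<in> borel_measurable lborel"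
    and ab: "AE r in lborel. Re (g0 r) = a r" "AE r in lborel. Im (g0 r) = b r"
    by blast
  show ?thesis
  proof
    show "(\<lambda>r. Complex (a r) (b r)) \<in> borel_measurable borel"
      by (simp add: Complex_eq)
    show "AE r in lborel. r > 0 \<longrightarrow> g r = Complex (a r) (b r)"
      using ab by eventually_elim (auto simp: g0_def complex_eq_iff)
  qed
qed

lemma integral_lebesgue_borel_version:
  fixes F F' :: "'a::euclidean_space \<Rightarrow> complex"
  assumes F': "F' \<in> borel_measurable borel" and eq: "AE w in lborel. F w = F' w"
  shows "(LINT w|lebesgue. F w) = (LINT w|lborel. F' w)"
proof -
  have eq': "AE w in lebesgue. F w = F' w"
    using eq by (rule AE_completion)
  have F'm: "F' \<in> borel_measurable lebesgue"
    using F' by (simp add: measurable_completion)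
  have "F \<in> borel_measurable lebesgue"
  proof (rule measurableI)
    fix B :: "complex set" assume "B \<in> sets borel"
    then have "F' -` B \<inter> space lebesgue \<in> sets lebesgue"
      by (rule measurable_sets[OF F'm])
    then show "F -` B \<inter> space lebesgue \<in> sets lebesgue"
    proof (rule completion.in_sets_AE[rotated])
      show "AE w in lebesgue. w \<in> F' -` B \<inter> space lebesgue \<longleftrightarrow> w \<in> F -` B \<inter> space lebesgue"
        using eq' by eventually_elim simp
    qed simp
  qed simp
  then have "(LINT w|lebesgue. F w) = (LINT w|lebesgue. F' w)"
    using F'm eq' by (rule integral_cong_AE)
  also have "\<dots> = (LINT w|lborel. F' w)"
    using F' by (simp add: integral_completion)
  finally show ?thesis .
qed

section \<open>Polynomials and Wirtinger derivatives\<close>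

text \<open>
  Polynomial functions of \<open>w\<close> and its conjugate, as expressions, so that the two Wirtinger
  derivatives are computed by recursion. The atoms are arbitrary linear forms \<open>a \<cdot> w\<close> and
  \<open>a \<cdot> cnj w\<close> rather than coordinates, since the forms \<open>z \<cdot> cnj w\<close> and \<open>cnj z \<cdot> w\<close> are the
  ones that matter.
\<close>
datatype ('n::finite) wpoly =
    Const complex
  | Lin "complex ^ 'n"
  | LinC "complex ^ 'n"
  | Add "'n wpoly" "'n wpoly"
  | Mul "'n wpoly" "'n wpoly"

primrec weval :: "'n::finite wpoly \<Rightarrow> complex ^ 'n \<Rightarrow> complex" where
  "weval (Const c) w = c"
| "weval (Lin a) w = cdot a w"
| "weval (LinC a) w = cdot a (cconj w)"
| "weval (Add e f) w = weval e w + weval f w"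
| "weval (Mul e f) w = weval e w * weval f w"

text \<open>
  The holomorphic derivative \<open>\<Sum>j. z_j \<partial>/\<partial>w_j\<close>; its companion \<open>danti\<close> is
  \<open>\<Sum>j. cnj z_j \<partial>/\<partial>(cnj w_j)\<close>.
\<close>
primrec dhol :: "complex ^ 'n::finite \<Rightarrow> 'n wpoly \<Rightarrow> 'n wpoly" where
  "dhol z (Const c) = Const 0"
| "dhol z (Lin a) = Const (cdot a z)"
| "dhol z (LinC a) = Const 0"
| "dhol z (Add e f) = Add (dhol z e) (dhol z f)"
| "dhol z (Mul e f) = Add (Mul (dhol z e) f) (Mul e (dhol z f))"

primrec danti :: "complex ^ 'n::finite \<Rightarrow> 'n wpoly \<Rightarrow> 'n wpoly" where
  "danti z (Const c) = Const 0"
| "danti z (Lin a) = Const 0"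
| "danti z (LinC a) = Const (cdot a (cconj z))"
| "danti z (Add e f) = Add (danti z e) (danti z f)"
| "danti z (Mul e f) = Add (Mul (danti z e) f) (Mul e (danti z f))"

lemma weval_has_vector_derivative:
  "((\<lambda>t. weval e (w + t *\<^sub>R h)) has_vector_derivative
     weval (dhol h e) (w + t *\<^sub>R h) + weval (danti h e) (w + t *\<^sub>R h)) (at t)"
proof (induction e)
  case (Lin a)
  have "((\<lambda>t. cdot a w + t *\<^sub>R cdot a h) has_vector_derivative cdot a h) (at t)"
    by (auto intro!: derivative_eq_intros)
  then show ?case by (simp add: cdot_add cdot_scaleR)
next
  case (LinC a)
  have "((\<lambda>t. cdot a (cconj w) + t *\<^sub>R cdot a (cconj h)) has_vector_derivative cdot a (cconj h)) (at t)"
    by (auto intro!: derivative_eq_intros)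
  then show ?case by (simp add: cdot_add cdot_scaleR cconj_add cconj_scaleR)
next
  case (Add e f)
  show ?case
    using has_vector_derivative_add[OF Add.IH] by (simp add: algebra_simps)
next
  case (Mul e f)
  show ?case
    using has_vector_derivative_mult[OF Mul.IH] by (simp add: algebra_simps)
qed simp

lemma weval_dhol_scale: "weval (dhol (c *s z) e) w = c * weval (dhol z e) w"
  by (induction e) (simp_all add: cdot_scale algebra_simps)

lemma weval_danti_scale: "weval (danti (c *s z) e) w = cnj c * weval (danti z e) w"
  by (induction e) (simp_all add: cdot_scale cconj_scale algebra_simps)

lemma weval_dhol_sum: "finite J \<Longrightarrow> weval (dhol (\<Sum>j\<in>J. f j) e) w = (\<Sum>j\<in>J. weval (dhol (f j) e) w)"
proof (induction J rule: finite_induct)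
  case empty
  show ?case using weval_dhol_scale[of 0 0 e w] by simp
next
  case (insert j J)
  have "weval (dhol (x + y) e) w = weval (dhol x e) w + weval (dhol y e) w" for x y
    by (induction e) (simp_all add: cdot_add algebra_simps)
  with insert show ?case by simp
qed

lemma weval_danti_sum: "finite J \<Longrightarrow> weval (danti (\<Sum>j\<in>J. f j) e) w = (\<Sum>j\<in>J. weval (danti (f j) e) w)"
proof (induction J rule: finite_induct)
  case empty
  show ?case using weval_danti_scale[of 0 0 e w] by simp
next
  case (insert j J)
  have "weval (danti (x + y) e) w = weval (danti x e) w + weval (danti y e) w" for x y
    by (induction e) (simp_all add: cdot_add cconj_add algebra_simps)
  with insert show ?case by simp
qed

lemma dhol_dhol_commute: "weval (dhol z (dhol z' e)) w = weval (dhol z' (dhol z e)) w"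
  by (induction e) (simp_all add: algebra_simps)

lemma danti_danti_commute: "weval (danti z (danti z' e)) w = weval (danti z' (danti z e)) w"
  by (induction e) (simp_all add: algebra_simps)

lemma dhol_danti_commute: "weval (dhol z (danti z' e)) w = weval (danti z' (dhol z e)) w"
  by (induction e) (simp_all add: algebra_simps)

lemma directional_derivative_unique:
  assumes "\<And>w. weval e w = weval e' w"
  shows "weval (dhol z e) w + weval (danti z e) w = weval (dhol z e') w + weval (danti z e') w"
proof -
  have "((\<lambda>t. weval e (w + t *\<^sub>R z)) has_vector_derivative
     weval (dhol z e) (w + 0 *\<^sub>R z) + weval (danti z e) (w + 0 *\<^sub>R z)) (at 0)"
    by (rule weval_has_vector_derivative)
  moreover have "((\<lambda>t. weval e (w + t *\<^sub>R z)) has_vector_derivative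
     weval (dhol z e') (w + 0 *\<^sub>R z) + weval (danti z e') (w + 0 *\<^sub>R z)) (at 0)"
    unfolding assms by (rule weval_has_vector_derivative)
  ultimately show ?thesis
    using vector_derivative_unique_at by fastforce
qed

text \<open>
  The Wirtinger derivatives depend only on the polynomial function and not on the expression
  for it: they are the complex linear combinations of the real derivatives in the directions
  \<open>z\<close> and \<open>i z\<close>.
\<close>
lemma wirtinger_cong:
  assumes "\<And>w. weval e w = weval e' w"
  shows weval_dhol_cong: "weval (dhol z e) w = weval (dhol z e') w"
    and weval_danti_cong: "weval (danti z e) w = weval (danti z e') w"
proof -
  note * = directional_derivative_unique[of e e', OF assms]
  \<comment> \<open>The derivative in the direction \<open>i z\<close> is \<open>i\<close> times the difference of the two Wirtinger derivatives.\<close>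
  from *[of z w] *[of "\<i> *s z" w]
  have 1: "weval (dhol z e) w + weval (danti z e) w = weval (dhol z e') w + weval (danti z e') w"
    and "\<i> * (weval (dhol z e) w - weval (danti z e) w) = \<i> * (weval (dhol z e') w - weval (danti z e') w)"
    by (simp_all add: weval_dhol_scale weval_danti_scale algebra_simps)
  then have "weval (dhol z e) w - weval (danti z e) w = weval (dhol z e') w - weval (danti z e') w"
    by simp
  with 1 show "weval (dhol z e) w = weval (dhol z e') w" "weval (danti z e) w = weval (danti z e') w"
    by algebra+
qed

text \<open>
  The sum is a quarter of the Laplacian.
\<close>
definition harmonic :: "'n::finite wpoly \<Rightarrow> bool" where
  "harmonic e \<longleftrightarrow> (\<forall>w. (\<Sum>j\<in>UNIV. weval (dhol (axis j 1) (danti (axis j 1) e)) w) = 0)"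

text \<open>
  Used to apply \<open>wirtinger_cong\<close> to a finite sum, such as the Laplacian, without fixing an
  order of its terms.
\<close>
lemma ex_weval_sum:
  fixes e :: "'j \<Rightarrow> 'n::finite wpoly"
  assumes "finite J"
  shows "\<exists>s. (\<forall>w. weval s w = (\<Sum>j\<in>J. weval (e j) w)) \<and>
     (\<forall>z w. weval (dhol z s) w = (\<Sum>j\<in>J. weval (dhol z (e j)) w)) \<and>
     (\<forall>z w. weval (danti z s) w = (\<Sum>j\<in>J. weval (danti z (e j)) w))"
  using assms
proof (induction J rule: finite_induct)
  case empty
  show ?case by (rule exI[of _ "Const 0"]) simp
next
  case (insert j J)
  then obtain s where "(\<forall>w. weval s w = (\<Sum>j\<in>J. weval (e j) w)) \<and>
     (\<forall>z w. weval (dhol z s) w = (\<Sum>j\<in>J. weval (dhol z (e j)) w)) \<and>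
     (\<forall>z w. weval (danti z s) w = (\<Sum>j\<in>J. weval (danti z (e j)) w))" by blast
  with insert show ?case by (intro exI[of _ "Add (e j) s"]) simp
qed

text \<open>
  Constant-coefficient operators commute, and the derivative of the zero function is zero.
\<close>
lemma harmonic_dhol: "harmonic e \<Longrightarrow> harmonic (dhol z e)"
  and harmonic_danti: "harmonic e \<Longrightarrow> harmonic (danti z e)"
proof -
  assume e: "harmonic e"
  obtain s where s: "\<And>w. weval s w = (\<Sum>j\<in>UNIV. weval (dhol (axis j 1) (danti (axis j 1) e)) w)"
    "\<And>z w. weval (dhol z s) w = (\<Sum>j\<in>UNIV. weval (dhol z (dhol (axis j 1) (danti (axis j 1) e))) w)"
    "\<And>z w. weval (danti z s) w = (\<Sum>j\<in>UNIV. weval (danti z (dhol (axis j 1) (danti (axis j 1) e))) w)"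
    using ex_weval_sum[of UNIV "\<lambda>j. dhol (axis j 1) (danti (axis j 1) e)"] by auto
  have "weval s w = weval (Const 0) w" for w
    using e by (simp add: s harmonic_def)
  then have "weval (dhol z s) w = 0" "weval (danti z s) w = 0" for w
    using wirtinger_cong[of s "Const 0" z w] by simp_all
  then have 0: "(\<Sum>j\<in>UNIV. weval (dhol z (dhol (axis j 1) (danti (axis j 1) e))) w) = 0"
    "(\<Sum>j\<in>UNIV. weval (danti z (dhol (axis j 1) (danti (axis j 1) e))) w) = 0" for w
    by (simp_all add: s)
  have "weval (dhol b (danti b (dhol z e))) w = weval (dhol z (dhol b (danti b e))) w" for b w
    by (subst dhol_dhol_commute, rule weval_dhol_cong) (simp add: dhol_danti_commute)
  then show "harmonic (dhol z e)"
    using 0 by (simp add: harmonic_def)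
  have "weval (dhol b (danti b (danti z e))) w = weval (danti z (dhol b (danti b e))) w" for b w
    by (subst dhol_danti_commute[symmetric], rule weval_dhol_cong, rule danti_danti_commute)
  then show "harmonic (danti z e)"
    using 0 by (simp add: harmonic_def)
qed

text \<open>
  Bidegrees are integers, and the zero polynomial has every bidegree. Then a derivative
  lowers the bidegree by one without a case distinction, and bidegrees with a negative entry
  contain only the zero function.
\<close>
inductive bideg :: "int \<Rightarrow> int \<Rightarrow> 'n::finite wpoly \<Rightarrow> bool" where
  bideg_zero: "bideg p q (Const 0)"
| bideg_Const: "bideg 0 0 (Const c)"
| bideg_Lin: "bideg 1 0 (Lin a)"
| bideg_LinC: "bideg 0 1 (LinC a)"
| bideg_Add: "bideg p q e \<Longrightarrow> bideg p q f \<Longrightarrow> bideg p q (Add e f)"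
| bideg_Mul: "bideg p q e \<Longrightarrow> bideg p' q' f \<Longrightarrow> bideg (p + p') (q + q') (Mul e f)"

lemma bideg_Mul': "bideg p q e \<Longrightarrow> bideg p' q' f \<Longrightarrow> p'' = p + p' \<Longrightarrow> q'' = q + q' \<Longrightarrow> bideg p'' q'' (Mul e f)"
  by (simp add: bideg_Mul)

lemma bideg_dhol: "bideg p q e \<Longrightarrow> bideg (p - 1) q (dhol z e)"
  by (induction rule: bideg.induct)
    (auto intro!: bideg.intros intro: bideg_Mul' bideg_Const[of 0] simp: bideg_Const bideg_zero)

lemma bideg_danti: "bideg p q e \<Longrightarrow> bideg p (q - 1) (danti z e)"
  by (induction rule: bideg.induct)
    (auto intro!: bideg.intros intro: bideg_Mul' simp: bideg_Const bideg_zero)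

lemma bideg_negative: "bideg p q e \<Longrightarrow> p < 0 \<or> q < 0 \<Longrightarrow> weval e w = 0"
proof (induction rule: bideg.induct)
  case (bideg_Mul p q e p' q' f)
  then have "(p < 0 \<or> q < 0) \<or> (p' < 0 \<or> q' < 0)"
    by linarith
  then show ?case using bideg_Mul.IH by auto
qed auto

lemma bideg_00: "bideg p q e \<Longrightarrow> p = 0 \<Longrightarrow> q = 0 \<Longrightarrow> weval e w = weval e w'"
proof (induction rule: bideg.induct)
  case (bideg_Mul p q e p' q' f)
  show ?case
  proof (cases "p = 0 \<and> q = 0")
    case True
    then show ?thesis using bideg_Mul by auto
  next
    case False
    then have "(p < 0 \<or> q < 0) \<or> (p' < 0 \<or> q' < 0)"
      using bideg_Mul.prems by linarith
    then show ?thesis using bideg_negative[OF bideg_Mul.hyps(1)] bideg_negative[OF bideg_Mul.hyps(2)] by auto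
  qed
qed auto

lemma euler_dhol: "bideg p q e \<Longrightarrow> weval (dhol w e) w = of_int p * weval e w"
  by (induction rule: bideg.induct) (auto simp: algebra_simps)

lemma euler_danti: "bideg p q e \<Longrightarrow> weval (danti w e) w = of_int q * weval e w"
  by (induction rule: bideg.induct) (auto simp: algebra_simps)

lemma weval_scaleR:
  "bideg p q e \<Longrightarrow> p \<ge> 0 \<Longrightarrow> q \<ge> 0 \<Longrightarrow> t > 0 \<Longrightarrow>
    weval e (t *\<^sub>R w) = of_real (t ^ nat (p + q)) * weval e w"
proof -
  assume e: "bideg p q e" and pq: "p \<ge> 0" "q \<ge> 0" and t: "t > 0"
  from e t have "weval e (t *\<^sub>R w) = of_real (t powi (p + q)) * weval e w"
  proof (induction rule: bideg.induct)
    case (bideg_Mul p q e p' q' f)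
    then show ?case by (simp add: power_int_add algebra_simps)
  qed (auto simp: cdot_scaleR cconj_scaleR algebra_simps, auto simp: scaleR_conv_of_real)
  with pq show ?thesis
    by (simp add: power_int_def)
qed

lemma continuous_on_weval [continuous_intros]: "continuous_on S (weval e)"
proof (induction e)
  case (Const x)
  then show ?case by (simp add: continuous_on_const)
qed (auto intro!: continuous_intros)

lemma weval_bound: "\<exists>C d. C \<ge> 0 \<and> (\<forall>w. norm (weval e w) \<le> C * (1 + norm w) ^ d)"
proof (induction e)
  case (Const c)
  show ?case by (rule exI[of _ "norm c"], rule exI[of _ 0]) simp
next
  case (Lin a)
  have "norm (cdot a w) \<le> norm a * (1 + norm w) ^ 1" for w
    by (rule order_trans[OF norm_cdot_le]) (simp add: mult_left_mono)
  then show ?case by (metis norm_ge_zero weval.simps(2))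
next
  case (LinC a)
  have "norm (cdot a (cconj w)) \<le> norm a * (1 + norm w) ^ 1" for w
    by (rule order_trans[OF norm_cdot_le]) (simp add: mult_left_mono)
  then show ?case by (metis norm_ge_zero weval.simps(3))
next
  case (Add e f)
  then obtain C d C' d' where *: "C \<ge> 0" "\<And>w. norm (weval e w) \<le> C * (1 + norm w) ^ d"
    "C' \<ge> 0" "\<And>w. norm (weval f w) \<le> C' * (1 + norm w) ^ d'" by blast
  have "norm (weval e w + weval f w) \<le> (C + C') * (1 + norm w) ^ (d + d')" for w
  proof -
    have "norm (weval e w + weval f w) \<le> C * (1 + norm w) ^ d + C' * (1 + norm w) ^ d'"
      using *(2,4)[of w] norm_triangle_le by (metis add_mono)
    also have "\<dots> \<le> C * (1 + norm w) ^ (d + d') + C' * (1 + norm w) ^ (d + d')"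
      using * by (intro add_mono mult_left_mono power_increasing) auto
    finally show ?thesis by (simp add: algebra_simps)
  qed
  then show ?case using * by (intro exI[of _ "C + C'"] exI[of _ "d + d'"]) auto
next
  case (Mul e f)
  then obtain C d C' d' where *: "C \<ge> 0" "\<And>w. norm (weval e w) \<le> C * (1 + norm w) ^ d"
    "C' \<ge> 0" "\<And>w. norm (weval f w) \<le> C' * (1 + norm w) ^ d'" by blast
  have "norm (weval e w * weval f w) \<le> (C * C') * (1 + norm w) ^ (d + d')" for w
  proof -
    have "norm (weval e w * weval f w) \<le> (C * (1 + norm w) ^ d) * (C' * (1 + norm w) ^ d')"
      unfolding norm_mult using * by (intro mult_mono) auto
    then show ?thesis by (simp add: power_add algebra_simps)
  qed
  then show ?case using * by (intro exI[of _ "C * C'"] exI[of _ "d + d'"]) auto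
qed

primrec wpow :: "'n::finite wpoly \<Rightarrow> nat \<Rightarrow> 'n wpoly" where
  "wpow e 0 = Const 1"
| "wpow e (Suc k) = Mul e (wpow e k)"

lemma weval_wpow [simp]: "weval (wpow e k) w = weval e w ^ k"
  by (induction k) simp_all

lemma weval_dhol_wpow: "weval (dhol z (wpow e k)) w = of_nat k * weval e w ^ (k - 1) * weval (dhol z e) w"
proof (induction k)
  case (Suc k)
  then show ?case by (cases k) (simp_all add: algebra_simps)
qed simp

lemma weval_danti_wpow: "weval (danti z (wpow e k)) w = of_nat k * weval e w ^ (k - 1) * weval (danti z e) w"
proof (induction k)
  case (Suc k)
  then show ?case by (cases k) (simp_all add: algebra_simps)
qed simp

lemma bideg_wpow: "bideg p q e \<Longrightarrow> bideg (int k * p) (int k * q) (wpow e k)"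
proof (induction k)
  case (Suc k)
  then show ?case by (auto intro!: bideg_Mul' simp: algebra_simps)
qed (simp add: bideg_Const)

section \<open>The spaces of bihomogeneous harmonic polynomials\<close>

lemma ex_wpoly_prod:
  fixes f :: "'j \<Rightarrow> complex ^ 'n::finite \<Rightarrow> complex"
  assumes "finite J" "\<And>j. j \<in> J \<Longrightarrow> \<exists>e. bideg (p j) (q j) e \<and> weval e = f j"
  shows "\<exists>e. bideg (\<Sum>j\<in>J. p j) (\<Sum>j\<in>J. q j) e \<and> weval e = (\<lambda>w. \<Prod>j\<in>J. f j w)"
  using assms
proof (induction J rule: finite_induct)
  case empty
  show ?case by (rule exI[of _ "Const 1"]) (auto intro: bideg_Const)
next
  case (insert j J)
  then obtain e e' where "bideg (p j) (q j) e" "weval e = f j"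
    "bideg (\<Sum>j\<in>J. p j) (\<Sum>j\<in>J. q j) e'" "weval e' = (\<lambda>w. \<Prod>j\<in>J. f j w)"
    by (metis insertCI)
  with insert.hyps show ?case
    by (intro exI[of _ "Mul e e'"]) (auto intro!: bideg_Mul)
qed

lemma ex_wpoly_sum:
  fixes f :: "'j \<Rightarrow> complex ^ 'n::finite \<Rightarrow> complex"
  assumes "finite J" "\<And>j. j \<in> J \<Longrightarrow> \<exists>e. bideg p q e \<and> weval e = f j"
  shows "\<exists>e. bideg p q e \<and> weval e = (\<lambda>w. \<Sum>j\<in>J. f j w)"
  using assms
proof (induction J rule: finite_induct)
  case empty
  show ?case by (rule exI[of _ "Const 0"]) (auto intro: bideg_zero)
next
  case (insert j J)
  then obtain e e' where "bideg p q e" "weval e = f j"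
    "bideg p q e'" "weval e' = (\<lambda>w. \<Sum>j\<in>J. f j w)"
    by (metis insertCI)
  with insert.hyps show ?case
    by (intro exI[of _ "Add e e'"]) (auto intro!: bideg_Add)
qed

lemma ex_wpoly_cmonomial:
  "\<exists>e. bideg (int (sum \<alpha> UNIV)) (int (sum \<beta> UNIV)) e \<and> weval e = cmonomial \<alpha> \<beta>"
proof -
  have "\<exists>e. bideg (int (\<alpha> j)) (int (\<beta> j)) e \<and> weval e = (\<lambda>z. z $ j ^ \<alpha> j * cnj (z $ j) ^ \<beta> j)" for j
  proof (intro exI conjI)
    show "bideg (int (\<alpha> j)) (int (\<beta> j)) (Mul (wpow (Lin (axis j 1)) (\<alpha> j)) (wpow (LinC (axis j 1)) (\<beta> j)))"
      by (rule bideg_Mul'[OF bideg_wpow[OF bideg_Lin] bideg_wpow[OF bideg_LinC]]) simp_all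
    show "weval (Mul (wpow (Lin (axis j 1)) (\<alpha> j)) (wpow (LinC (axis j 1)) (\<beta> j))) =
        (\<lambda>z. z $ j ^ \<alpha> j * cnj (z $ j) ^ \<beta> j)"
      by (rule ext) (simp add: cdot_axis, simp add: cconj_def)
  qed
  from ex_wpoly_prod[of UNIV "\<lambda>j. int (\<alpha> j)" "\<lambda>j. int (\<beta> j)", OF _ this]
  show ?thesis by (simp add: cmonomial_def[abs_def])
qed

lemma sum_Basis_complex_vec:
  "(\<Sum>b\<in>(Basis :: (complex ^ 'n::finite) set). F b) = (\<Sum>j\<in>UNIV. F (axis j 1) + F (axis j \<i>))"
proof -
  have B: "(Basis :: (complex ^ 'n) set) = (\<lambda>x. axis (fst x) (snd x)) ` (UNIV \<times> {1, \<i>})"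
    by (force simp: Basis_vec_def Basis_complex_def)
  have inj: "inj_on (\<lambda>x. axis (fst x) (snd x) :: complex ^ 'n) (UNIV \<times> {1, \<i>})"
    by (auto simp: inj_on_def axis_eq_axis)
  have "(\<Sum>b\<in>(Basis :: (complex ^ 'n) set). F b) = (\<Sum>x\<in>UNIV \<times> {1, \<i>}. F (axis (fst x) (snd x)))"
    unfolding B by (subst sum.reindex[OF inj]) simp
  also have "\<dots> = (\<Sum>j\<in>UNIV. \<Sum>u\<in>{1, \<i>}. F (axis j u))"
    by (subst sum.Sigma) (simp_all add: case_prod_unfold)
  finally show ?thesis
    by (simp add: complex_eq_iff)
qed

text \<open>
  The second derivatives in the directions \<open>e_j\<close> and \<open>i e_j\<close> are \<open>(\<partial> + \<partial>')^2\<close> and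
  \<open>(i\<partial> - i\<partial>')^2\<close>, where \<open>\<partial>\<close> and \<open>\<partial>'\<close> are the two Wirtinger derivatives; their sum is
  \<open>4 \<partial> \<partial>'\<close>.
\<close>
lemma laplacian_weval:
  "laplacian (weval e) z = 4 * (\<Sum>j\<in>UNIV. weval (dhol (axis j 1) (danti (axis j 1) e)) z)"
proof -
  define D2 where "D2 h = weval (dhol h (Add (dhol h e) (danti h e))) z + weval (danti h (Add (dhol h e) (danti h e))) z" for h
  have "vector_derivative (\<lambda>s. vector_derivative (\<lambda>t. weval e (z + t *\<^sub>R h)) (at s)) (at 0) = D2 h" for h
  proof -
    have "vector_derivative (\<lambda>t. weval e (z + t *\<^sub>R h)) (at s) = weval (Add (dhol h e) (danti h e)) (z + s *\<^sub>R h)" for s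
      using vector_derivative_at[OF weval_has_vector_derivative[of e z h s]] by simp
    then show ?thesis
      using vector_derivative_at[OF weval_has_vector_derivative[of "Add (dhol h e) (danti h e)" z h 0]]
      by (simp add: D2_def)
  qed
  then have "laplacian (weval e) z = (\<Sum>j\<in>UNIV. D2 (axis j 1) + D2 (axis j \<i>))"
    by (simp add: laplacian_def sum_Basis_complex_vec)
  also have "\<dots> = (\<Sum>j\<in>UNIV. 4 * weval (dhol (axis j 1) (danti (axis j 1) e)) z)"
  proof (rule sum.cong)
    fix j :: 'a
    let ?b = "axis j 1 :: complex ^ 'a"
    have ax: "axis j \<i> = \<i> *s ?b"
      by (auto simp: vec_eq_iff axis_def)
    have 1: "weval (dhol z (dhol (c *s z') e)) w = c * weval (dhol z (dhol z' e)) w"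
      "weval (danti z (dhol (c *s z') e)) w = c * weval (danti z (dhol z' e)) w"
      "weval (dhol z (danti (c *s z') e)) w = cnj c * weval (dhol z (danti z' e)) w"
      "weval (danti z (danti (c *s z') e)) w = cnj c * weval (danti z (danti z' e)) w" for z z' w c
      using weval_dhol_cong[of "dhol (c *s z') e" "Mul (Const c) (dhol z' e)" z w]
        weval_danti_cong[of "dhol (c *s z') e" "Mul (Const c) (dhol z' e)" z w]
        weval_dhol_cong[of "danti (c *s z') e" "Mul (Const (cnj c)) (danti z' e)" z w]
        weval_danti_cong[of "danti (c *s z') e" "Mul (Const (cnj c)) (danti z' e)" z w]
      by (simp_all add: weval_dhol_scale weval_danti_scale)
    show "D2 (axis j 1) + D2 (axis j \<i>) = 4 * weval (dhol ?b (danti ?b e)) z"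
      unfolding ax by (simp add: D2_def 1 weval_dhol_scale weval_danti_scale dhol_danti_commute)
  qed simp
  finally show ?thesis by (simp add: sum_distrib_left)
qed

lemma Hpq_wpoly:
  assumes "P \<in> Hpq p q"
  obtains e where "bideg (int p) (int q) e" "harmonic e" "weval e = P"
proof -
  obtain c where P: "P = (\<lambda>z. \<Sum>\<alpha>\<in>multiindices p. \<Sum>\<beta>\<in>multiindices q. c \<alpha> \<beta> * cmonomial \<alpha> \<beta> z)"
    and lap: "\<And>z. laplacian P z = 0"
    using assms by (auto simp: Hpq_def)
  have "\<exists>e. bideg (int p) (int q) e \<and> weval e = (\<lambda>z. c \<alpha> \<beta> * cmonomial \<alpha> \<beta> z)"
    if "\<alpha> \<in> multiindices p" "\<beta> \<in> multiindices q" for \<alpha> \<beta>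
  proof -
    obtain e where e: "bideg (int p) (int q) e" "weval e = cmonomial \<alpha> \<beta>"
      using ex_wpoly_cmonomial[of \<alpha> \<beta>] \<open>\<alpha> \<in> multiindices p\<close> \<open>\<beta> \<in> multiindices q\<close>
      by (auto simp: multiindices_def)
    show ?thesis
    proof (intro exI conjI)
      show "bideg (int p) (int q) (Mul (Const (c \<alpha> \<beta>)) e)"
        using bideg_Mul[OF bideg_Const e(1)] by simp
      show "weval (Mul (Const (c \<alpha> \<beta>)) e) = (\<lambda>z. c \<alpha> \<beta> * cmonomial \<alpha> \<beta> z)"
        using e(2) by (simp add: fun_eq_iff)
    qed
  qed
  then have "\<exists>e. bideg (int p) (int q) e \<and> weval e = P"
    unfolding P by (intro ex_wpoly_sum) (auto intro: finite_multiindices)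
  then obtain e where e: "bideg (int p) (int q) e" "weval e = P" by blast
  have "harmonic e"
    using lap laplacian_weval[of e] by (simp add: harmonic_def e(2))
  with e that show ?thesis by blast
qed

lemma one_Hpq: "(\<lambda>_. 1) \<in> Hpq 0 0"
proof -
  have "multiindices 0 = {\<lambda>_::'a. 0}"
    by (auto simp: multiindices_def fun_eq_iff)
  then have "(\<lambda>_. 1) = (\<lambda>z::complex^'a. \<Sum>\<alpha>\<in>multiindices 0. \<Sum>\<beta>\<in>multiindices 0. 1 * cmonomial \<alpha> \<beta> z)"
    by (simp add: cmonomial_def)
  moreover have "laplacian (\<lambda>_. 1) z = 0" for z :: "complex^'a"
    by (simp add: laplacian_def)
  ultimately show ?thesis
    unfolding Hpq_def mem_Collect_eq by (intro conjI allI exI[of _ "\<lambda>_ _. 1"])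
qed

section \<open>Gaussian integrals of polynomials\<close>

lemma gaussian_power_integrable:
  "integrable lborel (\<lambda>r::real. (r ^ k * indicator {0<..} r) *\<^sub>R exp (- r\<^sup>2))"
proof -
  have "integrable lborel (\<lambda>x::real. indicator {0..} x *\<^sub>R (exp (-x\<^sup>2) * x ^ k))"
  proof (cases "even k")
    case True
    then show ?thesis
      using gaussian_moment_even_pos[of "k div 2"] by (auto simp: has_bochner_integral_iff)
  next
    case False
    then show ?thesis
      using gaussian_moment_odd_pos[of "k div 2"] by (auto simp: has_bochner_integral_iff)
  qed
  then show ?thesis
    by (rule Bochner_Integration.integrable_bound) (auto simp: indicator_def)
qed

lemma gaussian_odd_moment:
  assumes "M > 0"
  shows "(LINT r|lborel. (r ^ (2 * M - 1) * indicator {0<..} r) *\<^sub>R complex_of_real (exp (- r\<^sup>2))) =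
    fact (M - 1) / 2"
proof -
  obtain k where M: "M = Suc k"
    using assms gr0_conv_Suc by blast
  have "(LINT r|lborel. (r ^ (2 * M - 1) * indicator {0<..} r) *\<^sub>R complex_of_real (exp (- r\<^sup>2))) =
    complex_of_real (LINT r|lborel. indicator {0..} r *\<^sub>R (exp (-r\<^sup>2) * r ^ (2 * (M - 1) + 1)))"
    unfolding integral_complex_of_real[symmetric]
    by (rule Bochner_Integration.integral_cong)
      (auto simp: M indicator_def scaleR_conv_of_real)
  also have "\<dots> = fact (M - 1) / 2"
    using gaussian_moment_odd_pos[of "M - 1"] by (simp only: has_bochner_integral_iff) simp
  finally show ?thesis .
qed

lemma gaussian_moment_nonzero:
  "(LINT r|lborel. (r ^ k * indicator {0<..} r) *\<^sub>R complex_of_real (exp (- r\<^sup>2))) \<noteq> 0"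
proof -
  have "(LINT r|lborel. (r ^ k * indicator {0<..} r) *\<^sub>R complex_of_real (exp (- r\<^sup>2))) =
    complex_of_real (LINT r|lborel. (r ^ k * indicator {0<..} r) *\<^sub>R exp (- r\<^sup>2))"
    by (simp add: scaleR_conv_of_real flip: integral_complex_of_real)
  moreover have "(LINT r|lborel. (r ^ k * indicator {0<..} r) *\<^sub>R exp (- r\<^sup>2)) \<noteq> (0::real)"
  proof
    assume "(LINT r|lborel. (r ^ k * indicator {0<..} r) *\<^sub>R exp (- r\<^sup>2)) = (0::real)"
    then have "AE r in lborel. (r ^ k * indicator {0<..} r) *\<^sub>R exp (- r\<^sup>2) = (0::real)"
      by (subst (asm) integral_nonneg_eq_0_iff_AE[OF gaussian_power_integrable]) (auto simp: indicator_def)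
    then have "AE r in lborel. r \<notin> {0<..<1::real}"
      by eventually_elim (auto simp: indicator_def split: if_splits)
    then have "{0<..<1::real} \<in> null_sets lborel"
      by (subst (asm) AE_iff_null_sets[symmetric]) auto
    then show False by auto
  qed
  ultimately show ?thesis by simp
qed

definition gauss :: "'a::real_normed_vector \<Rightarrow> complex" where
  "gauss w = of_real (exp (- (norm w)\<^sup>2))"

lemma gauss_weval_integrable:
  fixes e :: "'n::finite wpoly"
  shows "integrable lborel (\<lambda>w. gauss w * weval e w)"
proof -
  obtain C d where C: "C \<ge> 0" "\<And>w. norm (weval e w) \<le> C * (1 + norm w) ^ d"
    using weval_bound by blast
  define K where "K = DIM(complex^'n) + 0 - 1"
  have "integrable lborel (\<lambda>r. \<Sum>i\<le>d. of_nat (d choose i) * ((r ^ (K + i) * indicator {0<..} r) *\<^sub>R exp (- r\<^sup>2)))"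
    by (intro Bochner_Integration.integrable_sum integrable_mult_right gaussian_power_integrable)
  also have "(\<lambda>r::real. \<Sum>i\<le>d. of_nat (d choose i) * ((r ^ (K + i) * indicator {0<..} r) *\<^sub>R exp (- r\<^sup>2))) =
      (\<lambda>r. (r ^ K * indicator {0<..} r) *\<^sub>R ((1 + r) ^ d * exp (- r\<^sup>2)))"
  proof
    fix r :: real
    have "(1 + r) ^ d = (\<Sum>i\<le>d. of_nat (d choose i) * r ^ i)"
      using binomial_ring[of r 1 d] by (simp add: add.commute)
    then show "(\<Sum>i\<le>d. of_nat (d choose i) * ((r ^ (K + i) * indicator {0<..} r) *\<^sub>R exp (- r\<^sup>2))) =
        (r ^ K * indicator {0<..} r) *\<^sub>R ((1 + r) ^ d * exp (- r\<^sup>2))"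
      by (simp add: sum_distrib_left sum_distrib_right power_add mult_ac del: sum_mult_indicator)
  qed
  finally have int: "integrable lborel (\<lambda>r. (r ^ K * indicator {0<..} r) *\<^sub>R complex_of_real ((1 + r) ^ d * exp (- r\<^sup>2)))"
    by (subst (asm) complex_of_real_integrable_eq[symmetric]) (simp add: scaleR_conv_of_real)
  obtain C' where C': "\<And>G :: real \<Rightarrow> complex. G \<in> borel_measurable borel \<Longrightarrow>
      integrable lborel (\<lambda>r. (r ^ K * indicator {0<..} r) *\<^sub>R G r) \<Longrightarrow>
      integrable lborel (\<lambda>w::complex^'n. 1 * G (norm w))"
    by (rule radial_integral_complex[of "\<lambda>_::complex^'n. 1" 0]) (auto simp: K_def)
  have "integrable lborel (\<lambda>w::complex^'n. of_real C * (1 * complex_of_real ((1 + norm w) ^ d * exp (- (norm w)\<^sup>2))))"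
    by (intro integrable_mult_right C'[OF _ int]) measurable
  then show ?thesis
  proof (rule Bochner_Integration.integrable_bound)
    have [measurable]: "weval e \<in> borel_measurable borel"
      by (intro borel_measurable_continuous_onI continuous_on_weval)
    show "(\<lambda>w. gauss w * weval e w) \<in> borel_measurable lborel"
      unfolding gauss_def by measurable
    show "AE w in lborel. norm (gauss w * weval e w) \<le>
      norm (of_real C * (1 * complex_of_real ((1 + norm w) ^ d * exp (- (norm w)\<^sup>2))))"
      using C by (intro AE_I2) (simp add: gauss_def norm_mult norm_power abs_mult mult_ac mult_left_mono abs_of_nonneg
          del: of_real_add of_real_mult of_real_power)
  qed
qed

definition gaussian_integral :: "'n::finite wpoly \<Rightarrow> complex" where
  "gaussian_integral e = (LINT w|lborel. gauss w * weval e w)"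

lemma gaussian_integral_cong: "(\<And>w. weval e w = weval f w) \<Longrightarrow> gaussian_integral e = gaussian_integral f"
  by (simp add: gaussian_integral_def)

lemma gaussian_integral_Add [simp]: "gaussian_integral (Add e f) = gaussian_integral e + gaussian_integral f"
  by (simp add: gaussian_integral_def distrib_left gauss_weval_integrable)

lemma gaussian_integral_Mul_Const [simp]: "gaussian_integral (Mul (Const c) e) = c * gaussian_integral e"
  by (simp add: gaussian_integral_def mult.left_commute)

lemma gaussian_integral_eq_0: "(\<And>w. weval e w = 0) \<Longrightarrow> gaussian_integral e = 0"
  by (simp add: gaussian_integral_def)

lemma gaussian_integral_sum:
  assumes "finite J" "\<And>w. weval s w = (\<Sum>j\<in>J. weval (e j) w)"
  shows "gaussian_integral s = (\<Sum>j\<in>J. gaussian_integral (e j))"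
  unfolding gaussian_integral_def assms(2) sum_distrib_left
  by (rule Bochner_Integration.integral_sum) (rule gauss_weval_integrable)

text \<open>
  The derivative of \<open>exp(-|w|^2) e(w)\<close> in the direction \<open>h\<close> integrates to zero.
\<close>
lemma gaussian_integral_directional:
  "gaussian_integral (Mul (Lin (cconj h)) e) + gaussian_integral (Mul (LinC h) e) = gaussian_integral (dhol h e) + gaussian_integral (danti h e)"
proof -
  \<comment> \<open>\<open>E\<close> is the polynomial with \<open>exp(-|w|^2) E(w)\<close> as the derivative.\<close>
  define E where "E = Add (Add (dhol h e) (danti h e))
    (Mul (Const (-1)) (Add (Mul (Lin (cconj h)) e) (Mul (LinC h) e)))"
  have inner: "cdot (cconj h) w + cdot h (cconj w) = of_real (2 * (w \<bullet> h))" for w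
    using complex_add_cnj[of "cdot h (cconj w)"]
    by (simp add: cnj_cdot Re_cdot_cconj inner_commute add.commute)
  have "(LINT w|lborel. gauss w * weval E w) = 0"
  proof (rule integral_directional_derivative_eq_0[where e = h])
    show "integrable lborel (\<lambda>w. gauss w * weval e w)" "integrable lborel (\<lambda>w. gauss w * weval E w)"
      by (rule gauss_weval_integrable)+
    show "continuous_on UNIV (\<lambda>w. gauss w * weval E w)"
      unfolding gauss_def by (intro continuous_intros)
    fix w t
    let ?x = "w + t *\<^sub>R h"
    have "((\<lambda>t. exp (- ((w + t *\<^sub>R h) \<bullet> (w + t *\<^sub>R h)))) has_real_derivative
        exp (- (?x \<bullet> ?x)) * (- (2 * (?x \<bullet> h)))) (at t)"
      by (auto intro!: derivative_eq_intros simp: inner_commute algebra_simps)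
    then have "((\<lambda>t. gauss (w + t *\<^sub>R h)) has_vector_derivative
        gauss ?x * of_real (- (2 * (?x \<bullet> h)))) (at t)"
      unfolding gauss_def power2_norm_eq_inner of_real_mult[symmetric]
      by (rule has_vector_derivative_of_real)
    from has_vector_derivative_mult[OF this weval_has_vector_derivative]
    show "((\<lambda>t. gauss (w + t *\<^sub>R h) * weval e (w + t *\<^sub>R h)) has_vector_derivative
        gauss ?x * weval E ?x) (at t)"
      by (rule has_vector_derivative_eq_rhs)
        (simp add: E_def distrib_right[symmetric] inner del: of_real_mult, simp add: algebra_simps)
  qed
  then have "gaussian_integral E = 0" by (simp add: gaussian_integral_def)
  moreover have "gaussian_integral E = (gaussian_integral (dhol h e) + gaussian_integral (danti h e)) - (gaussian_integral (Mul (Lin (cconj h)) e) + gaussian_integral (Mul (LinC h) e))"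
    by (simp add: E_def)
  ultimately show ?thesis by simp
qed

text \<open>
  Integration by parts: the conjugate variable acts under the Gaussian integral as the
  holomorphic derivative, and vice versa. The two identities are separated by using the
  directions \<open>z\<close> and \<open>i z\<close>, on which the holomorphic and antiholomorphic parts differ by a
  sign.
\<close>
lemma wick: "gaussian_integral (Mul (LinC z) e) = gaussian_integral (dhol z e)"
  and wick_conj: "gaussian_integral (Mul (Lin (cconj z)) e) = gaussian_integral (danti z e)"
proof -
  have "gaussian_integral (Mul (Lin (cconj (\<i> *s z))) e) = - \<i> * gaussian_integral (Mul (Lin (cconj z)) e)"
    "gaussian_integral (Mul (LinC (\<i> *s z)) e) = \<i> * gaussian_integral (Mul (LinC z) e)"
    "gaussian_integral (dhol (\<i> *s z) e) = \<i> * gaussian_integral (dhol z e)"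
    "gaussian_integral (danti (\<i> *s z) e) = - \<i> * gaussian_integral (danti z e)"
    by (subst gaussian_integral_Mul_Const[symmetric], rule gaussian_integral_cong,
        simp add: cdot_minus_left cconj_scale cdot_scale_left weval_dhol_scale weval_danti_scale)+
  with gaussian_integral_directional[of "\<i> *s z" e]
  have "\<i> * (gaussian_integral (Mul (LinC z) e) - gaussian_integral (Mul (Lin (cconj z)) e)) = \<i> * (gaussian_integral (dhol z e) - gaussian_integral (danti z e))"
    by (simp add: algebra_simps)
  then have "gaussian_integral (Mul (LinC z) e) - gaussian_integral (Mul (Lin (cconj z)) e) = gaussian_integral (dhol z e) - gaussian_integral (danti z e)"
    by simp
  with gaussian_integral_directional[of z e]
  show "gaussian_integral (Mul (LinC z) e) = gaussian_integral (dhol z e)" "gaussian_integral (Mul (Lin (cconj z)) e) = gaussian_integral (danti z e)"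
    by algebra+
qed

text \<open>
  If \<open>p \<noteq> 0\<close>, Euler's identity writes \<open>p e\<close> as \<open>\<Sum>j. w_j \<partial>e/\<partial>w_j\<close>. Integration by parts
  replaces each factor \<open>w_j\<close> by a derivative, which leaves the integral of the Laplacian of
  \<open>e\<close>, that is zero. The case \<open>q \<noteq> 0\<close> is symmetric.
\<close>
lemma gaussian_integral_harmonic:
  fixes e :: "'n::finite wpoly"
  assumes e: "bideg p q e" "harmonic e" and pq: "p \<noteq> 0 \<or> q \<noteq> 0"
  shows "gaussian_integral e = 0"
  using pq
proof
  assume "p \<noteq> 0"
  have euler: "weval (Mul (Const (of_int p)) e) w =
      (\<Sum>j\<in>UNIV. weval (Mul (Lin (cconj (axis j 1))) (dhol (axis j 1) e)) w)" for w
  proof -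
    have "weval (dhol w e) w = weval (dhol (\<Sum>j\<in>UNIV. w $ j *s axis j 1) e) w"
      using axis_expansion[of w] by simp
    then show ?thesis
      by (simp add: euler_dhol[OF e(1)] weval_dhol_sum weval_dhol_scale cconj_axis cdot_axis)
  qed
  have "of_int p * gaussian_integral e = (\<Sum>j\<in>UNIV. gaussian_integral (Mul (Lin (cconj (axis j 1))) (dhol (axis j 1) e)))"
    by (subst gaussian_integral_Mul_Const[symmetric], rule gaussian_integral_sum[OF _ euler]) simp
  also have "\<dots> = (\<Sum>j\<in>UNIV. gaussian_integral (dhol (axis j 1) (danti (axis j 1) e)))"
    unfolding wick_conj by (intro sum.cong gaussian_integral_cong) (simp_all add: dhol_danti_commute)
  also have "\<dots> = gaussian_integral (Const 0 :: 'n wpoly)"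
    by (rule gaussian_integral_sum[symmetric]) (use e(2) in \<open>simp_all add: harmonic_def\<close>)
  finally show ?thesis using \<open>p \<noteq> 0\<close> by (simp add: gaussian_integral_eq_0)
next
  assume "q \<noteq> 0"
  have euler: "weval (Mul (Const (of_int q)) e) w =
      (\<Sum>j\<in>UNIV. weval (Mul (LinC (axis j 1)) (danti (axis j 1) e)) w)" for w
  proof -
    have "weval (danti w e) w = weval (danti (\<Sum>j\<in>UNIV. w $ j *s axis j 1) e) w"
      using axis_expansion[of w] by simp
    then show ?thesis
      by (simp add: euler_danti[OF e(1)] weval_danti_sum weval_danti_scale cdot_axis) (simp add: cconj_def)
  qed
  have "of_int q * gaussian_integral e = (\<Sum>j\<in>UNIV. gaussian_integral (Mul (LinC (axis j 1)) (danti (axis j 1) e)))"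
    by (subst gaussian_integral_Mul_Const[symmetric], rule gaussian_integral_sum[OF _ euler]) simp
  also have "\<dots> = (\<Sum>j\<in>UNIV. gaussian_integral (dhol (axis j 1) (danti (axis j 1) e)))"
    unfolding wick ..
  also have "\<dots> = gaussian_integral (Const 0 :: 'n wpoly)"
    by (rule gaussian_integral_sum[symmetric]) (use e(2) in \<open>simp_all add: harmonic_def\<close>)
  finally show ?thesis using \<open>q \<noteq> 0\<close> by (simp add: gaussian_integral_eq_0)
qed

definition moment_poly :: "complex ^ 'n::finite \<Rightarrow> nat \<Rightarrow> nat \<Rightarrow> 'n wpoly \<Rightarrow> 'n wpoly" where
  "moment_poly z s b e = Mul (wpow (LinC z) s) (Mul (wpow (Lin (cconj z)) b) e)"

text \<open>
  One factor \<open>z \<cdot> cnj w\<close> becomes the derivative in the direction \<open>z\<close>, which annihilates the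
  other such factors, sends each factor \<open>cnj z \<cdot> w\<close> to \<open>|z|^2\<close> and acts on \<open>e\<close>.
\<close>
lemma gaussian_integral_moment_Suc:
  "gaussian_integral (moment_poly z (Suc s) b e) =
    of_nat b * of_real ((norm z)\<^sup>2) * gaussian_integral (moment_poly z s (b - 1) e) + gaussian_integral (moment_poly z s b (dhol z e))"
proof -
  have "gaussian_integral (moment_poly z (Suc s) b e) = gaussian_integral (Mul (LinC z) (moment_poly z s b e))"
    by (rule gaussian_integral_cong) (simp add: moment_poly_def)
  also have "\<dots> = gaussian_integral (Add (Mul (Const (of_nat b * of_real ((norm z)\<^sup>2))) (moment_poly z s (b - 1) e))
      (moment_poly z s b (dhol z e)))"
    unfolding wick
    by (rule gaussian_integral_cong)
      (simp add: moment_poly_def weval_dhol_wpow cdot_commute[of "cconj z"] cdot_cconj_self algebra_simps)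
  finally show ?thesis by simp
qed

lemma gaussian_integral_moment_0_Suc:
  "gaussian_integral (moment_poly z 0 (Suc b) e) = gaussian_integral (moment_poly z 0 b (danti z e))"
proof -
  have "gaussian_integral (moment_poly z 0 (Suc b) e) = gaussian_integral (Mul (Lin (cconj z)) (moment_poly z 0 b e))"
    by (rule gaussian_integral_cong) (simp add: moment_poly_def)
  also have "\<dots> = gaussian_integral (moment_poly z 0 b (danti z e))"
    unfolding wick_conj
    by (rule gaussian_integral_cong) (simp add: moment_poly_def weval_danti_wpow)
  finally show ?thesis .
qed

text \<open>
  Induction on \<open>s\<close> by the two recursions above, with an inner induction on \<open>b\<close> for \<open>s = 0\<close>.
  By Euler's identity the derivative of \<open>e\<close> in the direction \<open>z\<close>, evaluated at \<open>z\<close> itself,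
  is a multiple of \<open>e(z)\<close>, so only the value \<open>e(z)\<close> enters. When \<open>s - p = b - q = l\<close>, the
  two terms on the right of the recursion for \<open>s\<close> contribute \<open>l\<close> and \<open>p\<close>, up to a common
  factor, and \<open>l + p = s\<close> is what turns \<open>(s - 1)!\<close> into \<open>s!\<close>.
\<close>
lemma gaussian_integral_moment:
  fixes e :: "'n::finite wpoly"
  assumes "bideg p q e" "harmonic e"
  shows "gaussian_integral (moment_poly z s b e) =
    (if p \<le> int s \<and> int s - p = int b - q
     then gaussian_integral (Const 1 :: 'n wpoly) * fact s * fact b / fact (nat (int s - p)) *
       of_real ((norm z)\<^sup>2) ^ nat (int s - p) * weval e z
     else 0)"
  using assms
proof (induction s arbitrary: p q e b)
  case 0
  then show ?case
  proof (induction b arbitrary: q e)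
    case 0
    show ?case
    proof (cases "p = 0 \<and> q = 0")
      case True
      have "gaussian_integral (moment_poly z 0 0 e) = gaussian_integral (Mul (Const (weval e z)) (Const 1) :: 'n wpoly)"
        by (rule gaussian_integral_cong) (use True bideg_00[OF 0(1)] in \<open>simp add: moment_poly_def\<close>)
      with True show ?thesis by simp
    next
      case False
      have "gaussian_integral (moment_poly z 0 0 e) = gaussian_integral e"
        by (rule gaussian_integral_cong) (simp add: moment_poly_def)
      also have "\<dots> = 0"
        using gaussian_integral_harmonic[OF 0] False by auto
      finally show ?thesis
        using bideg_negative[OF 0(1)] False by auto
    qed
  next
    case (Suc b)
    show ?case
    proof (cases "p < 0 \<or> q < 0")
      case True
      then have "weval e w = 0" for w
        using bideg_negative[OF Suc.prems(1)] by simp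
      then have "gaussian_integral (moment_poly z 0 (Suc b) e) = 0"
        by (intro gaussian_integral_eq_0) (simp add: moment_poly_def)
      with \<open>\<And>w. weval e w = 0\<close> show ?thesis by simp
    next
      case False
      have IH: "gaussian_integral (moment_poly z 0 b (danti z e)) =
        (if p \<le> int 0 \<and> int 0 - p = int b - (q - 1)
         then gaussian_integral (Const 1 :: 'n wpoly) * fact 0 * fact b / fact (nat (int 0 - p)) *
           of_real ((norm z)\<^sup>2) ^ nat (int 0 - p) * weval (danti z e) z else 0)"
        by (rule Suc.IH) (use Suc.prems in \<open>auto intro: bideg_danti harmonic_danti\<close>)
      show ?thesis
      proof (cases "p = 0 \<and> q = int b + 1")
        case True
        then have "of_int q = (of_nat (Suc b) :: complex)" by simp
        with True show ?thesis
          unfolding gaussian_integral_moment_0_Suc IH by (simp add: euler_danti[OF Suc.prems(1)])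
      next
        case False
        with \<open>\<not> (p < 0 \<or> q < 0)\<close> show ?thesis
          unfolding gaussian_integral_moment_0_Suc IH by auto
      qed
    qed
  qed
next
  case (Suc s)
  show ?case
  proof (cases "p < 0 \<or> q < 0")
    case True
    then have "weval e w = 0" for w
      using bideg_negative[OF Suc.prems(1)] by simp
    then have "gaussian_integral (moment_poly z (Suc s) b e) = 0"
      by (intro gaussian_integral_eq_0) (simp add: moment_poly_def)
    with \<open>\<And>w. weval e w = 0\<close> show ?thesis by simp
  next
    case False
    note pq = this
    note IH1 = Suc.IH[OF Suc.prems, of "b - 1"]
    note IH2 = Suc.IH[OF bideg_dhol[OF Suc.prems(1)] harmonic_dhol[OF Suc.prems(2)], of b]
    show ?thesis
    proof (cases "p \<le> int (Suc s) \<and> int (Suc s) - p = int b - q")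
      case nz: True
      define l where "l = nat (int (Suc s) - p)"
      have l: "int (Suc s) = p + int l" "int b = q + int l"
        using nz by (auto simp: l_def)
      have [simp]: "nat (int s - (p - 1)) = l" using l by simp
      have pl: "of_int p = (of_nat (Suc s) - of_nat l :: complex)"
      proof -
        have "p = int (Suc s) - int l" using l by simp
        then show ?thesis by simp
      qed
      have B: "gaussian_integral (moment_poly z s b (dhol z e)) =
          gaussian_integral (Const 1 :: 'n wpoly) * fact s * fact b / fact l * of_real ((norm z)\<^sup>2) ^ l * (of_int p * weval e z)"
        unfolding IH2 using l by (simp add: euler_dhol[OF Suc.prems(1)])
      show ?thesis
      proof (cases l)
        \<comment> \<open>For \<open>l = 0\<close> only the term with the derivative of \<open>e\<close> remains.\<close>
        case 0
        have "of_nat b * of_real ((norm z)\<^sup>2) * gaussian_integral (moment_poly z s (b - 1) e) = 0"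
          unfolding IH1 using l 0 by (auto simp: of_nat_diff)
        then show ?thesis
          unfolding gaussian_integral_moment_Suc B using nz 0 pl by (simp add: l_def)
      next
        case (Suc m)
        have b: "b > 0" using l Suc pq by linarith
        have A: "gaussian_integral (moment_poly z s (b - 1) e) =
          gaussian_integral (Const 1 :: 'n wpoly) * fact s * fact (b - 1) / fact m * of_real ((norm z)\<^sup>2) ^ m * weval e z"
        proof -
          have "p \<le> int s" "int s - p = int (b - 1) - q" "nat (int s - p) = m"
            using l Suc b by (auto simp: of_nat_diff)
          then show ?thesis unfolding IH1 by simp
        qed
        have fb: "fact b = of_nat b * (fact (b - 1) :: complex)"
          using b by (simp add: fact_reduce)
        have "gaussian_integral (moment_poly z (Suc s) b e) =
          gaussian_integral (Const 1 :: 'n wpoly) * fact s * fact b / fact l * of_real ((norm z)\<^sup>2) ^ l * weval e z *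
            (of_nat l + of_int p)"
          unfolding gaussian_integral_moment_Suc A B fb Suc by (simp add: field_simps del: of_nat_Suc)
        also have "of_nat l + of_int p = (of_nat (Suc s) :: complex)"
          using pl by simp
        finally have "gaussian_integral (moment_poly z (Suc s) b e) =
            gaussian_integral (Const 1 :: 'n wpoly) * fact (Suc s) * fact b / fact l * of_real ((norm z)\<^sup>2) ^ l * weval e z"
          by (simp add: algebra_simps)
        then show ?thesis
          unfolding l_def using nz by (simp only: simp_thms if_True)
      qed
    next
      case z: False
      have "gaussian_integral (moment_poly z s b (dhol z e)) = 0"
        unfolding IH2 using z by auto
      moreover have "of_nat b * gaussian_integral (moment_poly z s (b - 1) e) = 0"
        unfolding IH1 using z by (cases b) auto
      ultimately show ?thesis
        unfolding gaussian_integral_moment_Suc using z by auto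
    qed
  qed
qed

text \<open>
  The volume of the unit ball of \<open>C^n\<close> is \<open>\<pi>^n / n!\<close>, which fixes the constant in the polar
  formula.
\<close>
lemma gaussian_integral_one: "gaussian_integral (Const 1 :: 'n::finite wpoly) = of_real (pi ^ CARD('n))"
proof -
  let ?n = "CARD('n)"
  have D: "DIM(complex^'n) = 2 * ?n" by simp
  obtain C where "C \<ge> 0" and
    C: "ennreal C = ennreal (DIM(complex^'n) + 0) * (\<integral>\<^sup>+w. ennreal 1 * indicator (cball (0::complex^'n) 1) w \<partial>lborel)"
    and int: "\<And>G :: real \<Rightarrow> complex. G \<in> borel_measurable borel \<Longrightarrow>
      (LINT w|lborel. 1 *\<^sub>R G (norm (w::complex^'n))) =
      (LINT r|lborel. (C * r ^ (DIM(complex^'n) + 0 - 1) * indicator {0<..} r) *\<^sub>R G r)"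
    by (rule radial_integral_nonneg[of "\<lambda>_::complex^'n. 1" 0 1]) auto
  have "(\<integral>\<^sup>+w. ennreal 1 * indicator (cball (0::complex^'n) 1) w \<partial>lborel) = ennreal (pi ^ ?n / fact ?n)"
    using unit_ball_vol_even[of ?n] by (simp add: emeasure_cball mult.commute)
  with C have "ennreal C = ennreal (2 * real ?n * (pi ^ ?n / fact ?n))"
    by (simp add: ennreal_mult[symmetric] D)
  then have C_eq: "C = 2 * real ?n * (pi ^ ?n / fact ?n)"
    using \<open>C \<ge> 0\<close> by (subst (asm) ennreal_inj) auto
  have "gaussian_integral (Const 1 :: 'n wpoly) = (LINT w|lborel. 1 *\<^sub>R (\<lambda>r. complex_of_real (exp (- r\<^sup>2))) (norm (w::complex^'n)))"
    by (simp add: gaussian_integral_def gauss_def)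
  also have "\<dots> = (LINT r|lborel. (C * r ^ (2 * ?n - 1) * indicator {0<..} r) *\<^sub>R complex_of_real (exp (- r\<^sup>2)))"
    by (subst int) (auto simp: mult.commute)
  also have "\<dots> = of_real C * (LINT r|lborel. (r ^ (2 * ?n - 1) * indicator {0<..} r) *\<^sub>R complex_of_real (exp (- r\<^sup>2)))"
    by (subst Bochner_Integration.integral_mult_right_zero[symmetric])
      (simp add: scaleR_conv_of_real mult.assoc)
  also have "\<dots> = of_real (C * fact (?n - 1) / 2)"
    by (subst gaussian_odd_moment) auto
  also have "C * fact (?n - 1) / 2 = pi ^ ?n"
    unfolding C_eq by (simp add: fact_reduce[of ?n] field_simps)
  finally show ?thesis .
qed

section \<open>Moments of harmonic polynomials against radial weights\<close>

text \<open>
  The integrand without \<open>G\<close> is homogeneous, so \<open>G\<close> enters through one radial integral with a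
  constant \<open>C\<close>; comparison with the Gaussian weight evaluates \<open>C\<close>. If \<open>q + s = p + b\<close>, the
  total degree of homogeneity is \<open>2(q + s)\<close>, hence the exponent \<open>2(n + q + s) - 1\<close> of the
  radial integral.
\<close>
lemma radial_moment:
  fixes P :: "complex ^ 'n::finite \<Rightarrow> complex"
  assumes P: "P \<in> Hpq p q" and G: "G \<in> borel_measurable borel"
    and int: "integrable lborel (\<lambda>r. (r ^ (2 * CARD('n) + (p + q + s + b) - 1) * indicator {0<..} r) *\<^sub>R (G r :: complex))"
  shows "has_bochner_integral lborel
      (\<lambda>w. cdot z (cconj w) ^ s * cdot (cconj z) w ^ b * P w * G (norm w))
      (if p \<le> s \<and> q + s = p + b
       then of_real pi ^ CARD('n) * fact s * fact b / fact (s - p) * of_real ((norm z)\<^sup>2) ^ (s - p) * P z *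
         (2 / fact (CARD('n) + q + s - 1)) *
         (LINT r|lborel. (r ^ (2 * (CARD('n) + q + s) - 1) * indicator {0<..} r) *\<^sub>R G r)
       else 0)"
proof -
  obtain e where e: "bideg (int p) (int q) e" "harmonic e" "weval e = P"
    using P by (rule Hpq_wpoly)
  let ?e = "moment_poly z s b e"
  let ?d = "p + q + s + b"
  have we: "weval ?e w = cdot z (cconj w) ^ s * cdot (cconj z) w ^ b * P w" for w
    by (simp add: moment_poly_def e)
  have bid: "bideg (int (b + p)) (int (s + q)) ?e"
    unfolding moment_poly_def
    by (rule bideg_Mul'[OF bideg_wpow[OF bideg_LinC] bideg_Mul[OF bideg_wpow[OF bideg_Lin] e(1)]]) simp_all
  have hom: "weval ?e (t *\<^sub>R w) = of_real (t ^ ?d) * weval ?e w" if "t > 0" for t w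
  proof -
    have "nat (int (b + p) + int (s + q)) = ?d" by (simp add: nat_add_distrib nat_int_add)
    then show ?thesis using weval_scaleR[OF bid _ _ that, of w] by simp
  qed
  let ?K = "DIM(complex^'n) + ?d - 1"
  have K: "?K = 2 * CARD('n) + ?d - 1" by simp
  obtain C where C:
    "\<And>G :: real \<Rightarrow> complex. G \<in> borel_measurable borel \<Longrightarrow>
      integrable lborel (\<lambda>r. (r ^ ?K * indicator {0<..} r) *\<^sub>R G r) \<Longrightarrow>
      integrable lborel (\<lambda>w. weval ?e w * G (norm w))"
    "\<And>G :: real \<Rightarrow> complex. G \<in> borel_measurable borel \<Longrightarrow>
      integrable lborel (\<lambda>r. (r ^ ?K * indicator {0<..} r) *\<^sub>R G r) \<Longrightarrow>
      (LINT w|lborel. weval ?e w * G (norm w)) = C * (LINT r|lborel. (r ^ ?K * indicator {0<..} r) *\<^sub>R G r)"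
    by (rule radial_integral_complex[of "weval ?e" ?d, OF continuous_on_weval hom]) blast+
  \<comment> \<open>The Gaussian weight links \<open>C\<close> to the moment that is already known.\<close>
  have "(LINT w|lborel. weval ?e w * complex_of_real (exp (- (norm w)\<^sup>2))) =
     C * (LINT r|lborel. (r ^ ?K * indicator {0<..} r) *\<^sub>R complex_of_real (exp (- r\<^sup>2)))"
  proof (rule C(2))
    have "integrable lborel (\<lambda>r. complex_of_real ((r ^ ?K * indicator {0<..} r) *\<^sub>R exp (- r\<^sup>2)))"
      unfolding complex_of_real_integrable_eq by (rule gaussian_power_integrable)
    then show "integrable lborel (\<lambda>r. (r ^ ?K * indicator {0<..} r) *\<^sub>R complex_of_real (exp (- r\<^sup>2)))"
      by (simp add: scaleR_conv_of_real)
  qed measurable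
  then have gC: "gaussian_integral ?e = C * (LINT r|lborel. (r ^ ?K * indicator {0<..} r) *\<^sub>R complex_of_real (exp (- r\<^sup>2)))"
    by (simp add: gaussian_integral_def gauss_def mult.commute)
  have hb: "has_bochner_integral lborel (\<lambda>w. weval ?e w * G (norm w))
      (C * (LINT r|lborel. (r ^ ?K * indicator {0<..} r) *\<^sub>R G r))"
    unfolding has_bochner_integral_iff using C[OF G] int K by simp
  show ?thesis
  proof (cases "p \<le> s \<and> q + s = p + b")
    case True
    note if_P[OF True, simp]
    define M where "M = CARD('n) + q + s"
    have "?d = 2 * (q + s)" using True by simp
    then have KM: "?K = 2 * M - 1" unfolding K M_def by simp
    have M: "M > 0" by (simp add: M_def)
    have l: "nat (int s - int p) = s - p" "int p \<le> int s" "int s - int p = int b - int q"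
      using True by auto
    have "gaussian_integral ?e = of_real pi ^ CARD('n) * fact s * fact b / fact (s - p) * of_real ((norm z)\<^sup>2) ^ (s - p) * P z"
      using gaussian_integral_moment[OF e(1,2), of z s b] l by (simp add: gaussian_integral_one e)
    moreover have "gaussian_integral ?e = C * (fact (M - 1) / 2)"
      unfolding gC KM gaussian_odd_moment[OF M] ..
    ultimately have "C = of_real pi ^ CARD('n) * fact s * fact b / fact (s - p) * of_real ((norm z)\<^sup>2) ^ (s - p) * P z * (2 / fact (M - 1))"
      by (simp add: field_simps)
    with hb show ?thesis
      unfolding KM using True by (simp add: we M_def)
  next
    case False
    then have "gaussian_integral ?e = 0"
      using gaussian_integral_moment[OF e(1,2), of z s b] by (auto split: if_splits)
    then have "C = 0"
      unfolding gC using gaussian_moment_nonzero[of ?K] by simp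
    with hb show ?thesis
      unfolding if_not_P[OF False] by (simp add: we)
  qed
qed

text \<open>
  Tailored to dominated convergence: the partial sums of the series of \<open>exp(\<beta> Y)\<close> are
  dominated by an exponential in \<open>r = |w|\<close>, and \<open>X\<close> and \<open>Y\<close> contribute powers of \<open>r\<close>.
\<close>
definition exp_integrable :: "nat \<Rightarrow> (real \<Rightarrow> complex) \<Rightarrow> bool" where
  "exp_integrable m0 G \<longleftrightarrow> G \<in> borel_measurable borel \<and>
     (\<forall>m B. integrable lborel (\<lambda>r. (r ^ m0 * indicator {0<..} r) *\<^sub>R (of_real (r ^ m * exp (B * r)) * G r)))"

lemma exp_integrable_power:
  assumes "exp_integrable m0 G" "m0 \<le> m"
  shows "integrable lborel (\<lambda>r. (r ^ m * indicator {0<..} r) *\<^sub>R G r)"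
proof -
  obtain j where m: "m = m0 + j" using assms le_Suc_ex by blast
  have "integrable lborel (\<lambda>r. (r ^ m0 * indicator {0<..} r) *\<^sub>R (of_real (r ^ j * exp (0 * r)) * G r))"
    using assms(1) unfolding exp_integrable_def by blast
  then show ?thesis
    by (simp add: m power_add scaleR_conv_of_real mult_ac)
qed

text \<open>
  Expand the exponential in powers of \<open>\<beta> (cnj z \<cdot> w)\<close>. The partial sums are dominated by the
  exponential of the absolute value, and by \<open>radial_moment\<close> at most one term of the series
  has a nonzero integral.
\<close>
lemma exp_moment:
  fixes P :: "complex ^ 'n::finite \<Rightarrow> complex" and \<beta> :: complex
  assumes P: "P \<in> Hpq p q" and G: "exp_integrable (2 * CARD('n) + p + q - 1) G"
  shows "has_bochner_integral lborel
      (\<lambda>w. cdot z (cconj w) ^ i * cdot (cconj z) w ^ s * exp (\<beta> * cdot (cconj z) w) * P w * G (norm w))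
      (if p \<le> i \<and> s \<le> q + (i - p)
       then \<beta> ^ (q + (i - p) - s) / fact (q + (i - p) - s) *
         (of_real pi ^ CARD('n) * fact i * fact (q + (i - p)) / fact (i - p) *
         of_real ((norm z)\<^sup>2) ^ (i - p) * P z * (2 / fact (CARD('n) + q + i - 1)) *
         (LINT r|lborel. (r ^ (2 * (CARD('n) + q + i) - 1) * indicator {0<..} r) *\<^sub>R G r))
       else 0)"
proof -
  let ?X = "\<lambda>w. cdot z (cconj w)" and ?Y = "\<lambda>w. cdot (cconj z) w"
  let ?F = "\<lambda>w. ?X w ^ i * ?Y w ^ s * exp (\<beta> * ?Y w) * P w * G (norm w)"
  define f where "f j w = \<beta> ^ j / fact j * (?X w ^ i * ?Y w ^ (s + j) * P w * G (norm w))" for j w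
  define c where "c j = (if p \<le> i \<and> q + i = p + (s + j)
       then \<beta> ^ j / fact j * (of_real pi ^ CARD('n) * fact i * fact (s + j) / fact (i - p) *
         of_real ((norm z)\<^sup>2) ^ (i - p) * P z * (2 / fact (CARD('n) + q + i - 1)) *
         (LINT r|lborel. (r ^ (2 * (CARD('n) + q + i) - 1) * indicator {0<..} r) *\<^sub>R G r))
       else 0)" for j
  have Gm [measurable]: "G \<in> borel_measurable borel"
    using G by (simp add: exp_integrable_def)
  obtain e where e: "weval e = P" using P by (rule Hpq_wpoly)
  have [measurable]: "P \<in> borel_measurable borel"
    unfolding e[symmetric] by (intro borel_measurable_continuous_onI continuous_on_weval)
  have [measurable]: "?X \<in> borel_measurable borel" "?Y \<in> borel_measurable borel"
    by (intro borel_measurable_continuous_onI continuous_intros)+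
  have f: "has_bochner_integral lborel (f j) (c j)" for j
  proof -
    have "integrable lborel (\<lambda>r. (r ^ (2 * CARD('n) + (p + q + i + (s + j)) - 1) * indicator {0<..} r) *\<^sub>R G r)"
      by (rule exp_integrable_power[OF G]) simp
    from has_bochner_integral_mult_right[OF radial_moment[OF P Gm this, of z], of "\<beta> ^ j / fact j"]
    show ?thesis
      unfolding f_def[abs_def] c_def
      by (simp only: if_distrib[where f = "\<lambda>x. \<beta> ^ j / fact j * x"] mult_zero_right)
  qed
  define W where "W w = norm (P w * (of_real ((norm z * norm w) ^ (i + s) * exp (norm \<beta> * norm z * norm w)) * G (norm w)))" for w
  have W: "integrable lborel W"
  proof -
    define B where "B = norm \<beta> * norm z"
    have "integrable lborel (\<lambda>r. of_real (norm z ^ (i + s)) *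
        ((r ^ (2 * CARD('n) + p + q - 1) * indicator {0<..} r) *\<^sub>R (of_real (r ^ (i + s) * exp (B * r)) * G r)))"
      using G unfolding exp_integrable_def by (intro integrable_mult_right) blast
    then have "integrable lborel (\<lambda>r. (r ^ (2 * CARD('n) + (p + q + 0 + 0) - 1) * indicator {0<..} r) *\<^sub>R
        (of_real ((norm z * r) ^ (i + s) * exp (B * r)) * G r))"
      by (simp add: power_mult_distrib scaleR_conv_of_real mult_ac add_ac)
    from radial_moment[OF P _ this, of z]
    have "integrable lborel (\<lambda>w. P w * (of_real ((norm z * norm w) ^ (i + s) * exp (B * norm w)) * G (norm w)))"
      by (auto simp: has_bochner_integral_iff)
    then show ?thesis
      unfolding W_def[abs_def] B_def by (rule integrable_norm)
  qed
  have lim: "(\<lambda>N. \<Sum>j<N. f j w) \<longlonglongrightarrow> ?F w" for w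
  proof -
    have "(\<lambda>j. (\<beta> * ?Y w) ^ j /\<^sub>R fact j) sums exp (\<beta> * ?Y w)"
      by (rule exp_converges)
    from sums_mult[OF this, of "?X w ^ i * ?Y w ^ s * P w * G (norm w)"]
    have "(\<lambda>j. f j w) sums ?F w"
      by (simp add: f_def scaleR_conv_of_real divide_inverse power_mult_distrib power_add mult_ac)
    then show ?thesis by (simp add: sums_def)
  qed
  have bound: "norm (\<Sum>j<N. f j w) \<le> W w" for N w
  proof -
    have X: "norm (?X w) \<le> norm z * norm w" "norm (?Y w) \<le> norm z * norm w"
      using norm_cdot_le[of z "cconj w"] norm_cdot_le[of "cconj z" w] by simp_all
    define a where "a = norm (P w) * norm (G (norm w))"
    have "norm (\<Sum>j<N. f j w) \<le> (\<Sum>j<N. norm (f j w))" by (rule norm_sum)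
    also have "\<dots> \<le> (\<Sum>j<N. (norm z * norm w) ^ (i + s) * a * ((norm \<beta> * norm z * norm w) ^ j / fact j))"
    proof (rule sum_mono)
      fix j
      have "norm (f j w) = (norm \<beta> ^ j / fact j * a) * (norm (?X w) ^ i * norm (?Y w) ^ (s + j))"
        by (simp add: f_def a_def norm_mult norm_power norm_divide)
      also have "\<dots> \<le> (norm \<beta> ^ j / fact j * a) * ((norm z * norm w) ^ i * (norm z * norm w) ^ (s + j))"
        using X by (intro mult_left_mono mult_mono power_mono) (auto simp: a_def)
      also have "\<dots> = (norm z * norm w) ^ (i + s) * a * ((norm \<beta> * norm z * norm w) ^ j / fact j)"
        by (simp add: power_add power_mult_distrib)
      finally show "norm (f j w) \<le> \<dots>" .
    qed
    also have "\<dots> = (norm z * norm w) ^ (i + s) * a * (\<Sum>j<N. (norm \<beta> * norm z * norm w) ^ j / fact j)"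
      by (simp add: sum_distrib_left)
    also have "\<dots> \<le> (norm z * norm w) ^ (i + s) * a * exp (norm \<beta> * norm z * norm w)"
    proof (rule mult_left_mono)
      have "(\<Sum>j<N. (norm \<beta> * norm z * norm w) ^ j /\<^sub>R fact j) \<le> (\<Sum>j. (norm \<beta> * norm z * norm w) ^ j /\<^sub>R fact j)"
        by (intro sum_le_suminf summable_exp_generic) auto
      then show "(\<Sum>j<N. (norm \<beta> * norm z * norm w) ^ j / fact j) \<le> exp (norm \<beta> * norm z * norm w)"
        by (simp add: exp_def divide_inverse mult.commute)
    qed (simp add: a_def)
    also have "\<dots> = W w"
      by (simp add: W_def a_def norm_mult norm_power del: of_real_mult of_real_power)
    finally show ?thesis .
  qed
  have meas: "?F \<in> borel_measurable lborel" "(\<lambda>w. \<Sum>j<N. f j w) \<in> borel_measurable lborel" for N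
    unfolding f_def by measurable
  have "integrable lborel ?F"
    by (rule integrable_dominated_convergence[OF meas W AE_I2[OF lim] AE_I2[OF bound]])
  moreover have "(\<lambda>N. LINT w|lborel. (\<Sum>j<N. f j w)) \<longlonglongrightarrow> (LINT w|lborel. ?F w)"
    by (rule integral_dominated_convergence[OF meas W AE_I2[OF lim] AE_I2[OF bound]])
  \<comment> \<open>The series of the integrals \<open>c j\<close> is summed in two ways.\<close>
  then have "c sums (LINT w|lborel. ?F w)"
    using f by (simp add: sums_def has_bochner_integral_iff)
  moreover have "c sums (if p \<le> i \<and> s \<le> q + (i - p) then c (q + (i - p) - s) else 0)"
  proof (cases "p \<le> i \<and> s \<le> q + (i - p)")
    case True
    then have "c = (\<lambda>j. if j = q + (i - p) - s then c j else 0)"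
      by (auto simp: c_def fun_eq_iff)
    then have "c sums c (q + (i - p) - s)"
      using sums_single[of "q + (i - p) - s" c] by simp
    then show ?thesis by (simp only: if_P[OF True])
  next
    case False
    then have "c = (\<lambda>_. 0)" by (auto simp: c_def fun_eq_iff)
    then show ?thesis by (simp only: if_not_P[OF False] sums_zero)
  qed
  ultimately have "has_bochner_integral lborel ?F (if p \<le> i \<and> s \<le> q + (i - p) then c (q + (i - p) - s) else 0)"
    by (simp add: has_bochner_integral_iff sums_unique2)
  also have "(if p \<le> i \<and> s \<le> q + (i - p) then c (q + (i - p) - s) else 0) =
     (if p \<le> i \<and> s \<le> q + (i - p)
       then \<beta> ^ (q + (i - p) - s) / fact (q + (i - p) - s) *
         (of_real pi ^ CARD('n) * fact i * fact (q + (i - p)) / fact (i - p) *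
         of_real ((norm z)\<^sup>2) ^ (i - p) * P z * (2 / fact (CARD('n) + q + i - 1)) *
         (LINT r|lborel. (r ^ (2 * (CARD('n) + q + i) - 1) * indicator {0<..} r) *\<^sub>R G r))
       else 0)"
    by (auto simp: c_def)
  finally show ?thesis .
qed

section \<open>Laguerre polynomials\<close>

definition claguerre :: "nat \<Rightarrow> nat \<Rightarrow> complex \<Rightarrow> complex" where
  "claguerre a k x = (\<Sum>i\<le>k. (- 1) ^ i * of_nat ((k + a) choose (k - i)) * x ^ i / fact i)"

lemma of_real_laguerre: "of_real (laguerre a k x) = claguerre a k (of_real x)"
  by (simp add: laguerre_def claguerre_def)

lemma sum_nested_triangle:
  fixes f :: "nat \<Rightarrow> nat \<Rightarrow> 'a::comm_monoid_add"
  shows "(\<Sum>i\<le>k. \<Sum>l\<le>k - i. f i l) = (\<Sum>m\<le>k. \<Sum>i\<le>m. f i (m - i))"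
proof -
  have "(\<Sum>i\<le>k. \<Sum>l\<le>k - i. f i l) = (\<Sum>(i, l)\<in>{(i, l). i + l \<le> k}. f i l)"
    by (subst sum.Sigma) (auto intro!: sum.cong)
  then show ?thesis
    by (simp add: sum.triangle_reindex_eq)
qed

lemma sum_nested_swap:
  fixes f :: "nat \<Rightarrow> nat \<Rightarrow> 'a::comm_monoid_add"
  shows "(\<Sum>i\<le>k. \<Sum>l\<le>k - i. f i l) = (\<Sum>l\<le>k. \<Sum>i\<le>k - l. f i l)"
  unfolding sum_nested_triangle[of "\<lambda>i l. f l i"] sum_nested_triangle[of f]
proof (rule sum.cong)
  show "(\<Sum>i\<le>m. f i (m - i)) = (\<Sum>i\<le>m. f (m - i) i)" for m
    by (rule sum.reindex_bij_witness[of _ "\<lambda>i. m - i" "\<lambda>i. m - i"]) auto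
qed simp

text \<open>
  Taylor's formula: the derivative of the Laguerre polynomial of type \<open>a\<close> and degree \<open>k\<close> is
  minus the one of type \<open>a + 1\<close> and degree \<open>k - 1\<close>.
\<close>
lemma claguerre_taylor:
  "claguerre a k (v - x) = (\<Sum>i\<le>k. x ^ i / fact i * claguerre (a + i) (k - i) v)"
proof -
  have "(\<Sum>i\<le>k. x ^ i / fact i * claguerre (a + i) (k - i) v) =
    (\<Sum>i\<le>k. \<Sum>l\<le>k - i. x ^ i / fact i * ((- 1) ^ l * of_nat ((k + a) choose (k - (i + l))) * v ^ l / fact l))"
    by (intro sum.cong) (auto simp: claguerre_def sum_distrib_left diff_diff_left)
  also have "\<dots> = (\<Sum>m\<le>k. \<Sum>i\<le>m. x ^ i / fact i *
      ((- 1) ^ (m - i) * of_nat ((k + a) choose (k - (i + (m - i)))) * v ^ (m - i) / fact (m - i)))"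
    by (rule sum_nested_triangle)
  also have "\<dots> = claguerre a k (v - x)"
    unfolding claguerre_def
  proof (rule sum.cong)
    fix m assume "m \<in> {..k}"
    have "(v - x) ^ m = (\<Sum>i\<le>m. of_nat (m choose i) * (- x) ^ i * v ^ (m - i))"
      using binomial_ring[of "- x" v m] by simp
    then have "(- 1) ^ m * of_nat ((k + a) choose (k - m)) * (v - x) ^ m / fact m =
      (\<Sum>i\<le>m. (- 1) ^ m * of_nat ((k + a) choose (k - m)) * (of_nat (m choose i) * (- x) ^ i * v ^ (m - i)) / fact m)"
      by (simp add: sum_distrib_left sum_divide_distrib)
    also have "\<dots> = (\<Sum>i\<le>m. x ^ i / fact i *
      ((- 1) ^ (m - i) * of_nat ((k + a) choose (k - (i + (m - i)))) * v ^ (m - i) / fact (m - i)))"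
    proof (rule sum.cong)
      fix i assume "i \<in> {..m}"
      then have i: "i \<le> m" by simp
      have sg: "(- 1) ^ m * (- x) ^ i = (- 1) ^ (m - i) * x ^ i"
      proof -
        obtain l where "m = i + l"
          using i le_Suc_ex by blast
        then show ?thesis
          by (simp add: power_add mult_ac flip: power_mult_distrib)
      qed
      have "(- 1) ^ m * of_nat ((k + a) choose (k - m)) * (of_nat (m choose i) * (- x) ^ i * v ^ (m - i)) / fact m
        = ((- 1) ^ m * (- x) ^ i) * of_nat ((k + a) choose (k - m)) * (of_nat (m choose i) * v ^ (m - i)) / fact m"
        by (simp add: mult_ac)
      also have "\<dots> = x ^ i / fact i *
          ((- 1) ^ (m - i) * of_nat ((k + a) choose (k - (i + (m - i)))) * v ^ (m - i) / fact (m - i))"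
        unfolding sg using i by (simp add: binomial_fact field_simps)
      finally show "(- 1) ^ m * of_nat ((k + a) choose (k - m)) * (of_nat (m choose i) * (- x) ^ i * v ^ (m - i)) / fact m
        = \<dots>" .
    qed simp
    finally show "(\<Sum>i\<le>m. x ^ i / fact i *
      ((- 1) ^ (m - i) * of_nat ((k + a) choose (k - (i + (m - i)))) * v ^ (m - i) / fact (m - i))) =
      (- 1) ^ m * of_nat ((k + a) choose (k - m)) * (v - x) ^ m / fact m" ..
  qed simp
  finally show ?thesis ..
qed

lemma claguerre_taylor2:
  "claguerre a k (v - x - y) =
    (\<Sum>i\<le>k. \<Sum>r\<le>k - i. x ^ i / fact i * (y ^ r / fact r) * claguerre (a + i + r) (k - i - r) v)"
proof -
  have "claguerre a k (v - y - x) =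
    (\<Sum>i\<le>k. x ^ i / fact i * (\<Sum>r\<le>k - i. y ^ r / fact r * claguerre (a + i + r) (k - i - r) v))"
    by (subst claguerre_taylor) (simp only: claguerre_taylor[of _ _ v y])
  moreover have "v - x - y = v - y - x" by simp
  ultimately show ?thesis
    by (simp only: sum_distrib_left mult.assoc)
qed

lemma claguerre_vandermonde:
  "(\<Sum>r\<le>k. of_nat (b choose r) * claguerre (a + r) (k - r) v) = claguerre (a + b) k v"
proof -
  have "(\<Sum>r\<le>k. of_nat (b choose r) * claguerre (a + r) (k - r) v) =
    (\<Sum>r\<le>k. \<Sum>l\<le>k - r. of_nat (b choose r) *
      ((- 1) ^ l * of_nat ((k + a) choose (k - l - r)) * v ^ l / fact l))"
    by (intro sum.cong) (auto simp: claguerre_def sum_distrib_left add.commute)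
  also have "\<dots> = (\<Sum>l\<le>k. \<Sum>r\<le>k - l. of_nat (b choose r) *
      ((- 1) ^ l * of_nat ((k + a) choose (k - l - r)) * v ^ l / fact l))"
    by (rule sum_nested_swap)
  also have "\<dots> = (\<Sum>l\<le>k. (- 1) ^ l * of_nat (\<Sum>r\<le>k - l. (b choose r) * ((k + a) choose (k - l - r))) * v ^ l / fact l)"
    by (simp add: sum_distrib_left sum_distrib_right sum_divide_distrib mult_ac)
  also have "\<dots> = claguerre (a + b) k v"
    unfolding vandermonde claguerre_def by (simp add: add_ac)
  finally show ?thesis .
qed

text \<open>
  The form that occurs when the powers of \<open>cnj z \<cdot> w\<close> from the Laguerre polynomial, of
  exponent \<open>r\<close>, and from the exponential, of exponent \<open>b - r\<close>, are collected.
\<close>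
lemma claguerre_vandermonde':
  "(\<Sum>r\<le>k. if r \<le> b then claguerre (a + r) (k - r) v / (fact r * fact (b - r)) else 0) =
    claguerre (a + b) k v / fact b"
proof -
  have "(\<Sum>r\<le>k. if r \<le> b then claguerre (a + r) (k - r) v / (fact r * fact (b - r)) else 0) =
    (\<Sum>r\<le>k. of_nat (b choose r) * claguerre (a + r) (k - r) v / fact b)"
    by (intro sum.cong) (auto simp: binomial_fact field_simps binomial_eq_0)
  then show ?thesis
    by (simp add: claguerre_vandermonde sum_divide_distrib[symmetric])
qed

lemma power_div_fact_le_exp: "(x::real) \<ge> 0 \<Longrightarrow> x ^ m / fact m \<le> exp x"
proof -
  assume x: "x \<ge> 0"
  have "(\<Sum>i\<in>{m}. x ^ i /\<^sub>R fact i) \<le> (\<Sum>i. x ^ i /\<^sub>R fact i)"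
    using x by (intro sum_le_suminf summable_exp_generic) auto
  then show ?thesis
    by (simp add: exp_def divide_inverse mult.commute)
qed

text \<open>
  A growth bound with half the rate of the Gaussian factor \<open>exp(-v/2)\<close> that accompanies the
  polynomial at the argument \<open>v\<close>.
\<close>
lemma norm_claguerre_le:
  assumes "v \<ge> 0"
  shows "norm (claguerre a k (of_real v)) \<le> (\<Sum>i\<le>k. real ((k + a) choose (k - i)) * 4 ^ i) * exp (v / 4)"
proof -
  have "norm (claguerre a k (of_real v)) \<le>
      (\<Sum>i\<le>k. norm ((- 1) ^ i * of_nat ((k + a) choose (k - i)) * complex_of_real v ^ i / fact i))"
    unfolding claguerre_def by (rule norm_sum)
  also have "\<dots> = (\<Sum>i\<le>k. (real ((k + a) choose (k - i)) * 4 ^ i) * ((v / 4) ^ i / fact i))"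
    using assms by (intro sum.cong) (auto simp: norm_mult norm_divide norm_power power_divide)
  also have "\<dots> \<le> (\<Sum>i\<le>k. (real ((k + a) choose (k - i)) * 4 ^ i) * exp (v / 4))"
    using assms by (intro sum_mono mult_left_mono power_div_fact_le_exp) auto
  finally show ?thesis
    by (simp add: sum_distrib_right)
qed

text \<open>
  The radial coefficients of the kernel expansion, as functions of \<open>r = |w|\<close> for
  \<open>\<sigma> = |z|^2\<close>.
\<close>
definition laguerre_weight :: "real \<Rightarrow> real \<Rightarrow> nat \<Rightarrow> nat \<Rightarrow> real \<Rightarrow> complex" where
  "laguerre_weight c \<sigma> a k r =
     of_real (exp (- (c * (\<sigma> + r\<^sup>2) / 4))) * claguerre a k (of_real (c * (\<sigma> + r\<^sup>2) / 2))"

lemma laguerre_weight_measurable [measurable]: "laguerre_weight c \<sigma> a k \<in> borel_measurable borel"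
  unfolding laguerre_weight_def claguerre_def
  by (intro borel_measurable_continuous_onI continuous_intros) auto

text \<open>
  The weight decays like a Gaussian, so its product with powers and exponentials is bounded.
\<close>
lemma exp_integrable_laguerre_weight:
  assumes c: "c > 0" and \<sigma>: "\<sigma> \<ge> 0" and g [measurable]: "g \<in> borel_measurable borel"
    and int: "integrable lborel (\<lambda>r. (r ^ m0 * indicator {0<..} r) *\<^sub>R g r)"
  shows "exp_integrable m0 (\<lambda>r. laguerre_weight c \<sigma> a k r * g r)"
  unfolding exp_integrable_def
proof (intro conjI allI)
  show "(\<lambda>r. laguerre_weight c \<sigma> a k r * g r) \<in> borel_measurable borel" by measurable
  fix m :: nat and B :: real
  define K where "K = (\<Sum>i\<le>k. real ((k + a) choose (k - i)) * 4 ^ i)"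
  have K: "K \<ge> 0" unfolding K_def by (intro sum_nonneg) auto
  \<comment> \<open>The exponent \<open>(B + 1) r - c r^2 / 8\<close> has the maximum \<open>2 (B + 1)^2 / c\<close>; the power \<open>r^m\<close> costs
    \<open>m! exp r\<close>.\<close>
  define M where "M = fact m * K * exp (2 * (B + 1)\<^sup>2 / c)"
  have bound: "r ^ m * exp (B * r) * norm (laguerre_weight c \<sigma> a k r) \<le> M" if r: "r > 0" for r
  proof -
    define v where "v = c * (\<sigma> + r\<^sup>2) / 2"
    have v: "v \<ge> 0" "v \<ge> c * r\<^sup>2 / 2"
      using c \<sigma> by (auto simp: v_def field_simps)
    have "norm (laguerre_weight c \<sigma> a k r) = exp (- (v / 2)) * norm (claguerre a k (of_real v))"
      by (simp add: laguerre_weight_def v_def norm_mult)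
    also have "\<dots> \<le> exp (- (v / 2)) * (K * exp (v / 4))"
      unfolding K_def using norm_claguerre_le[OF v(1)] by (intro mult_left_mono) auto
    also have "\<dots> = K * exp (- (v / 4))"
      by (simp add: mult_exp_exp)
    also have "\<dots> \<le> K * exp (- (c * r\<^sup>2 / 8))"
      using v K by (intro mult_left_mono) auto
    finally have 1: "norm (laguerre_weight c \<sigma> a k r) \<le> K * exp (- (c * r\<^sup>2 / 8))" .
    have 2: "r ^ m \<le> fact m * exp r"
      using power_div_fact_le_exp[of r m] r by (simp add: field_simps)
    have "r ^ m * exp (B * r) * norm (laguerre_weight c \<sigma> a k r) \<le>
        (fact m * exp r) * exp (B * r) * (K * exp (- (c * r\<^sup>2 / 8)))"
      using 1 2 r K by (intro mult_mono) auto
    also have "\<dots> = fact m * K * (exp r * exp (B * r) * exp (- (c * r\<^sup>2 / 8)))"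
      by (simp only: mult_ac)
    also have "\<dots> = fact m * K * exp (r + B * r + - (c * r\<^sup>2 / 8))"
      by (simp only: exp_add)
    also have "\<dots> \<le> M"
    proof -
      define s where "s = (B + 1) / c"
      have s: "B = c * s - 1" using c by (simp add: s_def)
      have "r + B * r + - (c * r\<^sup>2 / 8) = 2 * c * s\<^sup>2 - c / 8 * (r - 4 * s)\<^sup>2"
        unfolding s by (simp add: power2_eq_square algebra_simps)
      also have "\<dots> \<le> 2 * c * s\<^sup>2" using c by simp
      also have "\<dots> = 2 * (B + 1)\<^sup>2 / c"
        using c by (simp add: s_def power2_eq_square)
      finally show ?thesis
        unfolding M_def using K by (intro mult_left_mono) auto
    qed
    finally show ?thesis .
  qed
  show "integrable lborel (\<lambda>r. (r ^ m0 * indicator {0<..} r) *\<^sub>R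
      (of_real (r ^ m * exp (B * r)) * (laguerre_weight c \<sigma> a k r * g r)))"
  proof (rule Bochner_Integration.integrable_bound)
    show "integrable lborel (\<lambda>r. of_real M * ((r ^ m0 * indicator {0<..} r) *\<^sub>R g r))"
      by (intro integrable_mult_right int)
    have "norm ((r ^ m0 * indicator {0<..} r) *\<^sub>R (of_real (r ^ m * exp (B * r)) * (laguerre_weight c \<sigma> a k r * g r)))
        \<le> norm (of_real M * ((r ^ m0 * indicator {0<..} r) *\<^sub>R g r))" for r
    proof (cases "r > 0")
      case True
      have "norm ((r ^ m0 * indicator {0<..} r) *\<^sub>R (of_real (r ^ m * exp (B * r)) * (laguerre_weight c \<sigma> a k r * g r)))
        = (r ^ m * exp (B * r) * norm (laguerre_weight c \<sigma> a k r)) * (r ^ m0 * norm (g r))"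
        using True by (simp add: norm_mult norm_power)
      also have "\<dots> \<le> M * (r ^ m0 * norm (g r))"
        using bound[OF True] True by (intro mult_right_mono) auto
      also have "\<dots> = norm (of_real M * ((r ^ m0 * indicator {0<..} r) *\<^sub>R g r))"
        using True K by (simp add: norm_mult norm_power M_def)
      finally show ?thesis .
    qed simp
    then show "AE r in lborel. norm ((r ^ m0 * indicator {0<..} r) *\<^sub>R
      (of_real (r ^ m * exp (B * r)) * (laguerre_weight c \<sigma> a k r * g r)))
        \<le> norm (of_real M * ((r ^ m0 * indicator {0<..} r) *\<^sub>R g r))"
      by simp
  qed measurable
qed

lemma laguerre_weight_vandermonde:
  assumes "c > 0" "\<sigma> \<ge> 0" and g: "g \<in> borel_measurable borel"
    and int: "integrable lborel (\<lambda>r. (r ^ m0 * indicator {0<..} r) *\<^sub>R g r)" and m: "m0 \<le> m"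
  shows "(\<Sum>s\<le>k. if s \<le> b then (LINT r|lborel. (r ^ m * indicator {0<..} r) *\<^sub>R
        (laguerre_weight c \<sigma> (a + s) (k - s) r * g r)) / (fact s * fact (b - s)) else 0) =
    (LINT r|lborel. (r ^ m * indicator {0<..} r) *\<^sub>R (laguerre_weight c \<sigma> (a + b) k r * g r)) / fact b"
proof -
  define F where "F s r = (r ^ m * indicator {0<..} r) *\<^sub>R (laguerre_weight c \<sigma> (a + s) (k - s) r * g r)" for s r
  have F: "integrable lborel (F s)" for s
    unfolding F_def[abs_def] by (rule exp_integrable_power[OF exp_integrable_laguerre_weight[OF assms(1,2) g int] m])
  have "(\<Sum>s\<le>k. if s \<le> b then (LINT r|lborel. F s r) / (fact s * fact (b - s)) else 0) =
      (\<Sum>s\<le>k. LINT r|lborel. (if s \<le> b then F s r / (fact s * fact (b - s)) else 0))"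
    by (intro sum.cong) auto
  also have "\<dots> = (LINT r|lborel. (\<Sum>s\<le>k. if s \<le> b then F s r / (fact s * fact (b - s)) else 0))"
  proof (rule Bochner_Integration.integral_sum[symmetric])
    show "integrable lborel (\<lambda>r. if s \<le> b then F s r / (fact s * fact (b - s)) else 0)" for s
      using F[of s] by (cases "s \<le> b") auto
  qed
  also have "(\<lambda>r. \<Sum>s\<le>k. if s \<le> b then F s r / (fact s * fact (b - s)) else 0) =
      (\<lambda>r. ((r ^ m * indicator {0<..} r) *\<^sub>R (laguerre_weight c \<sigma> (a + b) k r * g r)) / fact b)"
  proof
    fix r
    define x where "x = (r ^ m * indicator {0<..} r) *\<^sub>R (complex_of_real (exp (- (c * (\<sigma> + r\<^sup>2) / 4))) * g r)"
    define v where "v = complex_of_real (c * (\<sigma> + r\<^sup>2) / 2)"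
    have "(\<Sum>s\<le>k. if s \<le> b then F s r / (fact s * fact (b - s)) else 0) =
      (\<Sum>s\<le>k. x * (if s \<le> b then claguerre (a + s) (k - s) v / (fact s * fact (b - s)) else 0))"
      by (intro sum.cong) (auto simp: F_def x_def v_def laguerre_weight_def scaleR_conv_of_real mult_ac)
    also have "\<dots> = x * (claguerre (a + b) k v / fact b)"
      by (simp add: sum_distrib_left[symmetric] claguerre_vandermonde')
    finally show "(\<Sum>s\<le>k. if s \<le> b then F s r / (fact s * fact (b - s)) else 0) =
      ((r ^ m * indicator {0<..} r) *\<^sub>R (laguerre_weight c \<sigma> (a + b) k r * g r)) / fact b"
      by (simp add: x_def v_def laguerre_weight_def scaleR_conv_of_real mult_ac)
  qed
  finally show ?thesis
    unfolding F_def[abs_def] by simp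
qed

text \<open>
  Since \<open>|z - w|^2 = |z|^2 + |w|^2 - X - Y\<close> with \<open>X = z \<cdot> cnj w\<close> and \<open>Y = cnj X\<close>, the real
  exponent \<open>-c|z - w|^2/4\<close> and the phase \<open>-c Im X / 2\<close> combine to
  \<open>-c(|z|^2 + |w|^2)/4 + cY/2\<close>: the kernel is a polynomial in \<open>X\<close> and \<open>Y\<close> times an
  exponential of \<open>Y\<close> alone.
\<close>
lemma laguerre_kernel_expansion:
  fixes z w :: "complex ^ 'n::finite" and c :: real
  defines "\<beta> \<equiv> complex_of_real (c / 2)"
  shows "of_real (laguerre a k (c * (norm (z - w))\<^sup>2 / 2) * exp (- (c * (norm (z - w))\<^sup>2 / 4))) *
      exp (- (\<i> / 2 * of_real c * of_real (Im (cdot z (cconj w))))) =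
    (\<Sum>i\<le>k. \<Sum>s\<le>k - i. \<beta> ^ i / fact i * (\<beta> ^ s / fact s) *
      (cdot z (cconj w) ^ i * cdot (cconj z) w ^ s * exp (\<beta> * cdot (cconj z) w) *
        laguerre_weight c ((norm z)\<^sup>2) (a + i + s) (k - i - s) (norm w)))"
proof -
  let ?X = "cdot z (cconj w)" and ?Y = "cdot (cconj z) w"
  define v where "v = c * ((norm z)\<^sup>2 + (norm w)\<^sup>2) / 2"
  have Y: "?Y = cnj ?X" by (simp add: cnj_cdot)
  have XY: "?X + ?Y = of_real (2 * (z \<bullet> w))"
    unfolding Y complex_add_cnj by (simp add: Re_cdot_cconj)
  have nrm: "(norm (z - w))\<^sup>2 = (norm z)\<^sup>2 + (norm w)\<^sup>2 - 2 * (z \<bullet> w)"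
    by (simp add: power2_norm_eq_inner inner_diff_left inner_diff_right inner_commute)
  have arg: "complex_of_real (c * (norm (z - w))\<^sup>2 / 2) = of_real v - \<beta> * ?X - \<beta> * ?Y"
  proof -
    have "complex_of_real (c * (norm (z - w))\<^sup>2 / 2) = of_real v - \<beta> * of_real (2 * (z \<bullet> w))"
      unfolding nrm by (simp add: v_def \<beta>_def field_simps)
    then show ?thesis
      unfolding XY[symmetric] by (simp add: algebra_simps)
  qed
  have ex: "complex_of_real (exp (- (c * (norm (z - w))\<^sup>2 / 4))) * exp (- (\<i> / 2 * of_real c * of_real (Im ?X)))
     = of_real (exp (- (v / 2))) * exp (\<beta> * ?Y)"
  proof -
    have "of_real (- (c * (norm (z - w))\<^sup>2 / 4)) + - (\<i> / 2 * of_real c * of_real (Im ?X)) =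
       of_real (- (v / 2)) + \<beta> * ?Y"
      unfolding nrm Y Re_cdot_cconj[symmetric]
      by (simp add: v_def \<beta>_def complex_eq_iff field_simps)
    then show ?thesis
      by (simp only: exp_of_real[symmetric] exp_add[symmetric])
  qed
  have lw: "of_real (exp (- (v / 2))) * claguerre a' k' (of_real v) =
      laguerre_weight c ((norm z)\<^sup>2) a' k' (norm w)" for a' k'
    by (simp add: laguerre_weight_def v_def)
  have "of_real (laguerre a k (c * (norm (z - w))\<^sup>2 / 2) * exp (- (c * (norm (z - w))\<^sup>2 / 4))) *
      exp (- (\<i> / 2 * of_real c * of_real (Im ?X))) =
      claguerre a k (of_real v - \<beta> * ?X - \<beta> * ?Y) * (of_real (exp (- (v / 2))) * exp (\<beta> * ?Y))"
    unfolding of_real_mult[of "laguerre _ _ _"] of_real_laguerre arg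
    by (simp only: mult.assoc[of "claguerre _ _ _"] ex)
  also have "\<dots> = (\<Sum>i\<le>k. \<Sum>s\<le>k - i. \<beta> ^ i / fact i * (\<beta> ^ s / fact s) *
      (?X ^ i * ?Y ^ s * exp (\<beta> * ?Y) *
        (of_real (exp (- (v / 2))) * claguerre (a + i + s) (k - i - s) (of_real v))))"
    unfolding claguerre_taylor2 sum_distrib_right
    by (intro sum.cong refl) (simp add: power_mult_distrib)
  finally show ?thesis
    by (simp only: lw)
qed

section \<open>The scalar Hecke-Bochner identity\<close>

text \<open>
  The twisted convolution on \<open>C^N\<close> of a radial function and the Laguerre function of degree
  \<open>k\<close>, divided by \<open>\<pi>^N\<close>, at a point with \<open>|z|^2 = \<sigma>\<close>. As \<open>N\<close> is a number here, the formula
  can be compared across dimensions.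
\<close>
definition radial_twisted_conv :: "nat \<Rightarrow> nat \<Rightarrow> real \<Rightarrow> real \<Rightarrow> (real \<Rightarrow> complex) \<Rightarrow> complex" where
  "radial_twisted_conv N k c \<sigma> g =
    (\<Sum>l\<le>k. of_real (c / 2) ^ (2 * l) * of_real \<sigma> ^ l / fact l * (2 / fact (N + l - 1)) *
      (LINT r|lborel. (r ^ (2 * (N + l) - 1) * indicator {0<..} r) *\<^sub>R
        (laguerre_weight c \<sigma> (N - 1 + 2 * l) (k - l) r * g r)))"

text \<open>
  The convolution of \<open>g P\<close> with a Laguerre function on \<open>C^n\<close> in terms of \<open>N = n + p + q\<close> and
  \<open>k - p\<close>. The exponent \<open>m0\<close> of the integrability assumption may be smaller than the one
  natural for \<open>C^n\<close>, because the Laguerre weights compensate powers of \<open>r\<close>: this is how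
  integrability of \<open>g P\<close> on \<open>C^n\<close> suffices for the convolution of \<open>g\<close> on \<open>C^N\<close>.
\<close>
lemma scalar_hecke_bochner:
  fixes P :: "complex ^ 'n::finite \<Rightarrow> complex" and g :: "real \<Rightarrow> complex"
  assumes c: "c > 0" and P: "P \<in> Hpq p q" and g: "g \<in> borel_measurable borel"
    and int: "integrable lborel (\<lambda>r. (r ^ m0 * indicator {0<..} r) *\<^sub>R g r)"
    and m0: "m0 \<le> 2 * CARD('n) + p + q - 1"
  shows "scalar_twisted_conv c (\<lambda>w. g (norm w) * P w)
      (\<lambda>w. of_real (laguerre (CARD('n) - 1) k (c * (norm w)\<^sup>2 / 2) * exp (- (c * (norm w)\<^sup>2 / 4)))) z =
    (if p \<le> k then of_real (c / 2) ^ (p + q) * of_real pi ^ CARD('n) * P z *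
       radial_twisted_conv (CARD('n) + p + q) (k - p) c ((norm z)\<^sup>2) g else 0)"
proof -
  define n where "n = CARD('n)"
  have n: "n > 0" by (simp add: n_def)
  define \<sigma> where "\<sigma> = (norm z)\<^sup>2"
  have \<sigma>: "\<sigma> \<ge> 0" by (simp add: \<sigma>_def)
  define \<beta> where "\<beta> = complex_of_real (c / 2)"
  let ?X = "\<lambda>w. cdot z (cconj w)" and ?Y = "\<lambda>w. cdot (cconj z) w"
  let ?\<phi> = "\<lambda>w::complex^'n. complex_of_real (laguerre (n - 1) k (c * (norm w)\<^sup>2 / 2) * exp (- (c * (norm w)\<^sup>2 / 4)))"
  note [measurable] = g
  obtain e where e: "weval e = P" using P by (rule Hpq_wpoly)
  have [measurable]: "P \<in> borel_measurable borel"
    unfolding e[symmetric] by (intro borel_measurable_continuous_onI continuous_on_weval)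
  have [measurable]: "?X \<in> borel_measurable borel" "?\<phi> \<in> borel_measurable borel"
    unfolding laguerre_def by (intro borel_measurable_continuous_onI continuous_intros; simp)+
  define J where "J i a' k' = (LINT r|lborel. (r ^ (2 * (n + q + i) - 1) * indicator {0<..} r) *\<^sub>R
        (laguerre_weight c \<sigma> a' k' r * g r))" for i a' k'
  define A where "A i = of_real pi ^ n * fact i * fact (q + (i - p)) / fact (i - p) *
        of_real \<sigma> ^ (i - p) * P z * (2 / fact (n + q + i - 1))" for i
  \<comment> \<open>\<open>T i s\<close> is the integral of the term of the kernel expansion with indices \<open>i\<close> and \<open>s\<close>; here
    \<open>q + (i - p)\<close> is the exponent of \<open>Y\<close> that pairs with \<open>X^i\<close>.\<close>
  define T where "T i s = (if p \<le> i \<and> s \<le> q + (i - p)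
       then \<beta> ^ (q + (i - p) - s) / fact (q + (i - p) - s) * (A i * J i (n - 1 + i + s) (k - i - s)) else 0)" for i s
  have T: "has_bochner_integral lborel
      (\<lambda>w. ?X w ^ i * ?Y w ^ s * exp (\<beta> * ?Y w) * P w *
        (laguerre_weight c \<sigma> (n - 1 + i + s) (k - i - s) (norm w) * g (norm w))) (T i s)" for i s
  proof -
    have "exp_integrable (2 * CARD('n) + p + q - 1) (\<lambda>r. laguerre_weight c \<sigma> (n - 1 + i + s) (k - i - s) r * g r)"
    proof -
      obtain j where "2 * CARD('n) + p + q - 1 = m0 + j" using m0 le_Suc_ex by blast
      moreover have "integrable lborel (\<lambda>r. (r ^ (m0 + j) * indicator {0<..} r) *\<^sub>R
          (of_real (r ^ m * exp (B * r)) * (laguerre_weight c \<sigma> (n - 1 + i + s) (k - i - s) r * g r)))" for m B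
      proof -
        have "integrable lborel (\<lambda>r. (r ^ m0 * indicator {0<..} r) *\<^sub>R
          (of_real (r ^ (j + m) * exp (B * r)) * (laguerre_weight c \<sigma> (n - 1 + i + s) (k - i - s) r * g r)))"
          using exp_integrable_laguerre_weight[OF c \<sigma> g int] unfolding exp_integrable_def by blast
        then show ?thesis
          by (simp add: power_add scaleR_conv_of_real mult_ac)
      qed
      ultimately show ?thesis unfolding exp_integrable_def by simp
    qed
    from exp_moment[OF P this, of z i s \<beta>] show ?thesis
      unfolding T_def A_def J_def n_def \<sigma>_def by simp
  qed
  have "scalar_twisted_conv c (\<lambda>w. g (norm w) * P w) ?\<phi> z =
      (LINT w|lborel. g (norm (z - w)) * P (z - w) * ?\<phi> w * exp (\<i> / 2 * of_real c * of_real (Im (?X w))))"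
    unfolding scalar_twisted_conv_def by (rule integral_completion) measurable
  also have "\<dots> = (LINT w|lborel. g (norm (z - (z - w))) * P (z - (z - w)) * ?\<phi> (z - w) *
      exp (\<i> / 2 * of_real c * of_real (Im (?X (z - w)))))"
    by (rule lborel_integral_reflect[symmetric]) measurable
  also have "\<dots> = (LINT w|lborel. (\<Sum>i\<le>k. \<Sum>s\<le>k - i. \<beta> ^ i / fact i * (\<beta> ^ s / fact s) *
      (?X w ^ i * ?Y w ^ s * exp (\<beta> * ?Y w) * P w *
        (laguerre_weight c \<sigma> (n - 1 + i + s) (k - i - s) (norm w) * g (norm w)))))"
  proof (rule Bochner_Integration.integral_cong)
    fix w
    have "?X (z - w) = of_real \<sigma> - ?X w"
      using cdot_cconj_self[of z]
      by (simp add: cdot_def cconj_def \<sigma>_def right_diff_distrib sum_subtractf)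
    then have "exp (\<i> / 2 * of_real c * of_real (Im (?X (z - w)))) = exp (- (\<i> / 2 * of_real c * of_real (Im (?X w))))"
      by simp
    then have "g (norm (z - (z - w))) * P (z - (z - w)) * ?\<phi> (z - w) *
      exp (\<i> / 2 * of_real c * of_real (Im (?X (z - w)))) =
      g (norm w) * P w * (?\<phi> (z - w) * exp (- (\<i> / 2 * of_real c * of_real (Im (?X w)))))"
      by (simp only: mult.assoc diff_diff_eq2 add_diff_cancel_left')
    also have "\<dots> = (\<Sum>i\<le>k. \<Sum>s\<le>k - i. g (norm w) * P w * (\<beta> ^ i / fact i * (\<beta> ^ s / fact s) *
      (?X w ^ i * ?Y w ^ s * exp (\<beta> * ?Y w) *
        laguerre_weight c \<sigma> (n - 1 + i + s) (k - i - s) (norm w))))"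
      unfolding laguerre_kernel_expansion \<beta>_def[symmetric] \<sigma>_def[symmetric] sum_distrib_left ..
    finally show "g (norm (z - (z - w))) * P (z - (z - w)) * ?\<phi> (z - w) *
      exp (\<i> / 2 * of_real c * of_real (Im (?X (z - w)))) =
      (\<Sum>i\<le>k. \<Sum>s\<le>k - i. \<beta> ^ i / fact i * (\<beta> ^ s / fact s) *
      (?X w ^ i * ?Y w ^ s * exp (\<beta> * ?Y w) * P w *
        (laguerre_weight c \<sigma> (n - 1 + i + s) (k - i - s) (norm w) * g (norm w))))"
      by (simp only: mult_ac)
  qed simp
  also have "\<dots> = (\<Sum>i\<le>k. \<Sum>s\<le>k - i. \<beta> ^ i / fact i * (\<beta> ^ s / fact s) * T i s)"
    by (rule has_bochner_integral_integral_eq) (intro has_bochner_integral_sum has_bochner_integral_mult_right T)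
  also have "\<dots> = (\<Sum>i\<le>k. if p \<le> i then of_real (c / 2) ^ (p + q) * of_real pi ^ n * P z *
      (of_real (c / 2) ^ (2 * (i - p)) * of_real \<sigma> ^ (i - p) / fact (i - p) * (2 / fact (n + q + i - 1)) *
        J i (n - 1 + i + (q + (i - p))) (k - i)) else 0)"
  proof (rule sum.cong)
    fix i
    show "(\<Sum>s\<le>k - i. \<beta> ^ i / fact i * (\<beta> ^ s / fact s) * T i s) =
      (if p \<le> i then of_real (c / 2) ^ (p + q) * of_real pi ^ n * P z *
      (of_real (c / 2) ^ (2 * (i - p)) * of_real \<sigma> ^ (i - p) / fact (i - p) * (2 / fact (n + q + i - 1)) *
        J i (n - 1 + i + (q + (i - p))) (k - i)) else 0)"
    proof (cases "p \<le> i")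
      case True
      define b where "b = q + (i - p)"
      have "(\<Sum>s\<le>k - i. \<beta> ^ i / fact i * (\<beta> ^ s / fact s) * T i s) =
        (\<Sum>s\<le>k - i. \<beta> ^ (i + b) / fact i * A i *
          (if s \<le> b then J i (n - 1 + i + s) (k - i - s) / (fact s * fact (b - s)) else 0))"
      proof (rule sum.cong)
        fix s
        show "\<beta> ^ i / fact i * (\<beta> ^ s / fact s) * T i s = \<beta> ^ (i + b) / fact i * A i *
          (if s \<le> b then J i (n - 1 + i + s) (k - i - s) / (fact s * fact (b - s)) else 0)"
        proof (cases "s \<le> b")
          case sb: True
          have "\<beta> ^ (i + b) = \<beta> ^ i * (\<beta> ^ s * \<beta> ^ (b - s))"
            using sb by (simp flip: power_add)
          with sb True show ?thesis by (simp add: T_def b_def[symmetric] mult_ac)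
        qed (simp add: T_def b_def[symmetric])
      qed simp
      \<comment> \<open>Vandermonde's identity raises the type of the Laguerre polynomial by \<open>b\<close>.\<close>
      also have "\<dots> = \<beta> ^ (i + b) / fact i * A i * (J i (n - 1 + i + b) (k - i) / fact b)"
      proof -
        have "m0 \<le> 2 * (n + q + i) - 1"
          using m0 True by (simp add: n_def)
        from laguerre_weight_vandermonde[OF c \<sigma> g int this]
        show ?thesis
          unfolding sum_distrib_left[symmetric] J_def by simp
      qed
      also have "i + b = p + q + 2 * (i - p)"
        using True by (simp add: b_def)
      finally show ?thesis
        using True by (simp add: A_def b_def[symmetric] \<beta>_def power_add)
    qed (simp add: T_def)
  qed simp
  also have "\<dots> = (if p \<le> k then of_real (c / 2) ^ (p + q) * of_real pi ^ n * P z *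
       radial_twisted_conv (n + p + q) (k - p) c \<sigma> g else 0)"
  proof (cases "p \<le> k")
    case True
    have "(\<Sum>i\<le>k. if p \<le> i then of_real (c / 2) ^ (p + q) * of_real pi ^ n * P z *
      (of_real (c / 2) ^ (2 * (i - p)) * of_real \<sigma> ^ (i - p) / fact (i - p) * (2 / fact (n + q + i - 1)) *
        J i (n - 1 + i + (q + (i - p))) (k - i)) else 0) =
      (\<Sum>i\<in>{p..k}. of_real (c / 2) ^ (p + q) * of_real pi ^ n * P z *
      (of_real (c / 2) ^ (2 * (i - p)) * of_real \<sigma> ^ (i - p) / fact (i - p) * (2 / fact (n + q + i - 1)) *
        J i (n - 1 + i + (q + (i - p))) (k - i)))"
      by (rule sum.mono_neutral_cong_right) auto
    also have "\<dots> = (\<Sum>l\<le>k - p. of_real (c / 2) ^ (p + q) * of_real pi ^ n * P z *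
      (of_real (c / 2) ^ (2 * l) * of_real \<sigma> ^ l / fact l * (2 / fact (n + p + q + l - 1)) *
        J (p + l) (n + p + q - 1 + 2 * l) (k - p - l)))"
    proof (rule sum.reindex_bij_witness[of _ "\<lambda>l. p + l" "\<lambda>i. i - p"])
      fix i assume i: "i \<in> {p..k}"
      then obtain l where l: "i = p + l" using le_Suc_ex by auto
      have "n - 1 + (p + l) + (q + l) = n + p + q - 1 + 2 * l" "n + q + (p + l) = n + p + q + l"
        using n by simp_all
      then show "of_real (c / 2) ^ (p + q) * of_real pi ^ n * P z *
          (of_real (c / 2) ^ (2 * (i - p)) * of_real \<sigma> ^ (i - p) / fact (i - p) * (2 / fact (n + p + q + (i - p) - 1)) *
          J (p + (i - p)) (n + p + q - 1 + 2 * (i - p)) (k - p - (i - p))) =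
        of_real (c / 2) ^ (p + q) * of_real pi ^ n * P z *
          (of_real (c / 2) ^ (2 * (i - p)) * of_real \<sigma> ^ (i - p) / fact (i - p) * (2 / fact (n + q + i - 1)) *
          J i (n - 1 + i + (q + (i - p))) (k - i))"
        unfolding l by (simp only: add_diff_cancel_left' diff_diff_left)
    qed (use True in auto)
    also have "\<dots> = of_real (c / 2) ^ (p + q) * of_real pi ^ n * P z * radial_twisted_conv (n + p + q) (k - p) c \<sigma> g"
    proof -
      have "n + q + (p + l) = n + p + q + l" for l by simp
      then show ?thesis
        unfolding radial_twisted_conv_def J_def sum_distrib_left by (simp only:)
    qed
    finally show ?thesis using True by simp
  qed auto
  finally show ?thesis
    unfolding n_def \<sigma>_def .
qed

section \<open>Reduction of the H-type convolution to the scalar one\<close>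

lemma inner_realify: "realify z \<bullet> realify w = z \<bullet> (w :: complex ^ 'n::finite)"
proof -
  have "realify z \<bullet> realify w = (\<Sum>i\<in>UNIV <+> UNIV. realify z $ i * realify w $ i)"
    by (simp add: inner_vec_def)
  also have "\<dots> = (\<Sum>j\<in>UNIV. Re (z $ j) * Re (w $ j)) + (\<Sum>j\<in>UNIV. Im (z $ j) * Im (w $ j))"
    by (subst sum.Plus) (auto simp: realify_def)
  also have "\<dots> = z \<bullet> w"
    by (simp add: inner_vec_def inner_complex_def sum.distrib)
  finally show ?thesis .
qed

lemma inner_act: "orthogonal_matrix A \<Longrightarrow> act A z \<bullet> act A w = z \<bullet> w"
proof -
  assume "orthogonal_matrix A"
  then have "orthogonal_transformation ((*v) A)"
    by (simp add: orthogonal_transformation_matrix)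
  then show ?thesis
    by (simp add: act_def inner_realify[symmetric] orthogonal_transformation_def)
qed

lemma act_add: "act A (z + w) = act A z + act A w" and act_scaleR: "act A (r *\<^sub>R z) = r *\<^sub>R act A z"
proof -
  have "realify (z + w) = realify z + realify w" "realify (r *\<^sub>R z) = r *\<^sub>R realify z"
    by (auto simp: realify_def vec_eq_iff split: sum.split)
  moreover have "cplx (x + y) = cplx x + cplx y" "cplx (r *\<^sub>R x) = r *\<^sub>R cplx x" for x y
    by (auto simp: cplx_def vec_eq_iff complex_eq_iff)
  ultimately show "act A (z + w) = act A z + act A w" "act A (r *\<^sub>R z) = r *\<^sub>R act A z"
    by (simp_all add: act_def matrix_vector_right_distrib matrix_vector_mult_scaleR)
qed

lemma orthogonal_transformation_act: "orthogonal_matrix A \<Longrightarrow> orthogonal_transformation (act A)"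
  unfolding orthogonal_transformation_def
  by (auto intro!: linearI simp: act_add act_scaleR inner_act)

lemma eigenvector_real_parts:
  assumes "complex_eigenvector M (\<i> * of_real c) (\<chi> i. Complex (u $ i) (v $ i))"
  shows "M *v u = - c *\<^sub>R v" "M *v v = c *\<^sub>R u"
proof -
  have *: "(\<Sum>l\<in>UNIV. complex_of_real (M $ i $ l) * Complex (u $ l) (v $ l)) = \<i> * of_real c * Complex (u $ i) (v $ i)" for i
    using assms by (simp add: complex_eigenvector_def vec_eq_iff matrix_vector_mult_def)
  show "M *v u = - c *\<^sub>R v"
    using arg_cong[OF *, of Re] by (simp add: vec_eq_iff matrix_vector_mult_def)
  show "M *v v = c *\<^sub>R u"
    using arg_cong[OF *, of Im] by (simp add: vec_eq_iff matrix_vector_mult_def)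
qed

lemma frame_matrix_mult:
  fixes u v :: "'n::finite \<Rightarrow> real ^ ('n + 'n)"
  shows "frame_matrix u v *v realify z =
    (\<Sum>j\<in>UNIV. (sqrt 2 * Re (z $ j)) *\<^sub>R v j + (sqrt 2 * Im (z $ j)) *\<^sub>R u j)"
proof -
  have "(frame_matrix u v *v realify z) $ i = (\<Sum>c\<in>UNIV <+> UNIV. frame_matrix u v $ i $ c * realify z $ c)" for i
    by (simp add: matrix_vector_mult_def)
  also have "\<dots> i = (\<Sum>j\<in>UNIV. sqrt 2 * v j $ i * Re (z $ j)) + (\<Sum>j\<in>UNIV. sqrt 2 * u j $ i * Im (z $ j))" for i
    by (subst sum.Plus) (auto simp: realify_def frame_matrix_def)
  finally show ?thesis
    by (simp add: vec_eq_iff sum.distrib mult_ac)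
qed

text \<open>
  In the frame \<open>A\<close> the matrix \<open>V_\<lambda>\<close> acts as \<open>|\<lambda>|\<close> times multiplication by \<open>i\<close>, and the real
  inner product of \<open>z\<close> with \<open>i w\<close> is \<open>Im(z \<cdot> cnj w)\<close>.
\<close>
lemma twisted_phase:
  fixes U :: "'m::finite \<Rightarrow> real ^ ('n + 'n) ^ ('n::finite + 'n)"
  assumes "adapted_matrix U lam A"
  shows "orthogonal_matrix A"
    and "(\<Sum>j\<in>UNIV. lam $ j * Re (cdot (act A z) (cconj (act (U j) (act A w))))) =
      norm lam * Im (cdot z (cconj w))"
proof -
  obtain u v where uv: "(\<forall>j. complex_eigenvector (Vmat U lam) (\<i> * of_real (norm lam))
            (\<chi> i. Complex (u j $ i) (v j $ i)) \<and>
          complex_eigenvector (Vmat U lam) (- \<i> * of_real (norm lam))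
            (\<chi> i. Complex (u j $ i) (- v j $ i))) \<and>
     A = frame_matrix u v \<and> orthogonal_matrix A"
    using assms unfolding adapted_matrix_def by (elim exE)
  then have ev: "complex_eigenvector (Vmat U lam) (\<i> * of_real (norm lam)) (\<chi> i. Complex (u j $ i) (v j $ i))" for j
    by simp
  have A: "A = frame_matrix u v"
    using uv by (rule conjunct1[OF conjunct2])
  have orth: "orthogonal_matrix A"
    using uv by (rule conjunct2[OF conjunct2])
  show "orthogonal_matrix A" by (rule orth)
  note VU = eigenvector_real_parts[OF ev]
  have VA: "Vmat U lam *v (A *v realify w) = norm lam *\<^sub>R (A *v realify (\<i> *s w))"
  proof -
    have "Vmat U lam *v (A *v realify w) =
      (\<Sum>j\<in>UNIV. Vmat U lam *v ((sqrt 2 * Re (w $ j)) *\<^sub>R v j + (sqrt 2 * Im (w $ j)) *\<^sub>R u j))"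
      unfolding A frame_matrix_mult by (simp add: linear_sum[OF matrix_vector_mul_linear])
    also have "\<dots> = norm lam *\<^sub>R (A *v realify (\<i> *s w))"
      unfolding A frame_matrix_mult
      by (simp add: matrix_vector_right_distrib matrix_vector_mult_scaleR VU scaleR_sum_right algebra_simps)
    finally show ?thesis .
  qed
  have "(\<Sum>j\<in>UNIV. lam $ j * Re (cdot (act A z) (cconj (act (U j) (act A w))))) =
    (\<Sum>j\<in>UNIV. lam $ j * ((A *v realify z) \<bullet> (U j *v (A *v realify w))))"
    by (simp add: Re_cdot_cconj inner_realify[symmetric] act_def)
  also have "\<dots> = (A *v realify z) \<bullet> (Vmat U lam *v (A *v realify w))"
  proof -
    have "Vmat U lam *v x = (\<Sum>j\<in>UNIV. lam $ j *\<^sub>R (U j *v x))" for x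
      by (simp add: Vmat_def matrix_vector_mult_def vec_eq_iff sum_distrib_left sum_distrib_right mult.assoc)
        (subst sum.swap, simp)
    then show ?thesis by (simp add: inner_sum_right)
  qed
  also have "\<dots> = norm lam * (act A z \<bullet> act A (\<i> *s w))"
    unfolding VA by (simp add: inner_realify[symmetric] act_def)
  also have "\<dots> = norm lam * Re (cdot z (cconj (\<i> *s w)))"
    by (simp add: inner_act[OF orth] Re_cdot_cconj)
  also have "\<dots> = norm lam * Im (cdot z (cconj w))"
    by (simp add: cconj_scale cdot_minus_right cdot_scale)
  finally show "(\<Sum>j\<in>UNIV. lam $ j * Re (cdot (act A z) (cconj (act (U j) (act A w))))) =
      norm lam * Im (cdot z (cconj w))" .
qed

lemma laguerre_fun_scaled_eq:
  "laguerre_fun_scaled k lam w = of_real (laguerre (CARD('N) - 1) k (norm lam * (norm w)\<^sup>2 / 2) *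
     exp (- (norm lam * (norm w)\<^sup>2 / 4)))" for w :: "complex ^ 'N::finite"
  by (simp add: laguerre_fun_scaled_def laguerre_fun_def power_mult_distrib)

lemma continuous_on_laguerre_fun_scaled: "continuous_on S (laguerre_fun_scaled k lam)"
  unfolding laguerre_fun_scaled_eq[abs_def] laguerre_def by (intro continuous_intros) auto

lemma scalar_twisted_conv_cong:
  fixes P :: "complex ^ 'N::finite \<Rightarrow> complex"
  assumes g': "g' \<in> borel_measurable borel" and eq: "AE r in lborel. r > 0 \<longrightarrow> g r = g' r"
    and P: "continuous_on UNIV P" and h: "continuous_on UNIV h"
  shows "scalar_twisted_conv c (\<lambda>w. g (norm w) * P w) h z = scalar_twisted_conv c (\<lambda>w. g' (norm w) * P w) h z"
proof -
  note [measurable] = g' borel_measurable_continuous_onI[OF P] borel_measurable_continuous_onI[OF h]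
  have [measurable]: "(\<lambda>w. cdot z (cconj w)) \<in> borel_measurable borel"
    by (intro borel_measurable_continuous_onI continuous_intros)
  let ?F = "\<lambda>g w. g (norm (z - w)) * P (z - w) * h w * exp (\<i> / 2 * of_real c * of_real (Im (cdot z (cconj w))))"
  have m: "?F g' \<in> borel_measurable borel" by measurable
  have "AE w in lborel. w \<noteq> z"
    by (rule AE_lborel_singleton)
  with AE_radial(1)[OF eq, of z]
  have "AE w in lborel. ?F g w = ?F g' w"
    by eventually_elim simp
  from integral_lebesgue_borel_version[OF m this] integral_lebesgue_borel_version[OF m AE_I2[OF refl]]
  show ?thesis
    unfolding scalar_twisted_conv_def by simp
qed

text \<open>
  Substitution of \<open>A w\<close> for \<open>w\<close>, after \<open>g\<close> has been replaced by a Borel function that equals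
  it almost everywhere.
\<close>
lemma twisted_conv_adapted:
  fixes U :: "'m::finite \<Rightarrow> real ^ ('n + 'n) ^ ('n::finite + 'n)" and P :: "complex ^ 'n \<Rightarrow> complex"
  assumes A: "adapted_matrix U lam A"
    and g': "g' \<in> borel_measurable borel" and eq: "AE r in lborel. r > 0 \<longrightarrow> g r = g' r"
    and P: "continuous_on UNIV P"
  shows "twisted_conv U lam (\<lambda>w. g (norm w) * P w) (laguerre_fun_scaled k lam) (act A z) =
    scalar_twisted_conv (norm lam) (\<lambda>w. g' (norm w) * P (act A w)) (laguerre_fun_scaled k lam) z"
proof -
  note orth = orthogonal_transformation_act[OF twisted_phase(1)[OF A]]
  have nrm: "norm (act A w) = norm w" for w
    using orth by (rule orthogonal_transformation_norm)
  have lin: "linear (act A)" using orth by (rule orthogonal_transformation_linear)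
  have cont: "continuous_on S (act B)" for S B
    by (intro linear_continuous_on) (simp add: linear_conv_bounded_linear[symmetric] linearI act_add act_scaleR)
  let ?\<phi> = "laguerre_fun_scaled k lam :: complex ^ 'n \<Rightarrow> complex"
  let ?E = "\<lambda>w. exp (\<i> / 2 * of_real (\<Sum>j\<in>UNIV. lam $ j * Re (cdot (act A z) (cconj (act (U j) w)))))"
  let ?F = "\<lambda>g w. g (norm (act A z - w)) * P (act A z - w) * ?\<phi> w * ?E w"
  have [measurable]: "P \<in> borel_measurable borel" "?\<phi> \<in> borel_measurable borel" "act A \<in> borel_measurable borel"
    "?E \<in> borel_measurable borel"
    by (intro borel_measurable_continuous_onI P continuous_on_laguerre_fun_scaled cont
        continuous_intros)+
  note [measurable] = g'
  have m: "?F g' \<in> borel_measurable borel" by measurable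
  have "AE w in lborel. w \<noteq> act A z"
    by (rule AE_lborel_singleton)
  with AE_radial(1)[OF eq, of "act A z"]
  have "AE w in lborel. ?F g w = ?F g' w"
    by eventually_elim simp
  then have "twisted_conv U lam (\<lambda>w. g (norm w) * P w) ?\<phi> (act A z) = (LINT w|lborel. ?F g' w)"
    unfolding twisted_conv_def by (rule integral_lebesgue_borel_version[OF m])
  also have "\<dots> = (LINT w|distr lborel borel (act A). ?F g' w)"
    by (simp add: lborel_distr_orthogonal_transformation[OF orth])
  also have "\<dots> = (LINT w|lborel. ?F g' (act A w))"
    by (rule integral_distr) measurable
  also have "\<dots> = (LINT w|lborel. g' (norm (z - w)) * P (act A (z - w)) * ?\<phi> w *
      exp (\<i> / 2 * of_real (norm lam) * of_real (Im (cdot z (cconj w)))))"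
  proof (rule Bochner_Integration.integral_cong)
    fix w
    have "act A z - act A w = act A (z - w)"
      using lin by (simp add: linear_diff)
    then show "?F g' (act A w) = g' (norm (z - w)) * P (act A (z - w)) * ?\<phi> w *
      exp (\<i> / 2 * of_real (norm lam) * of_real (Im (cdot z (cconj w))))"
      by (simp add: nrm twisted_phase(2)[OF A] laguerre_fun_scaled_eq mult.assoc)
  qed simp
  also have "\<dots> = scalar_twisted_conv (norm lam) (\<lambda>w. g' (norm w) * P (act A w)) ?\<phi> z"
  proof -
    have [measurable]: "(\<lambda>w. cdot z (cconj w)) \<in> borel_measurable borel"
      by (intro borel_measurable_continuous_onI continuous_intros)
    show ?thesis
      unfolding scalar_twisted_conv_def by (rule integral_completion[symmetric]) measurable
  qed
  finally show ?thesis .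
qed

section \<open>The Hecke-Bochner identity for H-type groups\<close>

theorem theorem4p5:
  fixes U :: "'m::finite \<Rightarrow> real ^ ('n + 'n) ^ ('n::finite + 'n)"
    and lam :: "real ^ 'm"
    and A :: "real ^ ('n + 'n) ^ ('n + 'n)"
    and p q k :: nat
    and f P :: "complex ^ 'n \<Rightarrow> complex"
    and g :: "real \<Rightarrow> complex"
  assumes "h_type U"
    and "lam \<noteq> 0"
    and "adapted_matrix U lam A"
    and "P \<in> Hpq_twisted A p q"
    and "f = (\<lambda>z. g (norm z) * P z)"
    and "integrable lebesgue f"
  shows
    "(p \<le> k \<longrightarrow> CARD('N::finite) = CARD('n) + p + q \<longrightarrow>
       (\<forall>z. \<forall>z' :: complex ^ 'N. norm z' = norm z \<longrightarrow>
          twisted_conv U lam f (laguerre_fun_scaled k lam) z =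
            of_real (inverse ((2 * pi) ^ (p + q)) * norm lam ^ (p + q)) * P z *
            scalar_twisted_conv (norm lam) (\<lambda>w. g (norm w)) (laguerre_fun_scaled (k - p) lam) z')) \<and>
     (k < p \<longrightarrow> (\<forall>z. twisted_conv U lam f (laguerre_fun_scaled k lam) z = 0))"
proof (cases "\<exists>w. P w \<noteq> 0")
  \<comment> \<open>For \<open>P = 0\<close> the profile \<open>g\<close> can be arbitrary, even non-measurable, but both sides vanish.\<close>
  case False
  then have "twisted_conv U lam f (laguerre_fun_scaled k lam) z = 0" "P z = 0" for z
    using assms(5) by (simp_all add: twisted_conv_def)
  then show ?thesis by simp
next
  case True
  then obtain w0 where w0: "P w0 \<noteq> 0" by blast
  define c where "c = norm lam"
  have c: "c > 0" using assms(2) by (simp add: c_def)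
  define Q where "Q = (\<lambda>w. P (act A w))"
  have Q: "Q \<in> Hpq p q" using assms(4) by (simp add: Q_def Hpq_twisted_def)
  have orth: "orthogonal_transformation (act A)"
    by (rule orthogonal_transformation_act[OF twisted_phase(1)[OF assms(3)]])
  define T where "T = inv (act A)"
  have AT: "act A (T z) = z" for z
    unfolding T_def using orthogonal_transformation_surj[OF orth] by (rule surj_f_inv_f)
  have T: "linear T" "norm (T z) = norm z" for z
    using orthogonal_transformation_inv[OF orth]
    by (simp_all add: T_def orthogonal_transformation_linear orthogonal_transformation_norm)
  have PQ: "P = (\<lambda>w. Q (T w))" by (simp add: Q_def AT)
  obtain e where e: "bideg (int p) (int q) e" "weval e = Q" using Q by (rule Hpq_wpoly)
  have contQ: "continuous_on S Q" for S
    unfolding e(2)[symmetric] by (rule continuous_on_weval)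
  have contP: "continuous_on UNIV P"
    unfolding PQ by (intro continuous_on_compose2[OF contQ[of UNIV]] linear_continuous_on)
      (simp_all add: T linear_conv_bounded_linear[symmetric])
  have homP: "P (t *\<^sub>R w) = of_real (t ^ (p + q)) * P w" if "t > 0" for t w
    using weval_scaleR[OF e(1) _ _ that, of "T w"]
    by (simp add: PQ linear_scale[OF T(1)] e(2) nat_int_add)
  have meas: "(\<lambda>w. g (norm w) * P w) \<in> borel_measurable lebesgue"
    using assms(5,6) by auto
  obtain g' where g': "g' \<in> borel_measurable borel" and eq: "AE r in lborel. r > 0 \<longrightarrow> g r = g' r"
    by (rule radial_profile_borel[OF contP homP w0 meas])
  note [measurable] = g' borel_measurable_continuous_onI[OF contP]
  have int': "integrable lborel (\<lambda>w. g' (norm w) * P w)"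
  proof -
    have m: "(\<lambda>w. g' (norm w) * P w) \<in> borel_measurable borel" by measurable
    have "AE w in lborel. w \<noteq> (0 :: complex ^ 'n)" by (rule AE_lborel_singleton)
    with AE_radial(2)[OF eq] have "AE w in lborel. f w = g' (norm w) * P w"
      by eventually_elim (simp add: assms(5))
    then have "integrable lebesgue (\<lambda>w. g' (norm w) * P w)"
      using assms(6) m
      by (subst integrable_cong_AE[symmetric, of f]) (auto intro: AE_completion measurable_completion)
    then show ?thesis
      using m by (subst (asm) integrable_completion) simp_all
  qed
  \<comment> \<open>\<open>n\<close> complex dimensions and the degree \<open>p + q\<close> of \<open>P\<close> give the radial exponent \<open>2n + p + q - 1\<close>.\<close>
  define m0 where "m0 = 2 * CARD('n) + p + q - 1"
  have int: "integrable lborel (\<lambda>r. (r ^ m0 * indicator {0<..} r) *\<^sub>R g' r)"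
    using radial_factor_integrable[OF contP homP w0 g' int'] by (simp add: m0_def add.assoc mult.commute)
  have lhs: "twisted_conv U lam f (laguerre_fun_scaled k lam) z =
      (if p \<le> k then of_real (c / 2) ^ (p + q) * of_real pi ^ CARD('n) * P z *
       radial_twisted_conv (CARD('n) + p + q) (k - p) c ((norm z)\<^sup>2) g' else 0)" for z
  proof -
    have "twisted_conv U lam f (laguerre_fun_scaled k lam) z =
      scalar_twisted_conv c (\<lambda>w. g' (norm w) * Q w) (laguerre_fun_scaled k lam) (T z)"
      using twisted_conv_adapted[OF assms(3) g' eq contP, of k "T z"]
      by (simp add: assms(5) AT Q_def c_def)
    also have "\<dots> = (if p \<le> k then of_real (c / 2) ^ (p + q) * of_real pi ^ CARD('n) * Q (T z) *
       radial_twisted_conv (CARD('n) + p + q) (k - p) c ((norm (T z))\<^sup>2) g' else 0)"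
      unfolding laguerre_fun_scaled_eq[abs_def] c_def[symmetric]
      by (rule scalar_hecke_bochner[OF c Q g' int]) (simp add: m0_def)
    finally show ?thesis by (simp add: PQ T)
  qed
  show ?thesis
  proof (intro conjI impI allI)
    fix z :: "complex ^ 'n" and z' :: "complex ^ 'N"
    assume pk: "p \<le> k" and N: "CARD('N) = CARD('n) + p + q" and zz': "norm z' = norm z"
    have "scalar_twisted_conv c (\<lambda>w :: complex ^ 'N. g (norm w)) (laguerre_fun_scaled (k - p) lam) z' =
        scalar_twisted_conv c (\<lambda>w. g' (norm w) * 1) (laguerre_fun_scaled (k - p) lam) z'"
      using scalar_twisted_conv_cong[OF g' eq continuous_on_const[of _ 1] continuous_on_laguerre_fun_scaled]
      by simp
    also have "\<dots> = of_real pi ^ CARD('N) * radial_twisted_conv (CARD('N) + 0 + 0) (k - p) c ((norm z')\<^sup>2) g'"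
    proof -
      \<comment> \<open>The natural exponent on \<open>C^N\<close> is \<open>2n + 2p + 2q - 1\<close>, so it is at least \<open>m0\<close>.\<close>
      have "m0 \<le> 2 * CARD('N) + 0 + 0 - 1"
        by (simp add: m0_def N)
      from scalar_hecke_bochner[OF c one_Hpq g' int this, of "k - p" z']
      show ?thesis
        unfolding laguerre_fun_scaled_eq[abs_def] c_def[symmetric] by simp
    qed
    finally have "scalar_twisted_conv c (\<lambda>w :: complex ^ 'N. g (norm w)) (laguerre_fun_scaled (k - p) lam) z' =
        of_real pi ^ CARD('n) * of_real pi ^ (p + q) *
        radial_twisted_conv (CARD('n) + p + q) (k - p) c ((norm z)\<^sup>2) g'"
      by (simp add: N zz' power_add)
    then show "twisted_conv U lam f (laguerre_fun_scaled k lam) z =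
            of_real (inverse ((2 * pi) ^ (p + q)) * norm lam ^ (p + q)) * P z *
            scalar_twisted_conv (norm lam) (\<lambda>w. g (norm w)) (laguerre_fun_scaled (k - p) lam) z'"
      unfolding lhs c_def[symmetric] using pk
      by (simp add: power_divide power_mult_distrib field_simps)
  qed (simp add: lhs)
qed

end
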